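(* Let $X$ be an infinite-dimensional separable reflexive Banach space (over $\mathbb{K}\in\{\mathbb{R},\mathbb{C}\}$) with the approximation property. Then $X$ admits an equivalent norm such that, for the resulting space $Z$, \[ \mathrm{NA}_\pi(Z\widehat{\otimes}_\pi Z)\subsetneq \mathrm{INA}_\pi(Z\widehat{\otimes}_\pi Z)=Z\widehat{\otimes}_\pi Z. \]
   Context: For a Banach space $X$, $B_X$ denotes the closed unit ball. $X\widehat{\otimes}_\pi Y$ is the completed projective tensor product of Banach spaces $X,Y$ (over the same field), with projective norm $\|\cdot\|_\pi$. $\mathrm{NA}_\pi(X\widehat{\otimes}_\pi Y)$ is the set of $u\in X\widehat{\otimes}_\pi Y$ that can be written as $u=\sum_{n=1}^\infty \lambda_n x_n\otimes y_n$ with $(x_n,y_n)\in B_X\times B_Y$, $\lambda_n\ge 0$ and $\sum_{n=1}^\infty\lambda_n=\|u\|_\pi$. $\mathrm{INA}_\pi(X\widehat{\otimes}_\pi Y)$ is the set of $u\in X\widehat{\otimes}_\pi Y$ for which there is a finite positive Borel measure $\mu$ on $B_X\times B_Y$ (Borel $\sigma$-algebra of the product of the norm topologies) such that $\varphi:B_X\times B_Y\to X\widehat{\otimes}_\pi Y$, $\varphi(x,y)=x\otimes y$, is $\mu$-Bochner integrable, $u=\int_{B_X\times B_Y}\varphi\,d\mu$, and $\|u\|_\pi=\|\mu\|$, where $\|\mu\|=\mu(B_X\times B_Y)$. *)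

theory Defs
  imports "HOL-Analysis.Analysis" "HOL-Library.Function_Algebras"
begin

text \<open>
  Norms that vary over a fixed vector space, and spaces constructed from them, cannot be carried
  by type classes. A normed space is therefore given by a carrier \<open>V\<close> (a subset of an abelian group
  type), a scalar multiplication \<open>s\<close> and a norm \<open>p\<close>; when the carrier is a whole type it is omitted.
\<close>

subsection \<open>Scalars\<close>

text \<open>Up to isometric field isomorphism the only instances are the two given below.\<close>

class real_or_complex = real_normed_field +
  assumes real_or_complex:
    "\<exists>h :: 'a \<Rightarrow> complex.
       (\<forall>x y. h (x + y) = h x + h y) \<and> (\<forall>x y. h (x * y) = h x * h y) \<and>
       (\<forall>x. cmod (h x) = norm x) \<and> (range h = \<real> \<or> range h = UNIV)"

instance real :: real_or_complex
proof
  show "\<exists>h :: real \<Rightarrow> complex.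
       (\<forall>x y. h (x + y) = h x + h y) \<and> (\<forall>x y. h (x * y) = h x * h y) \<and>
       (\<forall>x. cmod (h x) = norm x) \<and> (range h = \<real> \<or> range h = UNIV)"
    by (rule exI[of _ complex_of_real]) (simp add: Reals_def)
qed

instance complex :: real_or_complex
proof
  show "\<exists>h :: complex \<Rightarrow> complex.
       (\<forall>x y. h (x + y) = h x + h y) \<and> (\<forall>x y. h (x * y) = h x * h y) \<and>
       (\<forall>x. cmod (h x) = norm x) \<and> (range h = \<real> \<or> range h = UNIV)"
    by (rule exI[of _ id]) simp
qed

subsection \<open>Normed spaces over the scalar field\<close>

text \<open>The real Banach space structure of the type \<open>'a\<close> is the one underlying the \<open>'k\<close>-Banach space.\<close>

locale banach_space_over = vector_space sX
  for sX :: "'k::real_or_complex \<Rightarrow> 'a::banach \<Rightarrow> 'a" +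
  assumes scale_of_real: "sX (of_real r) x = r *\<^sub>R x"
    and norm_scale: "norm (sX c x) = norm c * norm x"

definition norm_over :: "('k::real_or_complex \<Rightarrow> 'a::ab_group_add \<Rightarrow> 'a) \<Rightarrow> ('a \<Rightarrow> real) \<Rightarrow> bool" where
  "norm_over sX N \<longleftrightarrow>
     (\<forall>x. 0 \<le> N x) \<and> (\<forall>x. N x = 0 \<longrightarrow> x = 0) \<and>
     (\<forall>c x. N (sX c x) = norm c * N x) \<and> (\<forall>x y. N (x + y) \<le> N x + N y)"

definition equivalent_norm :: "('k::real_or_complex \<Rightarrow> 'a::real_normed_vector \<Rightarrow> 'a) \<Rightarrow> ('a \<Rightarrow> real) \<Rightarrow> bool" where
  "equivalent_norm sX N \<longleftrightarrow>
     norm_over sX N \<and> (\<exists>c>0. \<exists>C>0. \<forall>x. c * norm x \<le> N x \<and> N x \<le> C * norm x)"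

definition infinite_dimensional :: "('k::field \<Rightarrow> 'a::ab_group_add \<Rightarrow> 'a) \<Rightarrow> bool" where
  "infinite_dimensional sX \<longleftrightarrow> \<not> (\<exists>B. finite B \<and> module.span sX B = UNIV)"

definition approximation_property :: "('k::real_or_complex \<Rightarrow> 'a::real_normed_vector \<Rightarrow> 'a) \<Rightarrow> bool" where
  "approximation_property sX \<longleftrightarrow>
     (\<forall>K e. compact K \<and> e > 0 \<longrightarrow>
        (\<exists>T. Vector_Spaces.linear sX sX T \<and> (\<exists>C. \<forall>x. norm (T x) \<le> C * norm x) \<and>
             (\<exists>B. finite B \<and> range T \<subseteq> module.span sX B) \<and>
             (\<forall>x\<in>K. norm (T x - x) \<le> e)))"

subsection \<open>Duals, reflexivity and completion\<close>

definition fscale :: "'k::times \<Rightarrow> ('i \<Rightarrow> 'k) \<Rightarrow> 'i \<Rightarrow> 'k" where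
  "fscale c f = (\<lambda>i. c * f i)"

text \<open>
  Functionals on \<open>V\<close> are total functions vanishing outside \<open>V\<close>, so that distinct functionals are
  distinct functions and the vector space operations on the dual are the pointwise ones.
\<close>

definition dual_space :: "'v::ab_group_add set \<Rightarrow> ('k::real_or_complex \<Rightarrow> 'v \<Rightarrow> 'v) \<Rightarrow> ('v \<Rightarrow> real)
    \<Rightarrow> ('v \<Rightarrow> 'k) set" where
  "dual_space V s p = {f.
     (\<forall>x\<in>V. \<forall>y\<in>V. f (x + y) = f x + f y) \<and> (\<forall>c. \<forall>x\<in>V. f (s c x) = c * f x) \<and>
     (\<exists>C. \<forall>x\<in>V. norm (f x) \<le> C * p x) \<and> (\<forall>x. x \<notin> V \<longrightarrow> f x = 0)}"

definition dual_norm :: "'v set \<Rightarrow> ('v \<Rightarrow> real) \<Rightarrow> ('v \<Rightarrow> 'k::real_or_complex) \<Rightarrow> real" where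
  "dual_norm V p f = Sup {norm (f x) | x. x \<in> V \<and> p x \<le> 1}"

definition bidual :: "'v::ab_group_add set \<Rightarrow> ('k::real_or_complex \<Rightarrow> 'v \<Rightarrow> 'v) \<Rightarrow> ('v \<Rightarrow> real)
    \<Rightarrow> (('v \<Rightarrow> 'k) \<Rightarrow> 'k) set" where
  "bidual V s p = dual_space (dual_space V s p) fscale (dual_norm V p)"

definition bidual_norm :: "'v::ab_group_add set \<Rightarrow> ('k::real_or_complex \<Rightarrow> 'v \<Rightarrow> 'v) \<Rightarrow> ('v \<Rightarrow> real)
    \<Rightarrow> (('v \<Rightarrow> 'k) \<Rightarrow> 'k) \<Rightarrow> real" where
  "bidual_norm V s p = dual_norm (dual_space V s p) (dual_norm V p)"

definition canonical :: "'v::ab_group_add set \<Rightarrow> ('k::real_or_complex \<Rightarrow> 'v \<Rightarrow> 'v) \<Rightarrow> ('v \<Rightarrow> real)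
    \<Rightarrow> 'v \<Rightarrow> ('v \<Rightarrow> 'k) \<Rightarrow> 'k" where
  "canonical V s p x = (\<lambda>f. if f \<in> dual_space V s p then f x else 0)"

definition reflexive_space :: "('k::real_or_complex \<Rightarrow> 'a::ab_group_add \<Rightarrow> 'a) \<Rightarrow> ('a \<Rightarrow> real) \<Rightarrow> bool" where
  "reflexive_space sX N \<longleftrightarrow> range (canonical UNIV sX N) = bidual UNIV sX N"

text \<open>
  The completion of a normed space is realised as the closure of its canonical (isometric) image
  in its bidual; its norm is \<open>bidual_norm\<close>.
\<close>

definition completion :: "'v::ab_group_add set \<Rightarrow> ('k::real_or_complex \<Rightarrow> 'v \<Rightarrow> 'v) \<Rightarrow> ('v \<Rightarrow> real)
    \<Rightarrow> (('v \<Rightarrow> 'k) \<Rightarrow> 'k) set" where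
  "completion V s p =
     {u \<in> bidual V s p. \<forall>e>0. \<exists>x\<in>V. bidual_norm V s p (u - canonical V s p x) < e}"

subsection \<open>The completed projective tensor product\<close>

text \<open>
  The algebraic tensor product is the span of the evaluations \<open>A \<mapsto> A x y\<close> in the algebraic dual of
  the space of all bilinear forms.
\<close>

definition bilinear_forms :: "('k::field \<Rightarrow> 'a::ab_group_add \<Rightarrow> 'a) \<Rightarrow> ('k \<Rightarrow> 'b::ab_group_add \<Rightarrow> 'b)
    \<Rightarrow> ('a \<Rightarrow> 'b \<Rightarrow> 'k) set" where
  "bilinear_forms sX sY = {A.
     (\<forall>y. Vector_Spaces.linear sX (*) (\<lambda>x. A x y)) \<and> (\<forall>x. Vector_Spaces.linear sY (*) (A x))}"

definition tensor :: "('k::field \<Rightarrow> 'a::ab_group_add \<Rightarrow> 'a) \<Rightarrow> ('k \<Rightarrow> 'b::ab_group_add \<Rightarrow> 'b)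
    \<Rightarrow> 'a \<Rightarrow> 'b \<Rightarrow> ('a \<Rightarrow> 'b \<Rightarrow> 'k) \<Rightarrow> 'k" where
  "tensor sX sY x y = (\<lambda>A. if A \<in> bilinear_forms sX sY then A x y else 0)"

definition alg_tensor :: "('k::field \<Rightarrow> 'a::ab_group_add \<Rightarrow> 'a) \<Rightarrow> ('k \<Rightarrow> 'b::ab_group_add \<Rightarrow> 'b)
    \<Rightarrow> (('a \<Rightarrow> 'b \<Rightarrow> 'k) \<Rightarrow> 'k) set" where
  "alg_tensor sX sY = module.span fscale {tensor sX sY x y | x y. True}"

definition proj_norm :: "('k::field \<Rightarrow> 'a::ab_group_add \<Rightarrow> 'a) \<Rightarrow> ('a \<Rightarrow> real)
    \<Rightarrow> ('k \<Rightarrow> 'b::ab_group_add \<Rightarrow> 'b) \<Rightarrow> ('b \<Rightarrow> real) \<Rightarrow> (('a \<Rightarrow> 'b \<Rightarrow> 'k) \<Rightarrow> 'k) \<Rightarrow> real" where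
  "proj_norm sX NX sY NY u =
     Inf {(\<Sum>i<n. NX (x i) * NY (y i)) | (n::nat) x y. u = (\<Sum>i<n. tensor sX sY (x i) (y i))}"

type_synonym ('k, 'a, 'b) ptensor = "((('a \<Rightarrow> 'b \<Rightarrow> 'k) \<Rightarrow> 'k) \<Rightarrow> 'k) \<Rightarrow> 'k"

definition ptensor_space :: "('k::real_or_complex \<Rightarrow> 'a::ab_group_add \<Rightarrow> 'a) \<Rightarrow> ('a \<Rightarrow> real)
    \<Rightarrow> ('k \<Rightarrow> 'b::ab_group_add \<Rightarrow> 'b) \<Rightarrow> ('b \<Rightarrow> real) \<Rightarrow> ('k, 'a, 'b) ptensor set" where
  "ptensor_space sX NX sY NY = completion (alg_tensor sX sY) fscale (proj_norm sX NX sY NY)"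

definition ptensor_norm :: "('k::real_or_complex \<Rightarrow> 'a::ab_group_add \<Rightarrow> 'a) \<Rightarrow> ('a \<Rightarrow> real)
    \<Rightarrow> ('k \<Rightarrow> 'b::ab_group_add \<Rightarrow> 'b) \<Rightarrow> ('b \<Rightarrow> real) \<Rightarrow> ('k, 'a, 'b) ptensor \<Rightarrow> real" where
  "ptensor_norm sX NX sY NY = bidual_norm (alg_tensor sX sY) fscale (proj_norm sX NX sY NY)"

definition ptensor :: "('k::real_or_complex \<Rightarrow> 'a::ab_group_add \<Rightarrow> 'a) \<Rightarrow> ('a \<Rightarrow> real)
    \<Rightarrow> ('k \<Rightarrow> 'b::ab_group_add \<Rightarrow> 'b) \<Rightarrow> ('b \<Rightarrow> real) \<Rightarrow> 'a \<Rightarrow> 'b \<Rightarrow> ('k, 'a, 'b) ptensor" where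
  "ptensor sX NX sY NY x y =
     canonical (alg_tensor sX sY) fscale (proj_norm sX NX sY NY) (tensor sX sY x y)"

subsection \<open>Bochner integral for a finite measure\<close>

definition simple_integral_in :: "('k::real_or_complex \<Rightarrow> 'v::ab_group_add \<Rightarrow> 'v) \<Rightarrow> 'c measure
    \<Rightarrow> ('c \<Rightarrow> 'v) \<Rightarrow> 'v" where
  "simple_integral_in s M g =
     (\<Sum>v\<in>g ` space M. s (of_real (measure M (g -` {v} \<inter> space M))) v)"

text \<open>
  The clauses say: \<open>f\<close> is strongly measurable, and \<open>f\<close> is Bochner integrable with integral \<open>u\<close>.
  The library's integral is not applicable because the norm \<open>p\<close> is not that of a type class.
\<close>

definition has_bochner_integral_in :: "'v::ab_group_add set \<Rightarrow> ('k::real_or_complex \<Rightarrow> 'v \<Rightarrow> 'v)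
    \<Rightarrow> ('v \<Rightarrow> real) \<Rightarrow> 'c measure \<Rightarrow> ('c \<Rightarrow> 'v) \<Rightarrow> 'v \<Rightarrow> bool" where
  "has_bochner_integral_in V s p M f u \<longleftrightarrow>
     u \<in> V \<and> f ` space M \<subseteq> V \<and>
     (\<exists>g. (\<forall>i::nat. simple_function M (g i) \<and> g i ` space M \<subseteq> V) \<and>
          (AE z in M. (\<lambda>i. p (f z - g i z)) \<longlonglongrightarrow> 0)) \<and>
     (\<exists>g. (\<forall>i::nat. simple_function M (g i) \<and> g i ` space M \<subseteq> V) \<and>
          (\<lambda>i. \<integral>\<^sup>+ z. ennreal (p (f z - g i z)) \<partial>M) \<longlonglongrightarrow> 0 \<and>
          (\<lambda>i. p (u - simple_integral_in s M (g i))) \<longlonglongrightarrow> 0)"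

subsection \<open>Norm-attaining and integral norm-attaining tensors\<close>

definition unit_ball :: "('a \<Rightarrow> real) \<Rightarrow> 'a set" where
  "unit_ball N = {x. N x \<le> 1}"

definition norm_topology :: "('a::ab_group_add \<Rightarrow> real) \<Rightarrow> 'a topology" where
  "norm_topology N = Metric_space.mtopology UNIV (\<lambda>x y. N (x - y))"

definition balls_borel :: "('a::ab_group_add \<Rightarrow> real) \<Rightarrow> ('b::ab_group_add \<Rightarrow> real) \<Rightarrow> ('a \<times> 'b) measure" where
  "balls_borel NX NY = sigma (unit_ball NX \<times> unit_ball NY)
     {U. openin (subtopology (prod_topology (norm_topology NX) (norm_topology NY))
                             (unit_ball NX \<times> unit_ball NY)) U}"

definition NA_pi :: "('k::real_or_complex \<Rightarrow> 'a::ab_group_add \<Rightarrow> 'a) \<Rightarrow> ('a \<Rightarrow> real)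
    \<Rightarrow> ('k \<Rightarrow> 'b::ab_group_add \<Rightarrow> 'b) \<Rightarrow> ('b \<Rightarrow> real) \<Rightarrow> ('k, 'a, 'b) ptensor set" where
  "NA_pi sX NX sY NY = {u \<in> ptensor_space sX NX sY NY.
     \<exists>l x y. (\<forall>n. 0 \<le> l n \<and> x n \<in> unit_ball NX \<and> y n \<in> unit_ball NY) \<and>
       (\<lambda>m. ptensor_norm sX NX sY NY
              (u - (\<Sum>n<m. fscale (of_real (l n)) (ptensor sX NX sY NY (x n) (y n))))) \<longlonglongrightarrow> 0 \<and>
       l sums ptensor_norm sX NX sY NY u}"

definition INA_pi :: "('k::real_or_complex \<Rightarrow> 'a::ab_group_add \<Rightarrow> 'a) \<Rightarrow> ('a \<Rightarrow> real)
    \<Rightarrow> ('k \<Rightarrow> 'b::ab_group_add \<Rightarrow> 'b) \<Rightarrow> ('b \<Rightarrow> real) \<Rightarrow> ('k, 'a, 'b) ptensor set" where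
  "INA_pi sX NX sY NY = {u \<in> ptensor_space sX NX sY NY.
     \<exists>M. space M = unit_ball NX \<times> unit_ball NY \<and> sets M = sets (balls_borel NX NY) \<and>
       finite_measure M \<and>
       has_bochner_integral_in (ptensor_space sX NX sY NY) fscale (ptensor_norm sX NX sY NY)
         M (\<lambda>(x, y). ptensor sX NX sY NY x y) u \<and>
       ptensor_norm sX NX sY NY u = measure M (space M)}"

end

theory Submission
  imports Defs "HOL-Probability.Probability"
begin

text \<open>
  Every \<open>u\<close> in the completed projective tensor square is approximated by finite sums
  \<open>\<Sum> \<lambda> x \<otimes> y\<close> with \<open>x, y\<close> in the unit ball and total weight close to the norm of \<open>u\<close>. By reflexivity and separability the
  ball is weakly compact and weakly metrisable, so these discrete measures have a limit
  measure of total mass equal to the norm of \<open>u\<close>; its Bochner integral agrees with \<open>u\<close> on finite rank forms,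
  hence on all bounded forms by the approximation property. This works for every equivalent norm.

  For the strict inclusion take a biorthogonal system \<open>(e k, r k)\<close> with summable \<open>e k\<close> and an
  equivalent norm in which \<open>norm (r 0 x) = 1\<close> on the ball forces \<open>norm (r k x) \<le> 1\<close> for all \<open>k\<close>,
  while all sign combinations \<open>e 0 \<plusminus> e 1 \<plusminus> e 2 \<plusminus> ...\<close> lie in the ball. Then \<open>\<Sum> e k \<otimes> e k\<close>, the
  average of \<open>x \<otimes> x\<close> over these combinations, has norm 1. A discrete norm attaining representation
  of it with weights \<open>l n\<close> would make the sequences \<open>n \<mapsto> r k (x n)\<close> unimodular and orthonormal in
  \<open>L\<^sup>2(l)\<close>; by Bessel's inequality \<open>K * l n \<le> 1\<close> for every \<open>K\<close>, which is absurd.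
\<close>

subsection \<open>The scalar field\<close>

text \<open>Weak convergence of both legs passes to the limit in \<open>f x * g y\<close>, but not
  in a general bounded bilinear form. Hence the limit measure is first compared with
  \<open>u\<close> on rank one forms only, and the approximation property has to bridge the gap. The
  measure must live on the Borel sets of the norm topology although compactness is only weak; so the
  limit is taken for random vectors on one probability space, which converge weakly at every point,
  and separability turns weak measurability into norm measurability. The total mass comes out
  exactly because each approximant is a scalar times a probability and the scalars tend to the norm
  of \<open>u\<close>. In the strict inclusion, summability of the \<open>e k\<close> forces the
  functionals \<open>r k\<close> to have unbounded norms. What saves the argument is that only their
  values on one face of the ball matter: attainment puts all atoms of positive weight on that face,
  and the new norm is designed around it.\<close>

definition embed_complex :: "'k::real_or_complex \<Rightarrow> complex" where
  "embed_complex = (SOME h. (\<forall>x y. h (x + y) = h x + h y) \<and> (\<forall>x y. h (x * y) = h x * h y) \<and>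
       (\<forall>x. cmod (h x) = norm x) \<and> (range h = \<real> \<or> range h = UNIV))"

lemma embed_complex_props:
  "(\<forall>x y. embed_complex (x + y) = embed_complex x + embed_complex (y::'k::real_or_complex)) \<and>
   (\<forall>x y. embed_complex (x * y) = embed_complex x * embed_complex (y::'k)) \<and>
   (\<forall>x. cmod (embed_complex (x::'k)) = norm x) \<and>
   (range (embed_complex :: 'k \<Rightarrow> complex) = \<real> \<or> range (embed_complex :: 'k \<Rightarrow> complex) = UNIV)"
  unfolding embed_complex_def using someI_ex[OF real_or_complex[where 'a='k]] .

lemma embed_complex_add: "embed_complex (x + y) = embed_complex x + embed_complex y"
  and embed_complex_mult: "embed_complex (x * y) = embed_complex x * embed_complex y"
  and norm_embed_complex: "cmod (embed_complex x) = norm x"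
  using embed_complex_props by auto

lemma range_embed_complex:
  "range (embed_complex :: 'k::real_or_complex \<Rightarrow> complex) = \<real> \<or>
   range (embed_complex :: 'k \<Rightarrow> complex) = UNIV"
  using embed_complex_props[where 'k='k] by blast

lemma embed_complex_0 [simp]: "embed_complex 0 = 0"
  using embed_complex_add[of 0 0] by simp

lemma embed_complex_diff: "embed_complex (x - y) = embed_complex x - embed_complex y"
  using embed_complex_add[of "x - y" y] by simp

lemma embed_complex_eq_iff: "embed_complex x = embed_complex y \<longleftrightarrow> x = y"
proof
  assume "embed_complex x = embed_complex y"
  then have "norm (x - y) = 0"
    by (metis embed_complex_diff norm_embed_complex cancel_comm_monoid_add_class.diff_cancel norm_zero)
  then show "x = y" by simp
qed auto

lemma embed_complex_1 [simp]: "embed_complex 1 = 1"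
proof -
  have "embed_complex (1::'a) * embed_complex (1::'a) = embed_complex (1::'a)"
    by (metis embed_complex_mult mult_1)
  moreover have "embed_complex (1::'a) \<noteq> 0"
    by (metis embed_complex_0 embed_complex_eq_iff zero_neq_one)
  ultimately show ?thesis by simp
qed

lemma dist_embed_complex: "dist (embed_complex x) (embed_complex y) = dist x y"
  by (simp add: dist_norm norm_embed_complex flip: embed_complex_diff)

lemma continuous_on_embed_complex: "continuous_on S embed_complex"
  by (auto simp: continuous_on_iff dist_embed_complex)

lemma embed_complex_sum: "embed_complex (sum f A) = (\<Sum>i\<in>A. embed_complex (f i))"
  by (induction A rule: infinite_finite_induct) (auto simp: embed_complex_add)

text \<open>The embedding is only known to be additive, multiplicative and isometric. This fixes the
  rationals, and continuity together with density gives the reals.\<close>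

lemma embed_complex_of_real: "embed_complex (of_real r :: 'k::real_or_complex) = of_real r"
proof -
  have nat: "embed_complex (of_nat n :: 'k) = of_nat n" for n
    by (induction n) (auto simp: embed_complex_add)
  have int: "embed_complex (of_int n :: 'k) = of_int n" for n
    by (cases n rule: int_diff_cases) (simp add: embed_complex_diff nat)
  have rat: "embed_complex (of_real (of_rat q) :: 'k) = of_real (of_rat q)" for q
  proof -
    obtain a b where ab: "quotient_of q = (a, b)" by force
    then have q: "q = of_int a / of_int b" and b: "b > 0"
      using quotient_of_div quotient_of_denom_pos by blast+
    have r: "(of_rat q :: real) * of_int b = of_int a"
      using b by (simp add: q of_rat_divide)
    then have "(of_real (of_rat q) :: 'k) * of_int b = of_int a"
      by (metis of_real_mult of_real_of_int_eq)
    then have "embed_complex (of_real (of_rat q) :: 'k) * of_int b = of_int a"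
      by (metis embed_complex_mult int)
    moreover have "of_real (of_rat q) * of_int b = (of_int a :: complex)"
      using r by (metis of_real_mult of_real_of_int_eq)
    ultimately show ?thesis
      using b by (metis mult_right_cancel of_int_eq_0_iff less_irrefl)
  qed
  have "closed {r. embed_complex (of_real r :: 'k) = of_real r}"
    by (intro closed_Collect_eq continuous_intros
        continuous_on_compose2[OF continuous_on_embed_complex[of UNIV]]) auto
  moreover have "\<rat> \<subseteq> {r. embed_complex (of_real r :: 'k) = of_real r}"
    by (auto elim!: Rats_cases simp: rat)
  ultimately have "closure \<rat> \<subseteq> {r. embed_complex (of_real r :: 'k) = of_real r}"
    by (rule closure_minimal[rotated])
  then show ?thesis by (auto simp: Rats_closure_real)
qed

text \<open>The limit of the image sequence is brought back to \<open>'a\<close> because the range,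
  being the real line or the whole plane, is closed.\<close>

instance real_or_complex \<subseteq> heine_borel
proof
  fix f :: "nat \<Rightarrow> 'a"
  assume "bounded (range f)"
  then obtain B where "\<And>n. norm (f n) \<le> B"
    unfolding bounded_iff by blast
  then have "bounded (range (\<lambda>n. embed_complex (f n)))"
    unfolding bounded_iff by (auto simp: norm_embed_complex)
  then obtain l r where r: "strict_mono (r :: nat \<Rightarrow> nat)"
    and lim: "((\<lambda>n. embed_complex (f n)) \<circ> r) \<longlonglongrightarrow> l"
    using bounded_imp_convergent_subsequence by blast
  have "closed (range (embed_complex :: 'a \<Rightarrow> complex))"
    using range_embed_complex[where 'k='a] by (auto simp: closed_complex_Reals)
  then have "l \<in> range (embed_complex :: 'a \<Rightarrow> complex)"
    by (rule closed_sequentially[OF _ _ lim]) (auto simp: o_def)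
  then obtain m :: 'a where m: "l = embed_complex m" by blast
  have "(f \<circ> r) \<longlonglongrightarrow> m"
    using lim unfolding m lim_sequentially by (simp add: dist_embed_complex o_def)
  then show "\<exists>l r. strict_mono (r :: nat \<Rightarrow> nat) \<and> ((f \<circ> r) \<longlongrightarrow> l) sequentially"
    using r by blast
qed

text \<open>Besides measurability, a countable base of the scalars serves later as a countable list
  of yes/no tests that detects convergence.\<close>

instance real_or_complex \<subseteq> second_countable_topology
proof
  obtain B :: "complex set set" where B: "countable B" "topological_basis B"
    using ex_countable_basis by blast
  let ?B = "(\<lambda>U. embed_complex -` U :: 'a set) ` B"
  have "topological_basis ?B"
  proof (rule topological_basisI)
    fix B' :: "'a set" assume "B' \<in> ?B"
    then show "open B'"
      using topological_basis_open[OF B(2)] by (auto intro!: open_vimage continuous_on_embed_complex)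
  next
    fix O' :: "'a set" and x assume "open O'" "x \<in> O'"
    then obtain e where e: "e > 0" "ball x e \<subseteq> O'"
      using openE by blast
    obtain U where "U \<in> B" "embed_complex x \<in> U" "U \<subseteq> ball (embed_complex x) e"
      using topological_basisE[OF B(2), of "ball (embed_complex x) e" "embed_complex x"] e by auto
    then show "\<exists>B'\<in>?B. x \<in> B' \<and> B' \<subseteq> O'"
      using e(2) by (intro bexI[of _ "embed_complex -` U"])
        (auto simp: subset_iff dist_embed_complex)
  qed
  then show "\<exists>B::'a set set. countable B \<and> open = generate_topology B"
    using B(1) by (intro exI[of _ ?B]) (auto simp: topological_basis_imp_subbasis)
qed

instance real_or_complex \<subseteq> banach ..

subsection \<open>Seminormed spaces and their duals\<close>

lemma vector_space_fscale: "vector_space (fscale :: 'k::field \<Rightarrow> ('i \<Rightarrow> 'k) \<Rightarrow> 'i \<Rightarrow> 'k)"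
  by standard (auto simp: fscale_def fun_eq_iff algebra_simps)

interpretation fscale: vector_space "fscale :: 'k::field \<Rightarrow> ('i \<Rightarrow> 'k) \<Rightarrow> 'i \<Rightarrow> 'k"
  by (rule vector_space_fscale)

text \<open>The reverse inequality is the given one for \<open>inverse c\<close>, applied to
  \<open>s c x\<close>.\<close>

lemma homogeneous_if_le:
  fixes s :: "'k::real_normed_field \<Rightarrow> 'v::ab_group_add \<Rightarrow> 'v"
  assumes "vector_space s" and V: "\<And>c x. x \<in> V \<Longrightarrow> s c x \<in> V"
    and nonneg: "\<And>x. x \<in> V \<Longrightarrow> 0 \<le> p x"
    and le: "\<And>c x. x \<in> V \<Longrightarrow> p (s c x) \<le> norm c * p x" and x: "x \<in> V"
  shows "p (s c x) = norm c * p x"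
proof (cases "c = 0")
  case True
  then show ?thesis using le[OF x, of 0] nonneg[OF V[OF x, of 0]] by simp
next
  case False
  interpret vector_space s by fact
  have "p (s (inverse c) (s c x)) \<le> norm (inverse c) * p (s c x)" by (rule le[OF V[OF x]])
  then have "p x \<le> inverse (norm c) * p (s c x)" using False by (simp add: norm_inverse)
  then have "norm c * p x \<le> p (s c x)" using False by (simp add: field_simps)
  then show ?thesis using le[OF x, of c] by simp
qed

text \<open>Seminorms on a carrier, because the same theory serves \<open>N\<close>, the projective
  norm, the dual norms of both, and the oscillation of a sequence of vectors as a function of the
  functional, which is far from definite.\<close>

locale seminormed_space = vector_space s
  for s :: "'k::real_or_complex \<Rightarrow> 'v::ab_group_add \<Rightarrow> 'v" +
  fixes V :: "'v set" and p :: "'v \<Rightarrow> real"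
  assumes subspace_carrier: "subspace V"
    and seminorm_nonneg: "x \<in> V \<Longrightarrow> 0 \<le> p x"
    and seminorm_scale: "x \<in> V \<Longrightarrow> p (s c x) = norm c * p x"
    and seminorm_triangle: "x \<in> V \<Longrightarrow> y \<in> V \<Longrightarrow> p (x + y) \<le> p x + p y"
begin

lemmas carrier_add = subspace_add[OF subspace_carrier]
  and carrier_scale = subspace_scale[OF subspace_carrier]
  and carrier_diff = subspace_diff[OF subspace_carrier]
  and carrier_neg = subspace_neg[OF subspace_carrier]
  and carrier_zero = subspace_0[OF subspace_carrier]
  and carrier_sum = subspace_sum[OF subspace_carrier]

lemma seminorm_zero: "p 0 = 0"
  using seminorm_scale[OF carrier_zero, of 0] by simp

lemma seminorm_minus: "x \<in> V \<Longrightarrow> p (- x) = p x"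
  using seminorm_scale[of x "- 1"] by (simp add: scale_minus_left)

lemma seminorm_diff: "x \<in> V \<Longrightarrow> y \<in> V \<Longrightarrow> p (x - y) \<le> p x + p y"
  using seminorm_triangle[of x "- y"] seminorm_minus[of y] carrier_neg[of y] by simp

section \<open>The Hahn-Banach theorem by way of minimal sublinear functionals\<close>

definition sublinear :: "('v \<Rightarrow> real) \<Rightarrow> bool" where
  "sublinear q \<longleftrightarrow> (\<forall>x\<in>V. \<forall>y\<in>V. q (x + y) \<le> q x + q y) \<and>
     (\<forall>x\<in>V. \<forall>t\<ge>0. q (s (of_real t) x) = t * q x)"

lemma sublinearD:
  assumes "sublinear q"
  shows "x \<in> V \<Longrightarrow> y \<in> V \<Longrightarrow> q (x + y) \<le> q x + q y"
    and "x \<in> V \<Longrightarrow> 0 \<le> t \<Longrightarrow> q (s (of_real t) x) = t * q x"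
    and "q 0 = 0" and "x \<in> V \<Longrightarrow> - q (- x) \<le> q x"
proof -
  show a: "x \<in> V \<Longrightarrow> y \<in> V \<Longrightarrow> q (x + y) \<le> q x + q y" for x y
    using assms by (auto simp: sublinear_def)
  show "x \<in> V \<Longrightarrow> 0 \<le> t \<Longrightarrow> q (s (of_real t) x) = t * q x" for x t
    using assms by (auto simp: sublinear_def)
  then show 0: "q 0 = 0"
    using carrier_zero by fastforce
  show "x \<in> V \<Longrightarrow> - q (- x) \<le> q x"
    using a[of x "- x"] 0 carrier_neg[of x] by simp
qed

text \<open>The classical lowering of \<open>q\<close> in the direction \<open>y\<close>. The
  parameter \<open>t = 1\<close> shows that its value at \<open>- y\<close> is at most
  \<open>- q y\<close>, so it is strictly below \<open>q\<close> unless
  \<open>q (- y) = - q y\<close>.\<close>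

definition shift_down :: "('v \<Rightarrow> real) \<Rightarrow> 'v \<Rightarrow> 'v \<Rightarrow> real" where
  "shift_down q y x = (if x \<in> V then INF t\<in>{0..}. q (x + s (of_real t) y) - t * q y else 0)"

lemma shift_down:
  assumes q: "sublinear q" and y: "y \<in> V"
  shows "sublinear (shift_down q y)" and "x \<in> V \<Longrightarrow> shift_down q y x \<le> q x"
    and "shift_down q y (- y) \<le> - q y"
proof -
  note qD = sublinearD[OF q]
  let ?g = "\<lambda>x t. q (x + s (of_real t) y) - t * q y"
  have mem: "x + s c y \<in> V" if "x \<in> V" for x c
    using that y carrier_add carrier_scale by blast
  \<comment> \<open>Subadditivity for the splitting of \<open>t y\<close> into
    \<open>x + t y\<close> and \<open>- x\<close> bounds the infimum from below.\<close>
  have low: "- q (- x) \<le> ?g x t" if x: "x \<in> V" and t: "t \<ge> 0" for x t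
  proof -
    have "t * q y = q ((x + s (of_real t) y) + (- x))"
      using qD(2)[OF y t] by simp
    also have "\<dots> \<le> q (x + s (of_real t) y) + q (- x)"
      using mem[OF x] carrier_neg[OF x] by (intro qD(1)) auto
    finally show ?thesis by simp
  qed
  have bdd: "bdd_below (?g x ` {0..})" if "x \<in> V" for x
    using low[OF that] by (intro bdd_belowI[of _ "- q (- x)"]) auto
  have le: "shift_down q y x \<le> ?g x t" if "x \<in> V" "t \<ge> 0" for x t
    unfolding shift_down_def using that bdd[OF that(1)] by (auto intro!: cINF_lower)
  have ge: "c \<le> shift_down q y x" if "x \<in> V" "\<And>t. t \<ge> 0 \<Longrightarrow> c \<le> ?g x t" for x c
    unfolding shift_down_def using that by (auto intro!: cINF_greatest)
  show "x \<in> V \<Longrightarrow> shift_down q y x \<le> q x"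
    using le[of x 0] by simp
  show "shift_down q y (- y) \<le> - q y"
    using le[of "- y" 1] carrier_neg[OF y] qD(3) by simp
  have add: "shift_down q y (a + b) \<le> shift_down q y a + shift_down q y b"
    if a: "a \<in> V" and b: "b \<in> V" for a b
  proof -
    have *: "shift_down q y (a + b) \<le> ?g a t1 + ?g b t2" if t: "t1 \<ge> 0" "t2 \<ge> 0" for t1 t2
    proof -
      have "shift_down q y (a + b) \<le> ?g (a + b) (t1 + t2)"
        using t a b by (intro le carrier_add) auto
      also have "(a + b) + s (of_real (t1 + t2)) y
          = (a + s (of_real t1) y) + (b + s (of_real t2) y)"
        by (simp add: scale_left_distrib algebra_simps)
      also have "q \<dots> \<le> q (a + s (of_real t1) y) + q (b + s (of_real t2) y)"
        using mem a b by (intro qD(1)) auto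
      finally show ?thesis by (simp add: algebra_simps)
    qed
    have "shift_down q y (a + b) - ?g b t2 \<le> shift_down q y a" if "t2 \<ge> 0" for t2
      using *[OF _ that] by (intro ge a) (simp add: algebra_simps)
    then have "shift_down q y (a + b) - shift_down q y a \<le> shift_down q y b"
      by (intro ge b) (simp add: algebra_simps)
    then show ?thesis by simp
  qed
  \<comment> \<open>The parameter \<open>r\<close> for the scaled vector corresponds to
    \<open>r / t\<close> for \<open>x\<close>. This one inequality suffices: used again with
    \<open>1 / t\<close> it gives the converse.\<close>
  have scale_le: "t * shift_down q y x \<le> shift_down q y (s (of_real t) x)"
    if x: "x \<in> V" and t: "t > 0" for x t
  proof (rule ge)
    show "s (of_real t) x \<in> V" using x carrier_scale by blast
    fix r :: real assume r: "r \<ge> 0"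
    have "t * shift_down q y x \<le> t * ?g x (r / t)"
      using le[OF x, of "r / t"] r t by (intro mult_left_mono) auto
    also have "\<dots> = t * q (x + s (of_real (r / t)) y) - r * q y"
      using t by (simp add: algebra_simps)
    also have "t * q (x + s (of_real (r / t)) y) = q (s (of_real t) (x + s (of_real (r / t)) y))"
      using t mem[OF x] by (simp add: qD(2))
    also have "s (of_real t) (x + s (of_real (r / t)) y) = s (of_real t) x + s (of_real r) y"
      using t by (simp add: scale_right_distrib del: of_real_mult flip: of_real_mult of_real_divide)
    finally show "t * shift_down q y x \<le> ?g (s (of_real t) x) r" .
  qed
  have scale: "shift_down q y (s (of_real t) x) = t * shift_down q y x"
    if x: "x \<in> V" and t: "t \<ge> 0" for x t
  proof (cases "t = 0")
    case True
    have "shift_down q y 0 \<le> 0" using le[OF carrier_zero, of 0] qD(3) by simp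
    moreover have "0 \<le> shift_down q y 0"
      using low[OF carrier_zero] qD(3) by (intro ge carrier_zero) simp
    ultimately show ?thesis using True by simp
  next
    case False
    then have t: "t > 0" using t by simp
    have "(1 / t) * shift_down q y (s (of_real t) x) \<le> shift_down q y (s (of_real (1 / t)) (s (of_real t) x))"
      using t x carrier_scale by (intro scale_le) auto
    also have "s (of_real (1 / t)) (s (of_real t) x) = x"
      using t by (simp flip: of_real_mult)
    finally show ?thesis
      using scale_le[OF x t] t by (simp add: field_simps)
  qed
  show "sublinear (shift_down q y)"
    unfolding sublinear_def using add scale by blast
qed

lemma ex_minimal_sublinear:
  assumes p0: "sublinear p0"
  obtains q where "sublinear q" "\<And>x. x \<in> V \<Longrightarrow> q x \<le> p0 x"
    "\<And>q' x. sublinear q' \<Longrightarrow> (\<And>x. x \<in> V \<Longrightarrow> q' x \<le> q x) \<Longrightarrow> x \<in> V \<Longrightarrow> q' x = q x"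
proof -
  \<comment> \<open>Sublinearity says nothing outside \<open>V\<close>; fixing the value 0 there
    keeps infima over chains bounded below. The order \<open>P\<close> points downwards, so that a
    maximal element for Zorn is a minimal functional.\<close>
  define A where "A = {q. sublinear q \<and> (\<forall>x\<in>V. q x \<le> p0 x) \<and> (\<forall>x. x \<notin> V \<longrightarrow> q x = 0)}"
  define P where "P a b \<longleftrightarrow> (\<forall>x. b x \<le> (a x :: real))" for a b :: "'v \<Rightarrow> real"
  have cut: "sublinear (\<lambda>x. if x \<in> V then q x else 0)" if "sublinear q" for q
    using that carrier_add carrier_scale unfolding sublinear_def by auto
  have "\<exists>m\<in>A. \<forall>a\<in>A. P m a \<longrightarrow> a = m"
  proof (rule predicate_Zorn)
    show "partial_order_on A (relation_of P A)"
      by (rule partial_order_on_relation_ofI) (auto simp: P_def fun_eq_iff intro: order_trans antisym)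
  next
    fix C assume C: "C \<in> Chains (relation_of P A)"
    show "\<exists>u\<in>A. \<forall>a\<in>C. P a u"
    proof (cases "C = {}")
      case True
      have "(\<lambda>x. if x \<in> V then p0 x else 0) \<in> A"
        using cut[OF p0] by (auto simp: A_def)
      then show ?thesis using True by blast
    next
      case False
      have CA: "q \<in> A" if "q \<in> C" for q
        using C that by (auto simp: Chains_def relation_of_def)
      have tot: "P a b \<or> P b a" if "a \<in> C" "b \<in> C" for a b
        using C that by (auto simp: Chains_def relation_of_def)
      define u where "u x = (INF q\<in>C. q x)" for x
      have low: "- p0 (- x) \<le> q x" if "q \<in> C" "x \<in> V" for q x
        using CA[OF that(1)] sublinearD(4)[of q x] that(2) carrier_neg[OF that(2)]
        by (force simp: A_def)
      have bdd: "bdd_below ((\<lambda>q. q x) ` C)" for x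
      proof (cases "x \<in> V")
        case True
        then show ?thesis using low by (intro bdd_belowI[of _ "- p0 (- x)"]) auto
      next
        case False
        then have "(\<lambda>q. q x) ` C \<subseteq> {0}" using CA by (auto simp: A_def)
        then show ?thesis by (rule bdd_below_mono[rotated]) simp
      qed
      have le: "u x \<le> q x" if "q \<in> C" for q x
        unfolding u_def using that bdd by (auto intro!: cINF_lower)
      have ge: "c \<le> u x" if "\<And>q. q \<in> C \<Longrightarrow> c \<le> q x" for c x
        unfolding u_def using that False by (auto intro!: cINF_greatest)
      have sub: "u (x + y) \<le> u x + u y" if "x \<in> V" "y \<in> V" for x y
      proof -
        have *: "u (x + y) \<le> q1 x + q2 y" if C12: "q1 \<in> C" "q2 \<in> C" for q1 q2
        proof -
          \<comment> \<open>Members of a chain are comparable, so the smaller one replaces both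
            \<open>q1\<close> and \<open>q2\<close>; for a general family the infimum would not be
            subadditive.\<close>
          obtain q where q: "q \<in> C" "q x \<le> q1 x" "q y \<le> q2 y"
            using tot[OF C12] C12 unfolding P_def by (metis order_refl)
          have "u (x + y) \<le> q (x + y)" using q le by blast
          also have "\<dots> \<le> q x + q y"
            using CA[OF q(1)] \<open>x \<in> V\<close> \<open>y \<in> V\<close> by (auto simp: A_def intro: sublinearD)
          finally show ?thesis using q by linarith
        qed
        have "u (x + y) - q2 y \<le> u x" if "q2 \<in> C" for q2
          using *[OF _ that] by (intro ge) (simp add: algebra_simps)
        then have "u (x + y) - u x \<le> u y"
          by (intro ge) (simp add: algebra_simps)
        then show ?thesis by simp
      qed
      have scale: "u (s (of_real t) x) = t * u x" if "x \<in> V" "t \<ge> 0" for x t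
      proof (rule antisym)
        have q: "q (s (of_real t) x) = t * q x" if "q \<in> C" for q
          using CA[OF that] \<open>x \<in> V\<close> \<open>t \<ge> 0\<close> by (auto simp: A_def sublinearD)
        show "t * u x \<le> u (s (of_real t) x)"
          using le that by (intro ge) (auto simp: q intro: mult_left_mono)
        show "u (s (of_real t) x) \<le> t * u x"
        proof (cases "t = 0")
          case True
          obtain q0 where "q0 \<in> C" using False by blast
          then show ?thesis using True le[of q0 0] q[of q0] by simp
        next
          case False
          then have t: "t > 0" using that by simp
          have "u (s (of_real t) x) / t \<le> u x"
          proof (rule ge)
            fix q' assume "q' \<in> C"
            then show "u (s (of_real t) x) / t \<le> q' x"
              using le[of q' "s (of_real t) x"] q[of q'] t by (simp add: field_simps)
          qed
          then show ?thesis using t by (simp add: field_simps)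
        qed
      qed
      have "u x \<le> p0 x" if "x \<in> V" for x
      proof -
        obtain q0 where "q0 \<in> C" using False by blast
        then show ?thesis using le[of q0 x] CA[of q0] that by (force simp: A_def)
      qed
      moreover have "u x = 0" if "x \<notin> V" for x
      proof -
        have "(\<lambda>q. q x) ` C = (\<lambda>q. 0) ` C" using CA that by (intro image_cong) (auto simp: A_def)
        then have "(\<lambda>q. q x) ` C = {0}" using False by auto
        then show ?thesis by (simp add: u_def)
      qed
      ultimately have "u \<in> A"
        unfolding A_def sublinear_def using sub scale by auto
      moreover have "\<forall>a\<in>C. P a u" using le by (auto simp: P_def)
      ultimately show ?thesis by blast
    qed
  qed
  then obtain q where q: "q \<in> A" and min: "\<And>a. a \<in> A \<Longrightarrow> P q a \<Longrightarrow> a = q"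
    by blast
  show ?thesis
  proof (rule that)
    show "sublinear q" "\<And>x. x \<in> V \<Longrightarrow> q x \<le> p0 x" using q by (auto simp: A_def)
    fix q' x assume q': "sublinear q'" "\<And>x. x \<in> V \<Longrightarrow> q' x \<le> q x" and x: "x \<in> V"
    let ?q = "\<lambda>x. if x \<in> V then q' x else 0"
    have "q' y \<le> p0 y" if "y \<in> V" for y
      using q'(2)[OF that] q that by (fastforce simp: A_def)
    then have "?q \<in> A"
      using cut[OF q'(1)] unfolding A_def by simp
    moreover have "P q ?q"
      using q'(2) q by (auto simp: A_def P_def)
    ultimately have "?q = q" by (rule min)
    then have "?q x = q x" by (rule fun_cong)
    then show "q' x = q x" using x by simp
  qed
qed

text \<open>A minimal sublinear functional \<open>q\<close> is linear, since \<open>shift_down q y\<close> is again sublinear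
  and below \<open>q\<close>.\<close>

lemma ex_real_linear_below:
  assumes p0: "sublinear p0"
  obtains g where "\<And>x y. x \<in> V \<Longrightarrow> y \<in> V \<Longrightarrow> g (x + y) = g x + g y"
    "\<And>x t. x \<in> V \<Longrightarrow> g (s (of_real t) x) = t * g x"
    "\<And>x. x \<in> V \<Longrightarrow> g x \<le> p0 x"
proof -
  obtain q where q: "sublinear q" "\<And>x. x \<in> V \<Longrightarrow> q x \<le> p0 x"
    and min: "\<And>q' x. sublinear q' \<Longrightarrow> (\<And>x. x \<in> V \<Longrightarrow> q' x \<le> q x) \<Longrightarrow> x \<in> V \<Longrightarrow> q' x = q x"
    using ex_minimal_sublinear[OF p0] by blast
  note qD = sublinearD[OF q(1)]
  have neg: "q (- y) = - q y" if y: "y \<in> V" for y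
  proof -
    have "shift_down q y (- y) = q (- y)"
      using shift_down[OF q(1) y] carrier_neg[OF y] by (intro min) auto
    then show ?thesis
      using shift_down(3)[OF q(1) y] qD(4)[OF y] by simp
  qed
  show ?thesis
  proof (rule that)
    fix x y assume xy: "x \<in> V" "y \<in> V"
    have "q x = q ((x + y) + (- y))" by simp
    also have "\<dots> \<le> q (x + y) + q (- y)"
      using xy by (intro qD(1) carrier_add carrier_neg)
    finally show "q (x + y) = q x + q y"
      using qD(1)[OF xy] neg[OF xy(2)] by linarith
  next
    fix x and t :: real assume x: "x \<in> V"
    show "q (s (of_real t) x) = t * q x"
    proof (cases "t \<ge> 0")
      case True then show ?thesis using qD(2) x by blast
    next
      case False
      have "q (s (of_real t) x) = q (- s (of_real (- t)) x)" by simp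
      also have "\<dots> = - q (s (of_real (- t)) x)" using x by (intro neg carrier_scale)
      also have "\<dots> = - ((- t) * q x)" using False x qD(2)[of x "- t"] by simp
      finally show ?thesis by simp
    qed
  qed (use q in auto)
qed

lemma sublinear_seminorm: "sublinear p"
  unfolding sublinear_def by (auto simp: seminorm_scale seminorm_triangle)

text \<open>Going below \<open>shift_down p v\<close> instead of \<open>p\<close> itself forces
  \<open>g (- v) \<le> - p v\<close>, and linearity turns this into attainment at
  \<open>v\<close>.\<close>

lemma ex_real_linear_norming:
  assumes v: "v \<in> V"
  obtains g where "\<And>x y. x \<in> V \<Longrightarrow> y \<in> V \<Longrightarrow> g (x + y) = g x + g y"
    "\<And>x t. x \<in> V \<Longrightarrow> g (s (of_real t) x) = t * g x"
    "\<And>x. x \<in> V \<Longrightarrow> g x \<le> p x" "g v = p v"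
proof -
  note sd = shift_down[OF sublinear_seminorm v]
  obtain g where g: "\<And>x y. x \<in> V \<Longrightarrow> y \<in> V \<Longrightarrow> g (x + y) = g x + g y"
    "\<And>x t. x \<in> V \<Longrightarrow> g (s (of_real t) x) = t * g x"
    "\<And>x. x \<in> V \<Longrightarrow> g x \<le> shift_down p v x"
    using ex_real_linear_below[OF sd(1)] by blast
  have le: "g x \<le> p x" if "x \<in> V" for x using g(3) sd(2) that order_trans by blast
  have "g (- v) \<le> - p v" using g(3)[OF carrier_neg[OF v]] sd(3) by linarith
  moreover have "g (- v) = - g v" using g(2)[OF v, of "- 1"] by simp
  ultimately have "g v = p v" using le[OF v] by linarith
  then show ?thesis using that g le by blast
qed

lemma dual_spaceI:
  assumes "\<And>x y. x \<in> V \<Longrightarrow> y \<in> V \<Longrightarrow> f (x + y) = f x + f y"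
    "\<And>c x. x \<in> V \<Longrightarrow> f (s c x) = c * f x"
    "\<And>x. x \<in> V \<Longrightarrow> norm (f x) \<le> C * p x"
  shows "(\<lambda>x. if x \<in> V then f x else 0) \<in> dual_space V s p"
  unfolding dual_space_def using assms carrier_add carrier_scale by (auto intro!: exI[of _ C])

theorem hahn_banach:
  assumes v: "v \<in> V"
  obtains f where "f \<in> dual_space V s p" "f v = of_real (p v)" "\<And>x. x \<in> V \<Longrightarrow> norm (f x) \<le> p x"
proof -
  obtain g where gadd: "\<And>x y. x \<in> V \<Longrightarrow> y \<in> V \<Longrightarrow> g (x + y) = g x + g y"
    and gscale: "\<And>x t. x \<in> V \<Longrightarrow> g (s (of_real t) x) = t * g x"
    and gle: "\<And>x. x \<in> V \<Longrightarrow> g x \<le> p x" and gv: "g v = p v"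
    using ex_real_linear_norming[OF v] by blast
  have gneg: "g (- x) = - g x" if "x \<in> V" for x
    using gscale[OF that, of "- 1"] by simp
  have gabs: "\<bar>g x\<bar> \<le> p x" if "x \<in> V" for x
    using gle[OF that] gle[OF carrier_neg[OF that]] gneg[OF that] seminorm_minus[OF that] by linarith
  show ?thesis
  proof (cases "range (embed_complex :: 'k \<Rightarrow> complex) = \<real>")
    case True
    have real: "\<exists>r. c = of_real r" for c :: 'k
    proof -
      have "embed_complex c \<in> \<real>" using True by blast
      then obtain r where "embed_complex c = of_real r" by (auto elim: Reals_cases)
      then have "embed_complex c = embed_complex (of_real r :: 'k)" by (simp add: embed_complex_of_real)
      then show ?thesis by (auto simp: embed_complex_eq_iff)
    qed
    let ?f = "\<lambda>x. if x \<in> V then of_real (g x) else (0::'k)"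
    have "?f \<in> dual_space V s p"
    proof (rule dual_spaceI[where C = 1])
      fix c :: 'k and x assume x: "x \<in> V"
      obtain r where "c = of_real r" using real[of c] by blast
      then show "of_real (g (s c x)) = c * (of_real (g x) :: 'k)"
        using gscale[OF x] by simp
    qed (use gabs in \<open>auto simp: gadd\<close>)
    then show ?thesis using that[of ?f] v gv gabs by auto
  next
    case False
    then have surj: "range (embed_complex :: 'k \<Rightarrow> complex) = UNIV"
      using range_embed_complex by blast
    define e where "e = (inv embed_complex :: complex \<Rightarrow> 'k)"
    have he: "embed_complex (e z) = z" for z
      using surj unfolding e_def by (metis surj_f_inv_f)
    have eh: "e (embed_complex c) = c" for c :: 'k
      using he[of "embed_complex c"] by (simp add: embed_complex_eq_iff)
    \<comment> \<open>\<open>j\<close> is the imaginary unit of \<open>'k\<close>, and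
      \<open>F\<close> is the usual complexification of the real functional \<open>g\<close>, which
      becomes its real part.\<close>
    define j where "j = e \<i>"
    define F where "F x = Complex (g x) (- g (s j x))" for x
    have jj: "j * j = - 1"
    proof -
      have "embed_complex (j * j) = embed_complex (- 1 :: 'k)"
        using embed_complex_diff[of 0 "1::'k"] by (simp add: j_def embed_complex_mult he)
      then show ?thesis by (simp add: embed_complex_eq_iff)
    qed
    have Fadd: "F (x + y) = F x + F y" if "x \<in> V" "y \<in> V" for x y
      using that by (simp add: F_def gadd scale_right_distrib carrier_scale complex_eq_iff)
    have Freal: "F (s (of_real t) x) = of_real t * F x" if "x \<in> V" for x t
    proof -
      have "s j (s (of_real t) x) = s (of_real t) (s j x)"
        by (simp add: mult.commute)
      then show ?thesis
        using that by (simp add: F_def gscale carrier_scale complex_eq_iff del: scale_scale)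
    qed
    have Fj: "F (s j x) = \<i> * F x" if "x \<in> V" for x
      using that by (simp add: F_def complex_eq_iff jj gneg)
    have Fscale: "F (s c x) = embed_complex c * F x" if x: "x \<in> V" for c x
    proof -
      let ?a = "Re (embed_complex c)" and ?b = "Im (embed_complex c)"
      have "embed_complex c = embed_complex (of_real ?a + of_real ?b * j)"
        by (simp add: embed_complex_add embed_complex_mult embed_complex_of_real j_def he complex_eq_iff)
      then have c: "c = of_real ?a + of_real ?b * j" by (simp add: embed_complex_eq_iff)
      have "s c x = s (of_real ?a) x + s (of_real ?b) (s j x)"
        by (subst c) (simp add: scale_left_distrib)
      then have "F (s c x) = of_real ?a * F x + of_real ?b * (\<i> * F x)"
        using x by (simp add: Fadd Freal Fj carrier_scale del: scale_scale)
      also have "\<dots> = (of_real ?a + \<i> * of_real ?b) * F x" by (simp add: algebra_simps)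
      finally show ?thesis
        by (simp only: complex_eq[of "embed_complex c", symmetric])
    qed
    have Fle: "cmod (F x) \<le> p x" if x: "x \<in> V" for x
    proof (cases "F x = 0")
      case True then show ?thesis using seminorm_nonneg[OF x] by simp
    next
      case False
      \<comment> \<open>Rotation by this scalar of modulus 1 makes the value of \<open>F\<close>
        real and nonnegative, where the real bound on \<open>g\<close> applies.\<close>
      define c where "c = e (cnj (F x) / cmod (F x))"
      have "F (s c x) = cnj (F x) * F x / cmod (F x)"
        using Fscale[OF x] by (simp add: c_def he)
      also have "\<dots> = cmod (F x)"
        using False by (simp add: complex_norm_square[symmetric] mult.commute power2_eq_square)
      finally have "cmod (F x) = g (s c x)" by (simp add: F_def complex_eq_iff)
      also have "\<dots> \<le> p (s c x)" using x by (intro gle carrier_scale)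
      also have "\<dots> = cmod (embed_complex c) * p x" using x by (simp add: seminorm_scale norm_embed_complex)
      also have "\<dots> = p x" using False by (simp add: c_def he norm_divide)
      finally show ?thesis .
    qed
    let ?f = "\<lambda>x. if x \<in> V then e (F x) else (0::'k)"
    have norm_e: "norm (e z) = cmod z" for z
      using norm_embed_complex[of "e z"] he[of z] by simp
    have f: "?f \<in> dual_space V s p"
    proof (rule dual_spaceI[where C = 1])
      fix x y assume "x \<in> V" "y \<in> V"
      then show "e (F (x + y)) = e (F x) + e (F y)"
        by (subst embed_complex_eq_iff[symmetric]) (simp add: he embed_complex_add Fadd)
    next
      fix c :: 'k and x assume "x \<in> V"
      then show "e (F (s c x)) = c * e (F x)"
        by (subst embed_complex_eq_iff[symmetric]) (simp add: he embed_complex_mult Fscale)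
    qed (use Fle norm_e in auto)
    \<comment> \<open>The real part of \<open>F v\<close> already exhausts the bound
      \<open>p v\<close> on the modulus.\<close>
    have "Im (F v) = 0"
    proof -
      have "(Re (F v))\<^sup>2 + (Im (F v))\<^sup>2 \<le> (p v)\<^sup>2"
        using Fle[OF v] by (metis cmod_power2 norm_ge_zero power_mono)
      then show ?thesis using gv by (simp add: F_def)
    qed
    then have "F v = of_real (p v)" using gv by (simp add: F_def complex_eq_iff)
    then have "embed_complex (e (F v)) = embed_complex (of_real (p v) :: 'k)"
      by (simp add: embed_complex_of_real he)
    then have "?f v = of_real (p v)"
      using v by (simp add: embed_complex_eq_iff)
    then show ?thesis using that[of ?f] f Fle norm_e by auto
  qed
qed

end

section \<open>Dual norm, bidual and completion of a seminormed space\<close>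

context seminormed_space
begin

lemma dual_spaceD:
  assumes "f \<in> dual_space V s p"
  shows "x \<in> V \<Longrightarrow> y \<in> V \<Longrightarrow> f (x + y) = f x + f y"
    and "x \<in> V \<Longrightarrow> f (s c x) = c * f x"
    and "x \<notin> V \<Longrightarrow> f x = 0"
  using assms by (auto simp: dual_space_def)

lemma dual_space_zero: "f \<in> dual_space V s p \<Longrightarrow> f 0 = 0"
  using dual_spaceD(2)[of f 0 0] carrier_zero by simp

lemma dual_space_neg: "f \<in> dual_space V s p \<Longrightarrow> x \<in> V \<Longrightarrow> f (- x) = - f x"
  using dual_spaceD(2)[of f x "- 1"] by simp

lemma dual_space_diff: "f \<in> dual_space V s p \<Longrightarrow> x \<in> V \<Longrightarrow> y \<in> V \<Longrightarrow> f (x - y) = f x - f y"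
  using dual_spaceD(1)[of f x "- y"] dual_space_neg[of f y] carrier_neg[of y] by simp

lemma dual_space_sum:
  "f \<in> dual_space V s p \<Longrightarrow> (\<And>i. i \<in> A \<Longrightarrow> g i \<in> V) \<Longrightarrow> f (sum g A) = (\<Sum>i\<in>A. f (g i))"
proof (induction A rule: infinite_finite_induct)
  case (insert a A)
  then show ?case using dual_spaceD(1)[of f "g a" "sum g A"] carrier_sum[of A g] by auto
qed (auto simp: dual_space_zero)

lemma dual_space_bounded:
  assumes "f \<in> dual_space V s p"
  obtains C where "C \<ge> 0" "\<And>x. x \<in> V \<Longrightarrow> norm (f x) \<le> C * p x"
proof -
  obtain C where C: "\<And>x. x \<in> V \<Longrightarrow> norm (f x) \<le> C * p x"
    using assms unfolding dual_space_def by blast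
  have "norm (f x) \<le> \<bar>C\<bar> * p x" if "x \<in> V" for x
    using C[OF that] seminorm_nonneg[OF that] by (meson abs_ge_self mult_right_mono order_trans)
  then show ?thesis using that[of "\<bar>C\<bar>"] by auto
qed

lemma dual_norm_bdd:
  assumes "f \<in> dual_space V s p"
  shows "bdd_above {norm (f x) |x. x \<in> V \<and> p x \<le> 1}"
proof -
  obtain C where C: "C \<ge> 0" "\<And>x. x \<in> V \<Longrightarrow> norm (f x) \<le> C * p x"
    using dual_space_bounded[OF assms] by blast
  have "norm (f x) \<le> C" if "x \<in> V" "p x \<le> 1" for x
    using C(2)[OF that(1)] mult_left_mono[OF that(2) C(1)] by simp
  then show ?thesis by (auto intro!: bdd_aboveI[of _ C])
qed

lemma dual_norm_nonneg: "f \<in> dual_space V s p \<Longrightarrow> 0 \<le> dual_norm V p f"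
  unfolding dual_norm_def using carrier_zero seminorm_zero
  by (intro cSup_upper2[of "norm (f 0)"] dual_norm_bdd) auto

lemma dual_norm_bound:
  assumes f: "f \<in> dual_space V s p" and x: "x \<in> V"
  shows "norm (f x) \<le> dual_norm V p f * p x"
proof (cases "p x = 0")
  case True
  \<comment> \<open>Normalising \<open>x\<close> is impossible here; boundedness makes
    \<open>f\<close> vanish on vectors of seminorm 0.\<close>
  obtain C where C: "C \<ge> 0" "\<And>x. x \<in> V \<Longrightarrow> norm (f x) \<le> C * p x"
    using dual_space_bounded[OF f] by blast
  then show ?thesis using C(2)[OF x] True by simp
next
  case False
  then have px: "p x > 0" using seminorm_nonneg[OF x] by simp
  let ?y = "s (of_real (1 / p x)) x"
  have y: "?y \<in> V" using x by (rule carrier_scale)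
  have "p ?y = 1" using x px by (simp add: seminorm_scale norm_divide)
  then have "norm (f ?y) \<le> dual_norm V p f"
    unfolding dual_norm_def using y by (intro cSup_upper dual_norm_bdd f) auto
  moreover have "norm (f ?y) = norm (f x) / p x"
    using px unfolding dual_spaceD(2)[OF f x] by (simp add: norm_mult norm_divide)
  ultimately have "norm (f x) / p x \<le> dual_norm V p f" by simp
  then show ?thesis using px by (simp add: pos_divide_le_eq)
qed

lemma dual_norm_le:
  assumes "C \<ge> 0" and "\<And>x. x \<in> V \<Longrightarrow> norm (f x) \<le> C * p x"
  shows "dual_norm V p f \<le> C"
  unfolding dual_norm_def
proof (rule cSup_least)
  show "{norm (f x) |x. x \<in> V \<and> p x \<le> 1} \<noteq> {}"
    using carrier_zero seminorm_zero by force
  fix r assume "r \<in> {norm (f x) |x. x \<in> V \<and> p x \<le> 1}"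
  then obtain x where x: "r = norm (f x)" "x \<in> V" "p x \<le> 1" by blast
  then show "r \<le> C" using assms(2)[of x] mult_left_mono[OF x(3) assms(1)] by simp
qed

lemma dual_space_subspace: "fscale.subspace (dual_space V s p)"
proof (rule fscale.subspaceI)
  show "0 \<in> dual_space V s p" by (auto simp: dual_space_def intro!: exI[of _ 0])
next
  fix f g assume fg: "f \<in> dual_space V s p" "g \<in> dual_space V s p"
  obtain C where C: "C \<ge> 0" "\<And>x. x \<in> V \<Longrightarrow> norm (f x) \<le> C * p x"
    using dual_space_bounded[OF fg(1)] by blast
  obtain D where D: "D \<ge> 0" "\<And>x. x \<in> V \<Longrightarrow> norm (g x) \<le> D * p x"
    using dual_space_bounded[OF fg(2)] by blast
  have "norm (f x + g x) \<le> (C + D) * p x" if "x \<in> V" for x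
    using norm_triangle_ineq[of "f x" "g x"] C(2)[OF that] D(2)[OF that]
    by (simp add: algebra_simps)
  then show "f + g \<in> dual_space V s p"
    using fg unfolding dual_space_def by (auto simp: algebra_simps intro!: exI[of _ "C + D"])
next
  fix c f assume f: "f \<in> dual_space V s p"
  obtain C where C: "C \<ge> 0" "\<And>x. x \<in> V \<Longrightarrow> norm (f x) \<le> C * p x"
    using dual_space_bounded[OF f] by blast
  have "norm (c * f x) \<le> (norm c * C) * p x" if "x \<in> V" for x
    using mult_left_mono[OF C(2)[OF that], of "norm c"] by (simp add: norm_mult algebra_simps)
  then show "fscale c f \<in> dual_space V s p"
    using f unfolding dual_space_def by (auto simp: fscale_def algebra_simps intro!: exI[of _ "norm c * C"])
qed

lemma seminormed_space_dual: "seminormed_space fscale (dual_space V s p) (dual_norm V p)"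
proof unfold_locales
  show "fscale.subspace (dual_space V s p)" by (rule dual_space_subspace)
  show "f \<in> dual_space V s p \<Longrightarrow> 0 \<le> dual_norm V p f" for f by (rule dual_norm_nonneg)
next
  fix f g assume f: "f \<in> dual_space V s p" and g: "g \<in> dual_space V s p"
  show "dual_norm V p (f + g) \<le> dual_norm V p f + dual_norm V p g"
  proof (rule dual_norm_le)
    fix x assume x: "x \<in> V"
    show "norm ((f + g) x) \<le> (dual_norm V p f + dual_norm V p g) * p x"
      using norm_triangle_ineq[of "f x" "g x"] dual_norm_bound[OF f x] dual_norm_bound[OF g x]
      by (simp add: algebra_simps)
  qed (use dual_norm_nonneg f g in auto)
next
  fix f c assume f: "f \<in> dual_space V s p"
  have le: "dual_norm V p (fscale c f) \<le> norm c * dual_norm V p f"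
    if f: "f \<in> dual_space V s p" for c f
  proof (rule dual_norm_le)
    fix x assume x: "x \<in> V"
    show "norm (fscale c f x) \<le> (norm c * dual_norm V p f) * p x"
      using mult_left_mono[OF dual_norm_bound[OF f x], of "norm c"]
      by (simp add: fscale_def norm_mult algebra_simps)
  qed (use dual_norm_nonneg[OF f] in auto)
  show "dual_norm V p (fscale c f) = norm c * dual_norm V p f"
    by (rule homogeneous_if_le[where V = "dual_space V s p", OF vector_space_fscale _ dual_norm_nonneg le f])
      (rule fscale.subspace_scale[OF dual_space_subspace])
qed

lemma seminormed_space_bidual: "seminormed_space fscale (bidual V s p) (bidual_norm V s p)"
proof -
  interpret dual: seminormed_space fscale "dual_space V s p" "dual_norm V p"
    by (rule seminormed_space_dual)
  show ?thesis unfolding bidual_def bidual_norm_def by (rule dual.seminormed_space_dual)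
qed

lemma bidual_norm_bound:
  assumes "u \<in> bidual V s p" "f \<in> dual_space V s p"
  shows "norm (u f) \<le> bidual_norm V s p u * dual_norm V p f"
proof -
  interpret dual: seminormed_space fscale "dual_space V s p" "dual_norm V p"
    by (rule seminormed_space_dual)
  show ?thesis using dual.dual_norm_bound assms unfolding bidual_def bidual_norm_def by blast
qed

lemma bidual_norm_le:
  assumes "C \<ge> 0" and "\<And>f. f \<in> dual_space V s p \<Longrightarrow> norm (u f) \<le> C * dual_norm V p f"
  shows "bidual_norm V s p u \<le> C"
proof -
  interpret dual: seminormed_space fscale "dual_space V s p" "dual_norm V p"
    by (rule seminormed_space_dual)
  show ?thesis unfolding bidual_norm_def using assms by (rule dual.dual_norm_le)
qed

text \<open>A norming functional from Hahn-Banach turns a norm estimate into scalar estimates,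
  uniform over the dual.\<close>

lemma seminorm_le_dual:
  assumes x: "x \<in> V" and C: "C \<ge> 0"
    and "\<And>f. f \<in> dual_space V s p \<Longrightarrow> norm (f x) \<le> C * dual_norm V p f"
  shows "p x \<le> C"
proof -
  obtain f where f: "f \<in> dual_space V s p" "f x = of_real (p x)" "\<And>x. x \<in> V \<Longrightarrow> norm (f x) \<le> p x"
    using hahn_banach[OF x] by blast
  have "p x \<le> C * dual_norm V p f" using assms(3)[OF f(1)] f(2) by simp
  also have "\<dots> \<le> C * 1" using C f(3) by (intro mult_left_mono dual_norm_le) auto
  finally show ?thesis by simp
qed

lemma canonical_apply: "f \<in> dual_space V s p \<Longrightarrow> canonical V s p x f = f x"
  by (simp add: canonical_def)

lemma canonical_in_bidual:
  assumes x: "x \<in> V"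
  shows "canonical V s p x \<in> bidual V s p"
proof -
  interpret dual: seminormed_space fscale "dual_space V s p" "dual_norm V p"
    by (rule seminormed_space_dual)
  have "(\<lambda>f. if f \<in> dual_space V s p then f x else 0) \<in> bidual V s p"
    unfolding bidual_def
  proof (rule dual.dual_spaceI[where C = "p x"])
    show "f \<in> dual_space V s p \<Longrightarrow> norm (f x) \<le> p x * dual_norm V p f" for f
      using dual_norm_bound[OF _ x, of f] by (simp add: mult.commute)
  qed (auto simp: fscale_def)
  then show ?thesis by (simp add: canonical_def)
qed

lemma bidual_norm_canonical:
  assumes x: "x \<in> V"
  shows "bidual_norm V s p (canonical V s p x) = p x"
proof (rule antisym)
  show "bidual_norm V s p (canonical V s p x) \<le> p x"
    using dual_norm_bound[OF _ x] seminorm_nonneg[OF x]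
    by (intro bidual_norm_le) (auto simp: canonical_apply mult.commute)
  interpret bi: seminormed_space fscale "bidual V s p" "bidual_norm V s p"
    by (rule seminormed_space_bidual)
  show "p x \<le> bidual_norm V s p (canonical V s p x)"
    using bi.seminorm_nonneg[OF canonical_in_bidual[OF x]] bidual_norm_bound[OF canonical_in_bidual[OF x]]
    by (intro seminorm_le_dual x) (auto simp: canonical_apply)
qed

lemma canonical_in_completion: "x \<in> V \<Longrightarrow> canonical V s p x \<in> completion V s p"
proof -
  assume x: "x \<in> V"
  interpret bi: seminormed_space fscale "bidual V s p" "bidual_norm V s p"
    by (rule seminormed_space_bidual)
  show ?thesis
    unfolding completion_def using canonical_in_bidual[OF x] x bi.seminorm_zero
    by (auto intro!: bexI[of _ x])
qed

text \<open>\<open>W\<close> starts as a bare function. Being the pointwise limit of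
  \<open>f (w k)\<close> makes it linear in \<open>f\<close>, and the rate \<open>e k\<close>,
  uniform on the dual ball, makes it bounded and a norm limit of canonical images.\<close>

lemma completionI:
  assumes w: "\<And>k. w k \<in> V" and W0: "\<And>f. f \<notin> dual_space V s p \<Longrightarrow> W f = 0"
    and bound: "\<And>k f. f \<in> dual_space V s p \<Longrightarrow> norm (W f - f (w k)) \<le> e k * dual_norm V p f"
    and e: "e \<longlonglongrightarrow> 0"
  shows "W \<in> completion V s p"
    and "(\<lambda>k. bidual_norm V s p (W - canonical V s p (w k))) \<longlonglongrightarrow> 0"
proof -
  interpret dual: seminormed_space fscale "dual_space V s p" "dual_norm V p"
    by (rule seminormed_space_dual)
  interpret bi: seminormed_space fscale "bidual V s p" "bidual_norm V s p"
    by (rule seminormed_space_bidual)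
  have lim: "(\<lambda>k. f (w k)) \<longlonglongrightarrow> W f" if f: "f \<in> dual_space V s p" for f
  proof -
    have "(\<lambda>k. W f - f (w k)) \<longlonglongrightarrow> 0"
      by (rule Lim_null_comparison[where g = "\<lambda>k. e k * dual_norm V p f"])
        (use bound[OF f] tendsto_mult_left_zero[OF e] in auto)
    from tendsto_diff[OF tendsto_const[of "W f"] this] show ?thesis by simp
  qed
  have W_add: "W (f + g) = W f + W g" if f: "f \<in> dual_space V s p" and g: "g \<in> dual_space V s p" for f g
  proof (rule LIMSEQ_unique)
    show "(\<lambda>k. (f + g) (w k)) \<longlonglongrightarrow> W (f + g)" using f g by (intro lim dual.carrier_add)
    show "(\<lambda>k. (f + g) (w k)) \<longlonglongrightarrow> W f + W g"
      using tendsto_add[OF lim[OF f] lim[OF g]] by simp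
  qed
  have W_scale: "W (fscale c f) = c * W f" if f: "f \<in> dual_space V s p" for c f
  proof (rule LIMSEQ_unique)
    show "(\<lambda>k. (fscale c f) (w k)) \<longlonglongrightarrow> W (fscale c f)" using f by (intro lim dual.carrier_scale)
    show "(\<lambda>k. (fscale c f) (w k)) \<longlonglongrightarrow> c * W f"
      using tendsto_mult_left[OF lim[OF f], of c] by (simp add: fscale_def)
  qed
  have W_bd: "norm (W f) \<le> (e 0 + p (w 0)) * dual_norm V p f" if f: "f \<in> dual_space V s p" for f
    using norm_triangle_ineq[of "W f - f (w 0)" "f (w 0)"] bound[OF f, of 0] dual_norm_bound[OF f w[of 0]]
    by (simp add: algebra_simps)
  have W: "W \<in> bidual V s p"
    unfolding bidual_def dual_space_def[of "dual_space V s p"]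
    using W_add W_scale W0 W_bd by (auto intro!: exI[of _ "e 0 + p (w 0)"])
  have le: "bidual_norm V s p (W - canonical V s p (w k)) \<le> \<bar>e k\<bar>" for k
  proof (rule bidual_norm_le)
    fix f assume f: "f \<in> dual_space V s p"
    have "norm (W f - f (w k)) \<le> e k * dual_norm V p f" by (rule bound[OF f])
    also have "\<dots> \<le> \<bar>e k\<bar> * dual_norm V p f"
      using dual_norm_nonneg[OF f] by (intro mult_right_mono) auto
    finally show "norm ((W - canonical V s p (w k)) f) \<le> \<bar>e k\<bar> * dual_norm V p f"
      using f by (simp add: canonical_apply)
  qed simp
  show lim0: "(\<lambda>k. bidual_norm V s p (W - canonical V s p (w k))) \<longlonglongrightarrow> 0"
  proof (rule tendsto_sandwich[where f = "\<lambda>_. 0" and h = "\<lambda>k. \<bar>e k\<bar>"])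
    show "\<forall>\<^sub>F k in sequentially. 0 \<le> bidual_norm V s p (W - canonical V s p (w k))"
      using W canonical_in_bidual[OF w] by (intro always_eventually allI bi.seminorm_nonneg bi.carrier_diff) auto
  qed (use le e tendsto_rabs_zero in auto)
  show "W \<in> completion V s p"
    unfolding completion_def
  proof (intro CollectI conjI W allI impI)
    fix d :: real assume "d > 0"
    then have "\<forall>\<^sub>F k in sequentially. bidual_norm V s p (W - canonical V s p (w k)) < d"
      using order_tendstoD(2)[OF lim0] by blast
    then show "\<exists>x\<in>V. bidual_norm V s p (W - canonical V s p x) < d"
      using w by (auto simp: eventually_sequentially)
  qed
qed

text \<open>The harmonic rate is a convenience: where a faster one is needed, a subsequence is
  taken. The last clause lets the approximants be represented at a cost close to the norm of
  \<open>u\<close>.\<close>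

lemma completionE:
  assumes u: "u \<in> completion V s p"
  obtains w where "\<And>k. w k \<in> V" "\<And>k. bidual_norm V s p (u - canonical V s p (w k)) < 1 / Suc k"
    "\<And>k f. f \<in> dual_space V s p \<Longrightarrow> norm (u f - f (w k)) \<le> 1 / Suc k * dual_norm V p f"
    "\<And>k. p (w k) < bidual_norm V s p u + 1 / Suc k"
proof -
  interpret bi: seminormed_space fscale "bidual V s p" "bidual_norm V s p"
    by (rule seminormed_space_bidual)
  have ub: "u \<in> bidual V s p" using u by (simp add: completion_def)
  have "\<forall>k. \<exists>w\<in>V. bidual_norm V s p (u - canonical V s p w) < 1 / Suc k"
    using u by (simp add: completion_def)
  then obtain w where w: "\<And>k. w k \<in> V" "\<And>k. bidual_norm V s p (u - canonical V s p (w k)) < 1 / Suc k"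
    by metis
  show ?thesis
  proof (rule that[OF w])
    fix k f assume f: "f \<in> dual_space V s p"
    have "norm ((u - canonical V s p (w k)) f)
        \<le> bidual_norm V s p (u - canonical V s p (w k)) * dual_norm V p f"
      using ub w f by (intro bidual_norm_bound bi.carrier_diff canonical_in_bidual)
    also have "\<dots> \<le> 1 / Suc k * dual_norm V p f"
      using w(2)[of k] dual_norm_nonneg[OF f] by (intro mult_right_mono) auto
    finally show "norm (u f - f (w k)) \<le> 1 / Suc k * dual_norm V p f"
      using f by (simp add: canonical_apply)
  next
    fix k
    have "p (w k) = bidual_norm V s p (u - (u - canonical V s p (w k)))"
      using bidual_norm_canonical[OF w(1)] by simp
    also have "\<dots> \<le> bidual_norm V s p u + bidual_norm V s p (u - canonical V s p (w k))"
      using ub w by (intro bi.seminorm_diff bi.carrier_diff canonical_in_bidual)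
    finally show "p (w k) < bidual_norm V s p u + 1 / Suc k" using w(2)[of k] by simp
  qed
qed

lemma completion_subset_bidual: "completion V s p \<subseteq> bidual V s p"
  by (auto simp: completion_def)

end

text \<open>Applied in both directions to two equivalent norms, and once more one level up, to their
  dual norms.\<close>

lemma dual_space_mono:
  assumes "seminormed_space s V p" "seminormed_space s V q"
    and K: "K \<ge> 0" "\<And>x. x \<in> V \<Longrightarrow> p x \<le> K * q x" and f: "f \<in> dual_space V s p"
  shows "f \<in> dual_space V s q" and "dual_norm V q f \<le> K * dual_norm V p f"
proof -
  interpret p: seminormed_space s V p by fact
  interpret q: seminormed_space s V q by fact
  have le: "norm (f x) \<le> (K * dual_norm V p f) * q x" if x: "x \<in> V" for x
    using order_trans[OF p.dual_norm_bound[OF f x] mult_left_mono[OF K(2)[OF x] p.dual_norm_nonneg[OF f]]]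
    by (simp add: mult_ac)
  show "f \<in> dual_space V s q"
    using f le unfolding dual_space_def by blast
  show "dual_norm V q f \<le> K * dual_norm V p f"
    using K(1) p.dual_norm_nonneg[OF f] by (intro q.dual_norm_le le) auto
qed

subsection \<open>The projective norm\<close>

locale renormed_space = banach_space_over sX
  for sX :: "'k::real_or_complex \<Rightarrow> 'a::banach \<Rightarrow> 'a" +
  fixes N :: "'a \<Rightarrow> real"
  assumes equivalent_norm: "equivalent_norm sX N"
begin

lemma N_nonneg: "0 \<le> N x" and N_eq_0D: "N x = 0 \<Longrightarrow> x = 0"
  and N_scale: "N (sX c x) = norm c * N x" and N_triangle: "N (x + y) \<le> N x + N y"
  using equivalent_norm by (auto simp: equivalent_norm_def norm_over_def)

sublocale Z: seminormed_space sX UNIV N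
  by unfold_locales (auto simp: N_nonneg N_scale N_triangle)

lemma norm_equiv:
  obtains c C where "c > 0" "C > 0" "\<And>x. c * norm x \<le> N x" "\<And>x. N x \<le> C * norm x"
  using equivalent_norm unfolding equivalent_norm_def by blast

lemma N_0 [simp]: "N 0 = 0"
  by (rule Z.seminorm_zero)

lemma N_minus: "N (- x) = N x"
  by (simp add: Z.seminorm_minus)

lemma N_diff: "N (x - y) \<le> N x + N y"
  by (simp add: Z.seminorm_diff)

abbreviation tens :: "'a \<Rightarrow> 'a \<Rightarrow> ('a \<Rightarrow> 'a \<Rightarrow> 'k) \<Rightarrow> 'k" where
  "tens \<equiv> tensor sX sX"

abbreviation T :: "(('a \<Rightarrow> 'a \<Rightarrow> 'k) \<Rightarrow> 'k) set" where
  "T \<equiv> alg_tensor sX sX"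

abbreviation \<pi> :: "(('a \<Rightarrow> 'a \<Rightarrow> 'k) \<Rightarrow> 'k) \<Rightarrow> real" where
  "\<pi> \<equiv> proj_norm sX N sX N"

abbreviation dualZ :: "('a \<Rightarrow> 'k) set" where
  "dualZ \<equiv> dual_space UNIV sX N"

abbreviation dualT :: "((('a \<Rightarrow> 'a \<Rightarrow> 'k) \<Rightarrow> 'k) \<Rightarrow> 'k) set" where
  "dualT \<equiv> dual_space T fscale \<pi>"

lemma bilinear_forms_iff:
  "A \<in> bilinear_forms sX sX \<longleftrightarrow>
     (\<forall>x x' y. A (x + x') y = A x y + A x' y) \<and> (\<forall>x y y'. A x (y + y') = A x y + A x y') \<and>
     (\<forall>c x y. A (sX c x) y = c * A x y) \<and> (\<forall>c x y. A x (sX c y) = c * A x y)"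
proof -
  have "vector_space ((*) :: 'k \<Rightarrow> 'k \<Rightarrow> 'k)"
    by standard (auto simp: algebra_simps)
  then show ?thesis
    using vector_space_axioms unfolding bilinear_forms_def Vector_Spaces.linear_iff by auto
qed

lemma tensor_add_left: "tens (x + x') y = tens x y + tens x' y"
  and tensor_add_right: "tens x (y + y') = tens x y + tens x y'"
  and tensor_scale_left: "tens (sX c x) y = fscale c (tens x y)"
  and tensor_scale_right: "tens x (sX c y) = fscale c (tens x y)"
  by (auto simp: tensor_def fun_eq_iff bilinear_forms_iff fscale_def)

lemma tensor_0_left [simp]: "tens 0 y = 0"
  using tensor_scale_left[of 0 0 y] by simp

lemma tensor_0_right [simp]: "tens x 0 = 0"
  using tensor_scale_right[of x 0 0] by simp

lemma subspace_alg_tensor: "fscale.subspace T"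
  by (simp add: alg_tensor_def)

lemma tensor_in: "tens x y \<in> T"
  unfolding alg_tensor_def by (rule fscale.span_base) blast

lemma sum_fun_apply: "(\<Sum>i\<in>A. f i) x = (\<Sum>i\<in>A. f i x)"
  by (induction A rule: infinite_finite_induct) auto

lemma concat_sum:
  fixes f g :: "nat \<Rightarrow> 'c::comm_monoid_add"
  shows "(\<Sum>i<n. f i) + (\<Sum>i<m. g i) = (\<Sum>i<n + m. if i < n then f i else g (i - n))"
  by (induction m) (auto simp: add.assoc[symmetric])

lemma alg_tensor_representation:
  assumes "v \<in> T"
  obtains n :: nat and x y where "v = (\<Sum>i<n. tens (x i) (y i))"
proof -
  from assms have "\<exists>(n::nat) x y. v = (\<Sum>i<n. tens (x i) (y i))"
    unfolding alg_tensor_def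
  proof (induction rule: fscale.span_induct_alt)
    case base
    show ?case by (rule exI[of _ 0]) simp
  next
    case (step c w v)
    then obtain a b and n :: nat and x y
      where "w = tens a b" and v: "v = (\<Sum>i<n. tens (x i) (y i))" by blast
    then have "fscale c w + v = tens (sX c a) b + (\<Sum>i<n. tens (x i) (y i))"
      by (simp add: tensor_scale_left)
    also have "\<dots> = (\<Sum>i<Suc n. tens (case_nat (sX c a) x i) (case_nat b y i))"
      by (simp only: sum.lessThan_Suc_shift nat.case)
    finally show ?case by (intro exI)
  qed
  then show ?thesis using that by blast
qed

lemma proj_norm_reps_I:
  assumes "v = (\<Sum>i<(m::nat). tens (a i) (b i))"
  shows "(\<Sum>i<m. N (a i) * N (b i)) \<in>
    {(\<Sum>i<n. N (x i) * N (y i)) | (n::nat) x y. v = (\<Sum>i<n. tens (x i) (y i))}"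
  using assms by (intro CollectI exI[of _ m] exI[of _ a] exI[of _ b]) simp

lemma proj_norm_bdd_below:
  "bdd_below {(\<Sum>i<n. N (x i) * N (y i)) | (n::nat) x y. v = (\<Sum>i<n. tens (x i) (y i))}"
  by (rule bdd_belowI[of _ 0]) (auto intro!: sum_nonneg mult_nonneg_nonneg N_nonneg)

lemma proj_norm_le: "\<pi> (\<Sum>i<(n::nat). tens (x i) (y i)) \<le> (\<Sum>i<n. N (x i) * N (y i))"
  unfolding proj_norm_def by (rule cInf_lower[OF proj_norm_reps_I[OF refl] proj_norm_bdd_below])

lemma proj_norm_tensor_le: "\<pi> (tens x y) \<le> N x * N y"
  using proj_norm_le[where n = 1 and x = "\<lambda>_. x" and y = "\<lambda>_. y"] by simp

lemma proj_norm_approx: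
  assumes "v \<in> T" and "\<pi> v < r"
  obtains n :: nat and x y where "v = (\<Sum>i<n. tens (x i) (y i))" "(\<Sum>i<n. N (x i) * N (y i)) < r"
proof -
  let ?S = "{(\<Sum>i<n. N (x i) * N (y i)) | (n::nat) x y. v = (\<Sum>i<n. tens (x i) (y i))}"
  obtain n :: nat and x y where "v = (\<Sum>i<n. tens (x i) (y i))"
    using alg_tensor_representation[OF assms(1)] .
  then have "(\<Sum>i<n. N (x i) * N (y i)) \<in> ?S" by (rule proj_norm_reps_I)
  then have "?S \<noteq> {}" by (rule ex_in_conv[THEN iffD1, OF exI])
  then obtain t where "t \<in> ?S" "t < r"
    using cInf_lessD[of ?S r] assms(2) unfolding proj_norm_def by blast
  then show ?thesis using that by blast
qed

lemma proj_norm_nonneg: "v \<in> T \<Longrightarrow> 0 \<le> \<pi> v"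
  unfolding proj_norm_def
proof (rule cInf_greatest)
  let ?S = "{(\<Sum>i<n. N (x i) * N (y i)) | (n::nat) x y. v = (\<Sum>i<n. tens (x i) (y i))}"
  assume "v \<in> T"
  then obtain n :: nat and x y where "v = (\<Sum>i<n. tens (x i) (y i))"
    by (rule alg_tensor_representation)
  then have "(\<Sum>i<n. N (x i) * N (y i)) \<in> ?S" by (rule proj_norm_reps_I)
  then show "?S \<noteq> {}" by (rule ex_in_conv[THEN iffD1, OF exI])
qed (auto intro!: sum_nonneg mult_nonneg_nonneg N_nonneg)

lemma proj_norm_scale_le:
  assumes "v \<in> T"
  shows "\<pi> (fscale c v) \<le> norm c * \<pi> v"
proof (rule field_le_epsilon)
  fix e :: real assume e: "e > 0"
  \<comment> \<open>The summand 1 avoids a division by zero for \<open>c = 0\<close>.\<close>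
  define d where "d = e / (norm c + 1)"
  have d: "d > 0" using e by (simp add: d_def add_nonneg_pos)
  obtain n :: nat and x y where v: "v = (\<Sum>i<n. tens (x i) (y i))"
    and le: "(\<Sum>i<n. N (x i) * N (y i)) < \<pi> v + d"
    by (rule proj_norm_approx[OF assms, of "\<pi> v + d"]) (use d in auto)
  have "fscale c v = (\<Sum>i<n. tens (sX c (x i)) (y i))"
    by (simp add: v fscale.scale_sum_right tensor_scale_left)
  then have "\<pi> (fscale c v) \<le> norm c * (\<Sum>i<n. N (x i) * N (y i))"
    using proj_norm_le[of "\<lambda>i. sX c (x i)" y n] by (simp add: N_scale sum_distrib_left mult.assoc)
  also have "\<dots> \<le> norm c * (\<pi> v + d)" using le by (intro mult_left_mono) auto
  also have "norm c * d \<le> (norm c + 1) * d" using d by (intro mult_right_mono) auto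
  then have "norm c * (\<pi> v + d) \<le> norm c * \<pi> v + (norm c + 1) * d" by (simp add: algebra_simps)
  also have "(norm c + 1) * d = e"
    using norm_ge_zero[of c] unfolding d_def by (simp add: add_nonneg_eq_0_iff)
  finally show "\<pi> (fscale c v) \<le> norm c * \<pi> v + e" by simp
qed

lemma proj_norm_scale:
  assumes v: "v \<in> T"
  shows "\<pi> (fscale c v) = norm c * \<pi> v"
proof (rule homogeneous_if_le[where V = T and p = \<pi> and s = fscale])
  show "fscale a w \<in> T" if "w \<in> T" for a w by (rule fscale.subspace_scale[OF subspace_alg_tensor that])
qed (rule vector_space_fscale proj_norm_nonneg proj_norm_scale_le v; assumption)+

lemma proj_norm_triangle:
  assumes v: "v \<in> T" and w: "w \<in> T"
  shows "\<pi> (v + w) \<le> \<pi> v + \<pi> w"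
proof (rule field_le_epsilon)
  fix e :: real assume e: "e > 0"
  obtain n :: nat and x y where v: "v = (\<Sum>i<n. tens (x i) (y i))"
    and lev: "(\<Sum>i<n. N (x i) * N (y i)) < \<pi> v + e/2"
    by (rule proj_norm_approx[OF v, of "\<pi> v + e/2"]) (use e in auto)
  obtain m :: nat and x' y' where w: "w = (\<Sum>i<m. tens (x' i) (y' i))"
    and lew: "(\<Sum>i<m. N (x' i) * N (y' i)) < \<pi> w + e/2"
    by (rule proj_norm_approx[OF w, of "\<pi> w + e/2"]) (use e in auto)
  define a b where "a i = (if i < n then x i else x' (i - n))"
    and "b i = (if i < n then y i else y' (i - n))" for i
  have "v + w = (\<Sum>i<n+m. tens (a i) (b i))"
    unfolding v w concat_sum by (intro sum.cong) (auto simp: a_def b_def)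
  moreover have "(\<Sum>i<n. N (x i) * N (y i)) + (\<Sum>i<m. N (x' i) * N (y' i)) = (\<Sum>i<n+m. N (a i) * N (b i))"
    unfolding concat_sum by (intro sum.cong) (auto simp: a_def b_def)
  ultimately show "\<pi> (v + w) \<le> \<pi> v + \<pi> w + e"
    using proj_norm_le[of a b "n + m"] lev lew by simp
qed

sublocale P: seminormed_space fscale T \<pi>
  by unfold_locales
    (auto simp: subspace_alg_tensor proj_norm_nonneg proj_norm_scale proj_norm_triangle)

text \<open>A tensor is here a function of bilinear forms, so the linearisation of \<open>B\<close>
  is evaluation at \<open>B\<close>; the value 0 outside \<open>T\<close> is the convention of
  \<open>dual_space\<close>.\<close>

definition form_functional :: "('a \<Rightarrow> 'a \<Rightarrow> 'k) \<Rightarrow> (('a \<Rightarrow> 'a \<Rightarrow> 'k) \<Rightarrow> 'k) \<Rightarrow> 'k" where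
  "form_functional B v = (if v \<in> T then v B else 0)"

text \<open>Any representation of \<open>v\<close> bounds the value at \<open>B\<close> by
  \<open>C\<close> times the cost of that representation; the infimum over representations gives
  \<open>\<pi>\<close>.\<close>

lemma form_functional:
  assumes B: "B \<in> bilinear_forms sX sX" and C: "\<And>x y. norm (B x y) \<le> C * N x * N y" and C0: "C \<ge> 0"
  shows "form_functional B \<in> dualT" and "form_functional B (tens x y) = B x y"
    and "dual_norm T \<pi> (form_functional B) \<le> C"
proof -
  have bound: "norm (v B) \<le> C * \<pi> v" if v: "v \<in> T" for v
  proof (rule field_le_epsilon)
    fix e :: real assume e: "e > 0"
    define d where "d = e / (C + 1)"
    have d: "d > 0" "C * d \<le> e" using e C0 by (auto simp: d_def field_simps)
    obtain n :: nat and x y where v: "v = (\<Sum>i<n. tens (x i) (y i))"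
      and le: "(\<Sum>i<n. N (x i) * N (y i)) < \<pi> v + d"
      by (rule proj_norm_approx[OF v, of "\<pi> v + d"]) (use d in auto)
    have "v B = (\<Sum>i<n. B (x i) (y i))"
      using B by (simp add: v sum_fun_apply tensor_def)
    then have "norm (v B) \<le> (\<Sum>i<n. C * N (x i) * N (y i))"
      using C by (auto intro!: sum_norm_le)
    also have "\<dots> = C * (\<Sum>i<n. N (x i) * N (y i))" by (simp add: sum_distrib_left mult.assoc)
    also have "\<dots> \<le> C * (\<pi> v + d)" using le C0 by (intro mult_left_mono) auto
    finally show "norm (v B) \<le> C * \<pi> v + e" using d by (simp add: algebra_simps)
  qed
  show "form_functional B \<in> dualT"
    unfolding form_functional_def[abs_def] by (rule P.dual_spaceI[OF _ _ bound]) (auto simp: fscale_def)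
  show "form_functional B (tens x y) = B x y"
    using B tensor_in by (simp add: form_functional_def tensor_def)
  show "dual_norm T \<pi> (form_functional B) \<le> C"
    using C0 bound by (intro P.dual_norm_le) (auto simp: form_functional_def)
qed

text \<open>Converse to \<open>form_functional\<close>: functionals on the tensor product come from
  bilinear forms with the same bound.\<close>

lemma dualT_form:
  assumes \<Phi>: "\<Phi> \<in> dualT"
  shows "(\<lambda>x y. \<Phi> (tens x y)) \<in> bilinear_forms sX sX"
    and "norm (\<Phi> (tens x y)) \<le> dual_norm T \<pi> \<Phi> * N x * N y"
proof -
  show "(\<lambda>x y. \<Phi> (tens x y)) \<in> bilinear_forms sX sX"
    unfolding bilinear_forms_iff
    by (simp add: tensor_add_left tensor_add_right tensor_scale_left tensor_scale_right
        P.dual_spaceD[OF \<Phi>] tensor_in)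
  have "norm (\<Phi> (tens x y)) \<le> dual_norm T \<pi> \<Phi> * \<pi> (tens x y)"
    by (rule P.dual_norm_bound[OF \<Phi> tensor_in])
  also have "\<dots> \<le> dual_norm T \<pi> \<Phi> * (N x * N y)"
    by (intro mult_left_mono proj_norm_tensor_le P.dual_norm_nonneg \<Phi>)
  finally show "norm (\<Phi> (tens x y)) \<le> dual_norm T \<pi> \<Phi> * N x * N y" by (simp add: mult.assoc)
qed

definition rank_one :: "('a \<Rightarrow> 'k) \<Rightarrow> ('a \<Rightarrow> 'k) \<Rightarrow> (('a \<Rightarrow> 'a \<Rightarrow> 'k) \<Rightarrow> 'k) \<Rightarrow> 'k" where
  "rank_one f g = form_functional (\<lambda>x y. f x * g y)"

lemma rank_one:
  assumes f: "f \<in> dualZ" and g: "g \<in> dualZ"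
  shows "rank_one f g \<in> dualT" and "rank_one f g (tens x y) = f x * g y"
    and "dual_norm T \<pi> (rank_one f g) \<le> dual_norm UNIV N f * dual_norm UNIV N g"
proof -
  have B: "(\<lambda>x y. f x * g y) \<in> bilinear_forms sX sX"
    unfolding bilinear_forms_iff
    by (simp add: Z.dual_spaceD[OF f] Z.dual_spaceD[OF g] algebra_simps)
  have C: "norm (f x * g y) \<le> dual_norm UNIV N f * dual_norm UNIV N g * N x * N y" for x y
  proof -
    have "norm (f x) * norm (g y) \<le> (dual_norm UNIV N f * N x) * (dual_norm UNIV N g * N y)"
      using Z.dual_norm_bound[OF f, of x] Z.dual_norm_bound[OF g, of y] Z.dual_norm_nonneg[OF f] N_nonneg
      by (intro mult_mono) auto
    then show ?thesis by (simp add: norm_mult mult_ac)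
  qed
  have C0: "dual_norm UNIV N f * dual_norm UNIV N g \<ge> 0"
    using Z.dual_norm_nonneg f g by simp
  show "rank_one f g \<in> dualT" "rank_one f g (tens x y) = f x * g y"
    "dual_norm T \<pi> (rank_one f g) \<le> dual_norm UNIV N f * dual_norm UNIV N g"
    unfolding rank_one_def using form_functional[OF B C C0] by auto
qed

subsection \<open>Consequences of the approximation property\<close>

lemma dualZI:
  assumes "\<And>x y. f (x + y) = f x + f y" "\<And>c x. f (sX c x) = c * f x" "\<And>x. norm (f x) \<le> C * N x"
  shows "f \<in> dualZ"
  using assms by (auto simp: dual_space_def)

lemma ex_dual_eq_1:
  assumes "e \<noteq> 0"
  obtains g where "g \<in> dualZ" "g e = 1"
proof -
  obtain f where f: "f \<in> dualZ" "f e = of_real (N e)"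
    using Z.hahn_banach[of e] by auto
  have "N e \<noteq> 0" using N_eq_0D assms by blast
  then have "fscale (inverse (of_real (N e))) f e = 1" using f by (simp add: fscale_def)
  then show ?thesis
    using that fscale.subspace_scale[OF Z.dual_space_subspace f(1)] by blast
qed

text \<open>The coefficient functionals have to be bounded, and coordinates with respect to an
  arbitrary spanning set do not show this. So one term is split off at a time: for a nonzero vector
  \<open>e\<close> of the range and a bounded \<open>g\<close> with \<open>g e = 1\<close>, the
  coefficient of \<open>e\<close> is \<open>g (S x)\<close>, and projecting along \<open>e\<close>
  leaves a range spanned by fewer vectors.\<close>

lemma finite_rank_decomposition:
  assumes "finite B" "Vector_Spaces.linear sX sX S" "\<And>x. N (S x) \<le> C * N x" "range S \<subseteq> span B"
  shows "\<exists>(n::nat) f e. (\<forall>i<n. f i \<in> dualZ) \<and> (\<forall>x. S x = (\<Sum>i<n. sX (f i x) (e i)))"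
  using assms
proof (induction "card B" arbitrary: B S C rule: less_induct)
  case less
  have add: "S (x + y) = S x + S y" and scale: "S (sX c x) = sX c (S x)" for x y c
    using less.prems(2) by (auto simp: Vector_Spaces.linear_iff)
  show ?case
  proof (cases "\<forall>x. S x = 0")
    case True
    then show ?thesis by (intro exI[of _ 0]) auto
  next
    case False
    then obtain x0 where x0: "S x0 \<noteq> 0" by blast
    define e where "e = S x0"
    obtain g where g: "g \<in> dualZ" "g e = 1" using ex_dual_eq_1 x0 e_def by metis
    note gD = Z.dual_spaceD[OF g(1)]
    have e: "e \<in> span B" "e \<noteq> 0" using less.prems(4) x0 by (auto simp: e_def)
    have "e \<notin> span {}" using e by simp
    \<comment> \<open>Steinitz exchange: a vector of \<open>B\<close> that occurs in
      \<open>e\<close> with nonzero coefficient can be replaced by \<open>e\<close>.\<close>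
    then obtain c where c: "c \<in> B" "c \<in> span (insert e (B - {c}))"
    proof -
      obtain q where q: "e = (\<Sum>b\<in>B. sX (q b) b)"
        using e(1) span_finite[OF less.prems(1)] by auto
      have "\<exists>c\<in>B. q c \<noteq> 0"
      proof (rule ccontr)
        assume "\<not> (\<exists>c\<in>B. q c \<noteq> 0)"
        then have "e = 0" using q by simp
        then show False using e by simp
      qed
      then obtain c where c: "c \<in> B" "q c \<noteq> 0" by blast
      have "e = sX (q c) c + (\<Sum>b\<in>B-{c}. sX (q b) b)"
        using q sum.remove[OF less.prems(1) c(1)] by metis
      then have "sX (inverse (q c)) (e - (\<Sum>b\<in>B-{c}. sX (q b) b)) = c"
        using c by simp
      moreover have "sX (inverse (q c)) (e - (\<Sum>b\<in>B-{c}. sX (q b) b)) \<in> span (insert e (B - {c}))"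
        by (intro span_scale span_diff span_sum) (auto intro: span_base)
      ultimately show thesis using that c by metis
    qed
    define P where "P x = x - sX (g x) e" for x
    have P_add: "P (x + y) = P x + P y" and P_scale: "P (sX a x) = sX a (P x)" for x y a
      by (auto simp: P_def gD scale_left_distrib scale_right_diff_distrib)
    have Pe: "P e = 0" using g by (simp add: P_def)
    have P_span: "P x \<in> span (P ` (B - {c}))" if "x \<in> span B" for x
    proof -
      have "span B \<subseteq> span (insert e (B - {c}))"
      proof (rule span_minimal)
        show "B \<subseteq> span (insert e (B - {c}))"
        proof
          fix b assume "b \<in> B"
          then show "b \<in> span (insert e (B - {c}))"
            using c by (cases "b = c") (auto intro: span_base)
        qed
      qed simp
      then have "x \<in> span (insert e (B - {c}))" using that by blast
      then show ?thesis
      proof (induction rule: span_induct_alt)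
        case base
        have "P 0 = 0" using P_scale[of 0 0] by simp
        then show ?case by (simp add: span_zero)
      next
        case (step a b y)
        have "P b \<in> span (P ` (B - {c}))"
          using step(1) Pe by (auto simp: span_zero intro: span_base)
        then show ?case
          using step by (simp only: P_add P_scale) (intro span_add span_scale)
      qed
    qed
    obtain D where D: "D \<ge> 0" "\<And>x. norm (g x) \<le> D * N x"
      using Z.dual_space_bounded[OF g(1)] by auto
    define S' where "S' x = P (S x)" for x
    have "\<exists>(n::nat) f e'. (\<forall>i<n. f i \<in> dualZ) \<and> (\<forall>x. S' x = (\<Sum>i<n. sX (f i x) (e' i)))"
    proof (rule less.hyps[of "P ` (B - {c})"])
      have "card (P ` (B - {c})) \<le> card (B - {c})" using less.prems(1) by (intro card_image_le) auto
      also have "\<dots> < card B" using c less.prems(1) by (intro psubset_card_mono) auto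
      finally show "card (P ` (B - {c})) < card B" .
      show "finite (P ` (B - {c}))" using less.prems(1) by simp
      show "Vector_Spaces.linear sX sX S'"
        using less.prems(2) by (auto simp: Vector_Spaces.linear_iff S'_def P_add P_scale add scale)
      show "range S' \<subseteq> span (P ` (B - {c}))"
        using less.prems(4) P_span by (auto simp: S'_def)
      fix x
      have "N (P z) \<le> (1 + D * N e) * N z" for z
      proof -
        have "N (P z) \<le> N z + norm (g z) * N e"
          using N_diff[of z "sX (g z) e"] by (simp add: P_def N_scale)
        also have "\<dots> \<le> N z + (D * N z) * N e"
          using D(2) N_nonneg by (intro add_left_mono mult_right_mono) auto
        finally show ?thesis by (simp add: algebra_simps)
      qed
      then have "N (S' x) \<le> (1 + D * N e) * N (S x)" by (simp add: S'_def)
      also have "\<dots> \<le> (1 + D * N e) * (C * N x)"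
        using less.prems(3) D(1) N_nonneg by (intro mult_left_mono) auto
      finally show "N (S' x) \<le> ((1 + D * N e) * C) * N x" by (simp add: mult.assoc)
    qed
    then obtain n :: nat and f e' where fe: "\<And>i. i < n \<Longrightarrow> f i \<in> dualZ"
      "\<And>x. S' x = (\<Sum>i<n. sX (f i x) (e' i))" by blast
    have gS: "(\<lambda>x. g (S x)) \<in> dualZ"
    proof (rule dualZI)
      show "norm (g (S x)) \<le> (D * C) * N x" for x
        using order_trans[OF D(2) mult_left_mono[OF less.prems(3) D(1)]] by (simp add: mult.assoc)
    qed (simp_all add: add scale gD)
    have "S x = S' x + sX (g (S x)) e" for x by (simp add: S'_def P_def)
    then have "S x = (\<Sum>i<Suc n. sX ((f(n := \<lambda>x. g (S x))) i x) ((e'(n := e)) i))" for x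
      by (simp add: fe)
    moreover have "\<forall>i<Suc n. (f(n := \<lambda>x. g (S x))) i \<in> dualZ"
      using fe gS by (auto simp: less_Suc_eq)
    ultimately show ?thesis by blast
  qed
qed

end

lemma (in banach_space_over) renormed_space_norm: "renormed_space sX norm"
  by unfold_locales
    (auto simp: equivalent_norm_def norm_over_def norm_scale norm_triangle_ineq intro!: exI[of _ 1])

text \<open>A member of the cover that contains 0 swallows all but finitely many of the finite
  sets.\<close>

lemma compact_null_sequence_of_finite_sets:
  fixes F :: "nat \<Rightarrow> 'a::real_normed_vector set"
  assumes fin: "\<And>k. finite (F k)" and small: "\<And>k x. x \<in> F k \<Longrightarrow> norm x \<le> r k" and r: "r \<longlonglongrightarrow> 0"
  shows "compact (insert 0 (\<Union>k. F k))"
  unfolding compact_eq_Heine_Borel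
proof (intro allI impI, elim conjE)
  fix \<U> :: "'a set set"
  assume op: "\<forall>U\<in>\<U>. open U" and cov: "insert 0 (\<Union>k. F k) \<subseteq> \<Union>\<U>"
  then obtain U where U: "U \<in> \<U>" "0 \<in> U" by blast
  then obtain e where e: "e > 0" "ball 0 e \<subseteq> U" using op openE by metis
  obtain n where n: "\<And>k. k \<ge> n \<Longrightarrow> r k < e"
    using order_tendstoD(2)[OF r e(1)] by (auto simp: eventually_sequentially)
  have "finite (\<Union>k<n. F k)" using fin by simp
  moreover have "(\<Union>k<n. F k) \<subseteq> \<Union>\<U>" using cov by blast
  ultimately obtain \<V> where V: "finite \<V>" "\<V> \<subseteq> \<U>" "(\<Union>k<n. F k) \<subseteq> \<Union>\<V>"
    using finite_subset_Union by metis
  have "F k \<subseteq> \<Union>(insert U \<V>)" for k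
  proof (cases "k < n")
    case True then show ?thesis using V by blast
  next
    case False
    then have "F k \<subseteq> ball 0 e" using small n[of k] by (force simp: dist_norm)
    then show ?thesis using e by blast
  qed
  then show "\<exists>C'\<subseteq>\<U>. finite C' \<and> insert 0 (\<Union>k. F k) \<subseteq> \<Union>C'"
    using V U by (intro exI[of _ "insert U \<V>"]) auto
qed

context renormed_space
begin

text \<open>Telescoping along fast approximants writes \<open>u\<close> as a series of blocks of
  cost below \<open>D * (1/4) ^ k\<close>. Rescaling within each elementary tensor splits this
  factor evenly: the left legs form a null sequence, hence a relatively compact set, and the norms
  of the right legs stay summable.\<close>

lemma completion_block_representation:
  assumes u: "u \<in> completion T fscale \<pi>"
  obtains D and n :: "nat \<Rightarrow> nat" and x y where
    "D \<ge> 0" "\<And>k i. i < n k \<Longrightarrow> N (x k i) \<le> (1/2) ^ k" "\<And>k. (\<Sum>i<n k. N (y k i)) \<le> D * (1/2) ^ k"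
    "\<And>\<Phi>. \<Phi> \<in> dualT \<Longrightarrow> (\<lambda>m. \<Sum>k<m. \<Sum>i<n k. \<Phi> (tens (x k i) (y k i))) \<longlonglongrightarrow> u \<Phi>"
proof -
  obtain w where w: "\<And>k. w k \<in> T"
    and wb: "\<And>k \<Phi>. \<Phi> \<in> dualT \<Longrightarrow> norm (u \<Phi> - \<Phi> (w k)) \<le> 1 / Suc k * dual_norm T \<pi> \<Phi>"
    using P.completionE[OF u] by metis
  \<comment> \<open>The approximants come with error \<open>1 / Suc k\<close>, so index
    \<open>4 ^ k\<close> has error at most \<open>(1/4) ^ k\<close>.\<close>
  define r :: "nat \<Rightarrow> nat" where "r k = 4 ^ k" for k
  have rb: "norm (u \<Phi> - \<Phi> (w (r k))) \<le> (1/4) ^ k * dual_norm T \<pi> \<Phi>" if "\<Phi> \<in> dualT" for \<Phi> k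
  proof -
    have "norm (u \<Phi> - \<Phi> (w (r k))) \<le> 1 / Suc (4 ^ k) * dual_norm T \<pi> \<Phi>"
      using wb[OF that, of "r k"] by (simp add: r_def)
    also have "1 / real (Suc (4 ^ k)) \<le> 1 / 4 ^ k" by (intro divide_left_mono mult_pos_pos) (auto simp: add_pos_pos)
    then have "1 / Suc (4 ^ k) * dual_norm T \<pi> \<Phi> \<le> (1/4) ^ k * dual_norm T \<pi> \<Phi>"
      by (intro mult_right_mono P.dual_norm_nonneg that) (simp add: power_one_over)
    finally show ?thesis .
  qed
  define z where "z k = (case k of 0 \<Rightarrow> w (r 0) | Suc j \<Rightarrow> w (r (Suc j)) - w (r j))" for k
  have zT: "z k \<in> T" for k
    using w P.carrier_diff by (auto simp: z_def split: nat.split)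
  have zsum: "(\<Sum>k<Suc m. z k) = w (r m)" for m
  proof (induction m)
    case 0 then show ?case by (simp add: z_def)
  next
    case (Suc m)
    have "(\<Sum>k<Suc (Suc m). z k) = w (r m) + z (Suc m)"
      by (simp only: sum.lessThan_Suc[of z "Suc m"] Suc)
    also have "z (Suc m) = w (r (Suc m)) - w (r m)" by (simp only: z_def nat.case)
    finally show ?case by (simp only: add.commute[of "w (r m)"] diff_add_cancel)
  qed
  have zsmall: "\<pi> (z (Suc j)) \<le> 2 * (1/4) ^ j" for j
  proof (rule P.seminorm_le_dual[OF zT])
    fix \<Phi> assume \<Phi>: "\<Phi> \<in> dualT"
    have eq: "\<Phi> (z (Suc j)) = (u \<Phi> - \<Phi> (w (r j))) - (u \<Phi> - \<Phi> (w (r (Suc j))))"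
      by (simp add: z_def P.dual_space_diff[OF \<Phi> w w])
    have "norm (\<Phi> (z (Suc j))) \<le> (1/4) ^ j * dual_norm T \<pi> \<Phi> + (1/4) ^ Suc j * dual_norm T \<pi> \<Phi>"
      unfolding eq by (intro order_trans[OF norm_triangle_ineq4] add_mono rb \<Phi>)
    also have "\<dots> \<le> 2 * (1/4) ^ j * dual_norm T \<pi> \<Phi>"
      using P.dual_norm_nonneg[OF \<Phi>] by (simp add: algebra_simps)
    finally show "norm (\<Phi> (z (Suc j))) \<le> 2 * (1/4) ^ j * dual_norm T \<pi> \<Phi>" .
  qed simp
  \<comment> \<open>The bound \<open>2 * (1/4) ^ j\<close> has to be strictly below
    \<open>D * (1/4) ^ Suc j\<close>, which means \<open>D > 8\<close>; the summand
    \<open>\<pi> (z 0)\<close> takes care of the first block.\<close>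
  define D where "D = \<pi> (z 0) + 9"
  have D: "D \<ge> 9" using proj_norm_nonneg[OF zT] by (simp add: D_def)
  have zD: "\<pi> (z k) < D * (1/4) ^ k" for k
  proof (cases k)
    case 0 then show ?thesis by (simp add: D_def)
  next
    case (Suc j)
    have "2 * (1/4) ^ j < D * (1/4) ^ Suc j" using D by simp
    from le_less_trans[OF zsmall[of j] this] show ?thesis using Suc by simp
  qed
  have "\<forall>k. \<exists>(n::nat) x y. z k = (\<Sum>i<n. tens (x i) (y i)) \<and> (\<Sum>i<n. N (x i) * N (y i)) < D * (1/4) ^ k"
  proof
    fix k
    obtain n :: nat and x y where "z k = (\<Sum>i<n. tens (x i) (y i))"
      "(\<Sum>i<n. N (x i) * N (y i)) < D * (1/4) ^ k"
      by (rule proj_norm_approx[OF zT zD])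
    then show "\<exists>(n::nat) x y. z k = (\<Sum>i<n. tens (x i) (y i)) \<and> (\<Sum>i<n. N (x i) * N (y i)) < D * (1/4) ^ k"
      by (intro exI conjI)
  qed
  then have "\<exists>(n::nat \<Rightarrow> nat) x y. \<forall>k. z k = (\<Sum>i<n k. tens (x k i) (y k i)) \<and>
      (\<Sum>i<n k. N (x k i) * N (y k i)) < D * (1/4) ^ k"
    by (simp only: choice_iff)
  then obtain n :: "nat \<Rightarrow> nat" and x y where zr: "\<And>k. z k = (\<Sum>i<n k. tens (x k i) (y k i))"
    and zb: "\<And>k. (\<Sum>i<n k. N (x k i) * N (y k i)) < D * (1/4) ^ k"
    by blast
  define a b where "a k i = sX (of_real ((1/2) ^ k / N (x k i))) (x k i)"
    and "b k i = sX (of_real (2 ^ k * N (x k i))) (y k i)" for k i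
  have ab: "tens (a k i) (b k i) = tens (x k i) (y k i)" for k i
  proof (cases "N (x k i) = 0")
    \<comment> \<open>Here the quotient in \<open>a\<close> is 0 by convention, which is harmless
      because the left leg is already the zero vector.\<close>
    case True
    then have "x k i = 0" by (rule N_eq_0D)
    then show ?thesis by (simp add: a_def)
  next
    case False
    have "tens (a k i) (b k i)
        = fscale (of_real ((1/2) ^ k / N (x k i)) * of_real (2 ^ k * N (x k i))) (tens (x k i) (y k i))"
      by (simp add: a_def b_def tensor_scale_left tensor_scale_right del: of_real_mult of_real_divide)
    also have "of_real ((1/2) ^ k / N (x k i)) * of_real (2 ^ k * N (x k i)) = (1::'k)"
      using False by (simp add: power_one_over flip: of_real_mult)
    finally show ?thesis by simp
  qed
  show ?thesis
  proof (rule that[of D n a b])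
    show "D \<ge> 0" using D by simp
    show "N (a k i) \<le> (1/2) ^ k" for k i
      using N_nonneg[of "x k i"] by (simp add: a_def N_scale norm_divide norm_power norm_mult)
    show "(\<Sum>i<n k. N (b k i)) \<le> D * (1/2) ^ k" for k
    proof -
      have "(\<Sum>i<n k. N (b k i)) = 2 ^ k * (\<Sum>i<n k. N (x k i) * N (y k i))"
        using N_nonneg by (simp add: b_def N_scale norm_mult norm_power sum_distrib_left mult.assoc)
      also have "\<dots> \<le> 2 ^ k * (D * (1/4) ^ k)" using zb[of k] by (intro mult_left_mono) auto
      also have "\<dots> = D * (2 * (1/4)) ^ k" by (simp only: power_mult_distrib mult_ac)
      finally show ?thesis by simp
    qed
    fix \<Phi> assume \<Phi>: "\<Phi> \<in> dualT"
    have eq: "(\<Sum>k<Suc m. \<Sum>i<n k. \<Phi> (tens (a k i) (b k i))) = \<Phi> (w (r m))" for m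
    proof -
      have "\<Phi> (w (r m)) = (\<Sum>k<Suc m. \<Phi> (z k))"
        unfolding zsum[symmetric] by (rule P.dual_space_sum[OF \<Phi>]) (rule zT)
      also have "\<dots> = (\<Sum>k<Suc m. \<Sum>i<n k. \<Phi> (tens (x k i) (y k i)))"
        unfolding zr by (intro sum.cong refl P.dual_space_sum[OF \<Phi>] tensor_in)
      finally show ?thesis by (simp add: ab)
    qed
    have "(\<lambda>m. u \<Phi> - \<Phi> (w (r m))) \<longlonglongrightarrow> 0"
    proof (rule Lim_null_comparison[where g = "\<lambda>m. (1/4) ^ m * dual_norm T \<pi> \<Phi>"])
      show "(\<lambda>m. (1/4) ^ m * dual_norm T \<pi> \<Phi>) \<longlonglongrightarrow> 0"
        by (intro tendsto_mult_left_zero LIMSEQ_power_zero) simp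
    qed (use rb[OF \<Phi>] in auto)
    from tendsto_diff[OF tendsto_const[of "u \<Phi>"] this]
    have "(\<lambda>m. \<Sum>k<Suc m. \<Sum>i<n k. \<Phi> (tens (a k i) (b k i))) \<longlonglongrightarrow> u \<Phi>"
      unfolding eq by simp
    then show "(\<lambda>m. \<Sum>k<m. \<Sum>i<n k. \<Phi> (tens (a k i) (b k i))) \<longlonglongrightarrow> u \<Phi>"
      by (rule LIMSEQ_imp_Suc)
  qed
qed

text \<open>Replacing a bounded form \<open>B\<close> by \<open>B (S \<cdot>) \<cdot>\<close>, where \<open>S\<close> is a finite rank operator close to the
  identity on the compact set of all first legs of a representation of \<open>u\<close>, changes the value
  at \<open>u\<close> only little; and the new form is a sum of rank one forms.\<close>

theorem approximation_property_imp_determined: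
  assumes AP: "approximation_property sX"
    and u: "u \<in> completion T fscale \<pi>"
    and rank_one_zero: "\<And>f g. f \<in> dualZ \<Longrightarrow> g \<in> dualZ \<Longrightarrow> u (rank_one f g) = 0"
    and \<Phi>: "\<Phi> \<in> dualT"
  shows "u \<Phi> = 0"
proof -
  interpret bi: seminormed_space fscale dualT "dual_norm T \<pi>"
    by (rule P.seminormed_space_dual)
  have ub: "u \<in> dual_space dualT fscale (dual_norm T \<pi>)"
    using u P.completion_subset_bidual by (auto simp: bidual_def)
  obtain c C where cC: "c > 0" "C > 0" "\<And>x. c * norm x \<le> N x" "\<And>x. N x \<le> C * norm x"
    using norm_equiv by blast
  obtain D and n :: "nat \<Rightarrow> nat" and x y where D: "D \<ge> 0" and x: "\<And>k i. i < n k \<Longrightarrow> N (x k i) \<le> (1/2) ^ k"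
    and y: "\<And>k. (\<Sum>i<n k. N (y k i)) \<le> D * (1/2) ^ k"
    and lim: "\<And>\<Phi>. \<Phi> \<in> dualT \<Longrightarrow> (\<lambda>m. \<Sum>k<m. \<Sum>i<n k. \<Phi> (tens (x k i) (y k i))) \<longlonglongrightarrow> u \<Phi>"
    using completion_block_representation[OF u] by blast
  define K where "K = insert 0 (\<Union>k. x k ` {..<n k})"
  have K: "compact K"
    unfolding K_def
  proof (rule compact_null_sequence_of_finite_sets[where r = "\<lambda>k. (1/2) ^ k / c"])
    show "(\<lambda>k. (1/2) ^ k / c) \<longlonglongrightarrow> 0"
      by (intro tendsto_divide_zero LIMSEQ_power_zero) simp
    fix k v assume "v \<in> x k ` {..<n k}"
    then have "N v \<le> (1/2) ^ k" using x by blast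
    then show "norm v \<le> (1/2) ^ k / c"
      using cC(1) cC(3)[of v] by (simp add: pos_le_divide_eq mult.commute)
  qed simp
  let ?M = "dual_norm T \<pi> \<Phi>"
  have M: "?M \<ge> 0" by (rule P.dual_norm_nonneg[OF \<Phi>])
  \<comment> \<open>The factor 2 is the sum of the geometric series bounding the right legs. Nothing
    on the right depends on the operator chosen for \<open>e\<close>, so \<open>e\<close> can tend
    to 0.\<close>
  have bound: "norm (u \<Phi>) \<le> ?M * C * D * 2 * e" if e: "e > 0" for e
  proof -
    obtain S where S: "Vector_Spaces.linear sX sX S" and Sb: "\<exists>C. \<forall>x. norm (S x) \<le> C * norm x"
      and Sr: "\<exists>B. finite B \<and> range S \<subseteq> span B" and Se: "\<And>x. x \<in> K \<Longrightarrow> norm (S x - x) \<le> e"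
      using AP[unfolded approximation_property_def, rule_format, OF conjI[OF K e]] by blast
    have add: "S (x + y) = S x + S y" and scale: "S (sX c x) = sX c (S x)" for x y c
      using S by (auto simp: Vector_Spaces.linear_iff)
    obtain C' where C': "\<And>x. norm (S x) \<le> C' * norm x" using Sb by blast
    define C2 where "C2 = C * \<bar>C'\<bar> / c"
    have SN: "N (S v) \<le> C2 * N v" for v
    proof -
      have "N (S v) \<le> C * (C' * norm v)"
        using cC(2) by (intro order_trans[OF cC(4)] mult_left_mono C') auto
      also have "\<dots> \<le> C * (\<bar>C'\<bar> * (N v / c))"
        using cC(1,2) cC(3)[of v] by (intro mult_left_mono mult_mono) (auto simp: pos_le_divide_eq mult.commute)
      finally show ?thesis by (simp add: C2_def)
    qed
    obtain B where "finite B" "range S \<subseteq> span B" using Sr by blast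
    then obtain r :: nat and f e' where f: "\<And>i. i < r \<Longrightarrow> f i \<in> dualZ"
      and Sf: "\<And>v. S v = (\<Sum>i<r. sX (f i v) (e' i))"
      using finite_rank_decomposition[OF _ S SN] by blast
    \<comment> \<open>Inserting the decomposition of \<open>S\<close> into \<open>\<Phi>\<close>
      leaves the rank one forms with left factor \<open>f i\<close> and right factor
      \<open>\<Phi> (e' i \<otimes> \<cdot>)\<close>.\<close>
    define g where "g i = (\<lambda>v. \<Phi> (tens (e' i) v))" for i
    have g: "g i \<in> dualZ" for i
    proof (rule dualZI)
      show "norm (g i v) \<le> (?M * N (e' i)) * N v" for v
        using dualT_form(2)[OF \<Phi>, of "e' i" v] by (simp add: g_def)
    qed (simp_all add: g_def tensor_add_right tensor_scale_right P.dual_spaceD[OF \<Phi>] tensor_in)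
    define \<Psi> where "\<Psi> = (\<Sum>i<r. rank_one (f i) (g i))"
    have \<Psi>: "\<Psi> \<in> dualT" unfolding \<Psi>_def using rank_one(1) f g by (intro bi.carrier_sum) auto
    have \<Psi>_tens: "\<Psi> (tens v v') = \<Phi> (tens (S v) v')" for v v'
    proof -
      have "tens (S v) v' = (\<Sum>i<r. tens (sX (f i v) (e' i)) v')"
        unfolding Sf by (induction r) (auto simp: tensor_add_left)
      then have "\<Phi> (tens (S v) v') = (\<Sum>i<r. f i v * g i v')"
        by (simp add: P.dual_space_sum[OF \<Phi>] tensor_in tensor_scale_left P.dual_spaceD[OF \<Phi>] g_def
            P.carrier_scale)
      then show ?thesis
        using f g by (simp add: \<Psi>_def sum_fun_apply rank_one)
    qed
    have "u \<Psi> = (\<Sum>i<r. u (rank_one (f i) (g i)))"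
      unfolding \<Psi>_def using rank_one(1) f g by (intro bi.dual_space_sum[OF ub]) auto
    then have u\<Psi>: "u \<Psi> = 0" using rank_one_zero f g by simp
    have "norm (u \<Phi> - u \<Psi>) \<le> ?M * C * D * 2 * e"
    proof (rule LIMSEQ_le_const2)
      show "(\<lambda>m. norm ((\<Sum>k<m. \<Sum>i<n k. \<Phi> (tens (x k i) (y k i))) - (\<Sum>k<m. \<Sum>i<n k. \<Psi> (tens (x k i) (y k i)))))
          \<longlonglongrightarrow> norm (u \<Phi> - u \<Psi>)"
        by (intro tendsto_norm tendsto_diff lim \<Phi> \<Psi>)
      have "norm ((\<Sum>k<m. \<Sum>i<n k. \<Phi> (tens (x k i) (y k i))) - (\<Sum>k<m. \<Sum>i<n k. \<Psi> (tens (x k i) (y k i))))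
          \<le> ?M * C * D * 2 * e" for m
      proof -
        have pt: "norm (\<Phi> (tens (x k i) (y k i)) - \<Psi> (tens (x k i) (y k i))) \<le> ?M * (C * e) * N (y k i)"
          if "i < n k" for k i
        proof -
          have "x k i \<in> K" using that by (auto simp: K_def)
          then have "C * norm (S (x k i) - x k i) \<le> C * e"
            using cC(2) by (intro mult_left_mono Se) auto
          then have le: "N (x k i - S (x k i)) \<le> C * e"
            using cC(4)[of "S (x k i) - x k i"] N_minus[of "S (x k i) - x k i"] by simp
          have eq: "\<Phi> (tens (x k i) (y k i)) - \<Psi> (tens (x k i) (y k i))
              = \<Phi> (tens (x k i - S (x k i)) (y k i))"
            unfolding \<Psi>_tens
            using tensor_add_left[of "x k i - S (x k i)" "S (x k i)" "y k i"]
              P.dual_spaceD(1)[OF \<Phi> tensor_in tensor_in, of "x k i - S (x k i)" "y k i" "S (x k i)" "y k i"]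
            by simp
          have "norm (\<Phi> (tens (x k i - S (x k i)) (y k i))) \<le> ?M * N (x k i - S (x k i)) * N (y k i)"
            by (rule dualT_form(2)[OF \<Phi>])
          also have "\<dots> \<le> ?M * (C * e) * N (y k i)"
            using le M N_nonneg by (intro mult_right_mono mult_left_mono) auto
          finally show ?thesis unfolding eq .
        qed
        have "norm ((\<Sum>k<m. \<Sum>i<n k. \<Phi> (tens (x k i) (y k i))) - (\<Sum>k<m. \<Sum>i<n k. \<Psi> (tens (x k i) (y k i))))
            = norm (\<Sum>k<m. \<Sum>i<n k. \<Phi> (tens (x k i) (y k i)) - \<Psi> (tens (x k i) (y k i)))"
          by (simp add: sum_subtractf)
        also have "\<dots> \<le> (\<Sum>k<m. \<Sum>i<n k. ?M * (C * e) * N (y k i))"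
          by (intro sum_norm_le pt) auto
        also have "\<dots> = ?M * (C * e) * (\<Sum>k<m. \<Sum>i<n k. N (y k i))"
          by (simp add: sum_distrib_left)
        also have "\<dots> \<le> ?M * (C * e) * (\<Sum>k<m. D * (1/2) ^ k)"
          using M cC(2) e by (intro mult_left_mono sum_mono y) auto
        also have "(\<Sum>k<m. D * (1/2) ^ k) = D * (\<Sum>k<m. (1/2) ^ k)" by (simp add: sum_distrib_left)
        also have "?M * (C * e) * (D * (\<Sum>k<m. (1/2) ^ k)) \<le> ?M * (C * e) * (D * 2)"
          using D M cC(2) e by (intro mult_left_mono) (simp_all add: sum_gp_strict)
        finally show ?thesis by (simp only: mult_ac)
      qed
      then show "\<exists>M. \<forall>m\<ge>M. norm ((\<Sum>k<m. \<Sum>i<n k. \<Phi> (tens (x k i) (y k i)))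
          - (\<Sum>k<m. \<Sum>i<n k. \<Psi> (tens (x k i) (y k i)))) \<le> ?M * C * D * 2 * e"
        by blast
    qed
    then show ?thesis by (simp add: u\<Psi>)
  qed
  have "norm (u \<Phi>) \<le> 0"
  proof (rule field_le_epsilon)
    fix d :: real assume d: "d > 0"
    let ?A = "?M * C * D * 2"
    have A: "?A \<ge> 0" using M cC(2) D by simp
    have "norm (u \<Phi>) \<le> ?A * (d / (?A + 1))" using d A by (intro bound) (simp add: add_nonneg_pos)
    also have "\<dots> \<le> d" using d A by (simp add: field_simps)
    finally show "norm (u \<Phi>) \<le> 0 + d" by simp
  qed
  then show ?thesis by simp
qed

end

subsection \<open>A tensor that does not attain its norm\<close>

lemma bounded_linear_embed_complex: "bounded_linear (embed_complex :: 'k::real_or_complex \<Rightarrow> complex)"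
proof (rule bounded_linear_intro[where K = 1])
  fix r and x :: 'k
  show "embed_complex (r *\<^sub>R x) = r *\<^sub>R embed_complex x"
    by (simp add: scaleR_conv_of_real embed_complex_mult embed_complex_of_real)
qed (simp_all add: embed_complex_add norm_embed_complex)

text \<open>The number 1 is an extreme point of the unit disc: the terms
  \<open>l n * (1 - Re (b n))\<close> are nonnegative with sum 0, and real part 1 in the disc leaves
  no imaginary part.\<close>

lemma convex_sum_eq_1:
  fixes a :: "nat \<Rightarrow> 'k::real_or_complex"
  assumes l: "\<And>n. 0 \<le> l n" "l sums 1" and a: "\<And>n. l n > 0 \<Longrightarrow> norm (a n) \<le> 1"
    and la: "(\<lambda>n. of_real (l n) * a n) sums 1" and n: "l n > 0"
  shows "a n = 1"
proof -
  define b where "b n = embed_complex (a n)" for n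
  have "(\<lambda>n. Re (embed_complex (of_real (l n) * a n))) sums Re (embed_complex (1::'k))"
    by (intro bounded_linear.sums[OF bounded_linear_Re] bounded_linear.sums[OF bounded_linear_embed_complex] la)
  then have "(\<lambda>n. l n * Re (b n)) sums 1"
    by (simp add: embed_complex_mult embed_complex_of_real b_def)
  from sums_diff[OF l(2) this] have s: "(\<lambda>n. l n * (1 - Re (b n))) sums 0"
    by (simp add: algebra_simps)
  have nb: "cmod (b n) \<le> 1" if "l n > 0" for n
    using a[OF that] by (simp add: b_def norm_embed_complex)
  have "0 \<le> l n * (1 - Re (b n))" for n
  proof (cases "l n > 0")
    case True
    then show ?thesis using nb[OF True] complex_Re_le_cmod[of "b n"] by simp
  next
    case False then show ?thesis using l(1)[of n] by simp
  qed
  then have "\<forall>n. l n * (1 - Re (b n)) = 0"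
    using suminf_eq_zero_iff[OF sums_summable[OF s]] sums_unique[OF s] by auto
  then have "Re (b n) = 1" using n by (metis eq_iff_diff_eq_0 less_irrefl mult_eq_0_iff)
  moreover have "(Re (b n))\<^sup>2 + (Im (b n))\<^sup>2 \<le> 1"
    using nb[OF n] by (metis cmod_power2 norm_ge_zero power_le_one)
  ultimately have "b n = embed_complex (1::'k)" by (simp add: complex_eq_iff)
  then show ?thesis by (simp only: b_def embed_complex_eq_iff)
qed

text \<open>Two numbers of the unit disc with product 1 are conjugate. Thus \<open>b\<close> plays
  the role of the conjugate of \<open>a\<close>, and a bilinear expression becomes a squared
  modulus.\<close>

lemma sum_times_sum_of_inverses:
  fixes a b :: "nat \<Rightarrow> 'k::real_or_complex"
  assumes "\<And>k. k \<in> A \<Longrightarrow> norm (a k) \<le> 1" "\<And>k. k \<in> A \<Longrightarrow> norm (b k) \<le> 1"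
    and "\<And>k. k \<in> A \<Longrightarrow> a k * b k = 1"
  shows "sum a A * sum b A = of_real ((norm (sum a A))\<^sup>2)"
proof -
  have "embed_complex (b k) = cnj (embed_complex (a k))" if k: "k \<in> A" for k
  proof -
    have 1: "norm (a k) * norm (b k) = 1" using assms(3)[OF k] by (metis norm_mult norm_one)
    have "1 \<le> norm (a k)"
      using 1 mult_left_mono[OF assms(2)[OF k], of "norm (a k)"] by simp
    then have "norm (a k) = 1" using assms(1)[OF k] by simp
    then have c: "embed_complex (a k) * cnj (embed_complex (a k)) = 1"
      by (simp add: complex_norm_square[symmetric] norm_embed_complex)
    have "embed_complex (a k) * embed_complex (b k) = 1"
      using assms(3)[OF k] by (simp flip: embed_complex_mult)
    then show ?thesis using c by (metis mult.commute mult.left_commute mult_1)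
  qed
  then have "embed_complex (sum b A) = cnj (embed_complex (sum a A))"
    by (simp add: embed_complex_sum)
  then have "embed_complex (sum a A * sum b A) = of_real ((norm (sum a A))\<^sup>2)"
    by (simp add: embed_complex_mult complex_norm_square[symmetric] norm_embed_complex)
  then show ?thesis by (metis embed_complex_of_real embed_complex_eq_iff)
qed

context renormed_space
begin

text \<open>A vector outside the span of the earlier ones is corrected so that the earlier
  functionals vanish on it, and scaled down; then a functional equal to 1 there is corrected so that
  it vanishes on the earlier vectors. The norms of the functionals are not controlled.\<close>

lemma ex_biorthogonal:
  assumes inf: "infinite_dimensional sX"
  obtains e :: "nat \<Rightarrow> 'a" and r where "\<And>k. r k \<in> dualZ" "\<And>j k. r k (e j) = (if j = k then 1 else 0)"
    "\<And>k. N (e k) \<le> (1/2) ^ k"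
proof -
  \<comment> \<open>The condition on the pair \<open>q\<close> consults \<open>F\<close> only below
    \<open>n\<close>, as well-founded choice requires.\<close>
  define P where "P F n q \<longleftrightarrow> N (fst q) \<le> (1/2) ^ n \<and> snd q \<in> dualZ \<and> snd q (fst q) = 1 \<and>
      (\<forall>i<n. snd (F i) (fst q) = 0 \<and> snd q (fst (F i)) = 0)"
    for F :: "nat \<Rightarrow> 'a \<times> ('a \<Rightarrow> 'k)" and n q
  have "\<exists>F. \<forall>n. P F n (F n)"
  proof (rule dependent_wellorder_choice)
    show "P F n q = P G n q" if "\<And>y. y < n \<Longrightarrow> F y = G y" for q F G n
      using that by (auto simp: P_def)
  next
    fix n F assume F: "\<And>y. y < n \<Longrightarrow> P F y (F y)"
    let ?e = "\<lambda>i. fst (F i)" and ?r = "\<lambda>i. snd (F i)"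
    have r: "?r i \<in> dualZ" if "i < n" for i using F[OF that] by (simp add: P_def)
    have bi: "?r i (?e j) = (if i = j then 1 else 0)" if "i < n" "j < n" for i j
      using F[OF that(1)] F[OF that(2)] by (cases i j rule: linorder_cases) (auto simp: P_def)
    obtain x where x: "x \<notin> span (?e ` {..<n})"
      using inf unfolding infinite_dimensional_def by blast
    define d where "d = x - (\<Sum>i<n. sX (?r i x) (?e i))"
    have "(\<Sum>i<n. sX (?r i x) (?e i)) \<in> span (?e ` {..<n})"
      by (intro span_sum span_scale span_base) auto
    then have d0: "d \<noteq> 0" using x by (auto simp: d_def)
    have rd: "?r i d = 0" if i: "i < n" for i
    proof -
      have "?r i d = ?r i x - (\<Sum>j<n. ?r j x * ?r i (?e j))"
        unfolding d_def
        by (simp add: Z.dual_space_diff[OF r[OF i]] Z.dual_space_sum[OF r[OF i]] Z.dual_spaceD[OF r[OF i]])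
      also have "(\<Sum>j<n. ?r j x * ?r i (?e j)) = (\<Sum>j<n. if j = i then ?r i x else 0)"
        using i by (intro sum.cong) (auto simp: bi)
      finally show ?thesis using i by simp
    qed
    have Nd: "N d > 0" using d0 N_eq_0D N_nonneg by (metis less_eq_real_def)
    define c where "c = sX (of_real ((1/2) ^ n / N d)) d"
    have c0: "c \<noteq> 0" using d0 Nd by (simp add: c_def)
    have Nc: "N c \<le> (1/2) ^ n"
      using Nd by (simp add: c_def N_scale norm_divide norm_power)
    have rc: "?r i c = 0" if "i < n" for i
      using rd[OF that] by (simp add: c_def Z.dual_spaceD[OF r[OF that]])
    obtain g where g: "g \<in> dualZ" "g c = 1" using ex_dual_eq_1[OF c0] by blast
    define g' where "g' = g - (\<Sum>i<n. fscale (g (?e i)) (?r i))"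
    have "g' \<in> dualZ"
      unfolding g'_def using g r
      by (intro fscale.subspace_diff[OF Z.dual_space_subspace] fscale.subspace_sum[OF Z.dual_space_subspace]
          fscale.subspace_scale[OF Z.dual_space_subspace]) auto
    moreover have "g' c = 1"
      using rc g by (simp add: g'_def sum_fun_apply fscale_def)
    moreover have "g' (?e j) = 0" if j: "j < n" for j
    proof -
      have "g' (?e j) = g (?e j) - (\<Sum>i<n. g (?e i) * ?r i (?e j))"
        by (simp add: g'_def sum_fun_apply fscale_def)
      also have "(\<Sum>i<n. g (?e i) * ?r i (?e j)) = (\<Sum>i<n. if i = j then g (?e j) else 0)"
        using j by (intro sum.cong) (auto simp: bi)
      finally show ?thesis using j by simp
    qed
    ultimately have "P F n (c, g')" using Nc rc by (simp add: P_def)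
    then show "\<exists>q. P F n q" ..
  qed
  then obtain F where F: "\<And>n. P F n (F n)" by blast
  show ?thesis
  proof (rule that[of "\<lambda>k. snd (F k)" "\<lambda>k. fst (F k)"])
    show "snd (F k) (fst (F j)) = (if j = k then 1 else 0)" for j k
      using F[of j] F[of k] by (cases j k rule: linorder_cases) (auto simp: P_def)
  qed (use F in \<open>auto simp: P_def\<close>)
qed

end

text \<open>All that the argument against attainment uses. The last two conditions pull in opposite
  directions: \<open>face\<close> wants the ball thin where \<open>norm (r 0 x) = 1\<close>, while
  \<open>signs\<close> wants it to contain points of that face on which later \<open>r k\<close>
  also reach modulus 1.\<close>

locale face_norm = renormed_space sX N
  for sX :: "'k::real_or_complex \<Rightarrow> 'a::banach \<Rightarrow> 'a" and N +
  fixes e :: "nat \<Rightarrow> 'a" and r :: "nat \<Rightarrow> 'a \<Rightarrow> 'k" and C :: real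
  assumes r_dual: "r k \<in> dual_space UNIV sX N"
    and biorthogonal: "r k (e j) = (if j = k then 1 else 0)"
    and e_small: "N (e k) \<le> C * (1/2) ^ k"
    and r0_le: "norm (r 0 x) \<le> N x"
    and face: "N x \<le> 1 \<Longrightarrow> norm (r 0 x) = 1 \<Longrightarrow> norm (r k x) \<le> 1"
    and signs: "(\<And>k. \<bar>\<sigma> k\<bar> = 1) \<Longrightarrow> N (e 0 + (\<Sum>k=1..<n. \<sigma> k *\<^sub>R e k)) \<le> 1"

lemma ex_face_norm:
  fixes sX :: "'k::real_or_complex \<Rightarrow> 'a::banach \<Rightarrow> 'a"
  assumes X: "banach_space_over sX" and inf: "infinite_dimensional sX"
  obtains N e r C where "face_norm sX N e r C"
proof -
  interpret X: banach_space_over sX by (rule X)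
  interpret X: renormed_space sX norm by (rule X.renormed_space_norm)
  obtain e :: "nat \<Rightarrow> 'a" and r where r: "\<And>k. r k \<in> X.dualZ"
    and bi: "\<And>j k. r k (e j) = (if j = k then 1 else 0)" and e: "\<And>k. norm (e k) \<le> (1/2) ^ k"
  proof (rule X.ex_biorthogonal[OF inf])
    fix e :: "nat \<Rightarrow> 'a" and r
    assume "\<And>k. r k \<in> X.dualZ" "\<And>j k. r k (e j) = (if j = k then 1 else 0)" "\<And>k. norm (e k) \<le> (1/2) ^ k"
    then show thesis by (rule that[of r e])
  qed
  note rD = X.Z.dual_spaceD[OF r]
  \<comment> \<open>The weights \<open>M k\<close> make \<open>r k\<close> bounded on the new unit ball and still give \<open>norm (r k x) \<le> 1\<close>
    on the face \<open>norm (r 0 x) = 1\<close>, although the norms of the \<open>r k\<close> are unbounded.\<close>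
  define M where "M k = dual_norm UNIV norm (r k)" for k
  have M: "M k \<ge> 0" "norm (r k x) \<le> M k * norm x" for k x
    using X.Z.dual_norm_nonneg[OF r] X.Z.dual_norm_bound[OF r] by (auto simp: M_def)
  define q where "q k x = (norm (r k x) + M k * norm (r 0 x)) / (1 + M k)" for k x
  \<comment> \<open>The first term makes \<open>N\<close> dominate a multiple of the old norm. The
    factor 1/2 admits the sign combinations, whose old norm is at most 1 + 1/2 + 1/4 + ... =
    2.\<close>
  define N where "N x = max (norm x / 2) (SUP k. q k x)" for x
  have M1: "1 + M k > 0" for k using M(1)[of k] by linarith
  have q_le: "q k x \<le> (1 + M 0) * norm x" for k x
  proof -
    have "norm (r k x) + M k * norm (r 0 x) \<le> M k * norm x + M k * (M 0 * norm x)"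
      using M by (intro add_mono mult_left_mono) auto
    also have "\<dots> = M k * ((1 + M 0) * norm x)" by (simp add: algebra_simps)
    also have "\<dots> \<le> (1 + M k) * ((1 + M 0) * norm x)"
      using M1[of 0] by (intro mult_right_mono) auto
    finally show ?thesis using M1[of k] by (simp add: q_def pos_divide_le_eq mult.commute)
  qed
  have bdd: "bdd_above (range (\<lambda>k. q k x))" for x
    using q_le by (intro bdd_aboveI[of _ "(1 + M 0) * norm x"]) auto
  have q_N: "q k x \<le> N x" for k x
    unfolding N_def by (rule max.coboundedI2) (rule cSUP_upper[OF _ bdd], simp)
  have norm_N: "norm x \<le> 2 * N x" for x
    unfolding N_def using max.cobounded1[of "norm x / 2"] by (simp add: field_simps)
  have N_leI: "N x \<le> c" if "norm x \<le> 2 * c" "\<And>k. q k x \<le> c" for x c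
    using that by (auto simp: N_def intro!: cSUP_least)
  have q_scale: "q k (sX a x) = norm a * q k x" for k a x
    by (simp add: q_def rD norm_mult algebra_simps)
  have q_add: "q k (x + y) \<le> q k x + q k y" for k x y
  proof -
    have "norm (r k (x + y)) + M k * norm (r 0 (x + y))
        \<le> (norm (r k x) + norm (r k y)) + M k * (norm (r 0 x) + norm (r 0 y))"
      using M by (intro add_mono mult_left_mono) (auto simp: rD norm_triangle_ineq)
    then have "q k (x + y) \<le> ((norm (r k x) + norm (r k y)) + M k * (norm (r 0 x) + norm (r 0 y))) / (1 + M k)"
      unfolding q_def using M1[of k] by (intro divide_right_mono) auto
    also have "\<dots> = q k x + q k y"
      unfolding q_def add_divide_distrib[symmetric] by (simp add: algebra_simps)
    finally show ?thesis .
  qed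
  have N_scale_le: "N (sX a x) \<le> norm a * N x" for a x
  proof (rule N_leI)
    show "norm (sX a x) \<le> 2 * (norm a * N x)"
      using mult_left_mono[OF norm_N, of "norm a"] by (simp add: X.norm_scale mult_ac)
    show "q k (sX a x) \<le> norm a * N x" for k
      unfolding q_scale by (intro mult_left_mono q_N) auto
  qed
  have N_ge0: "N x \<ge> 0" for x using norm_N[of x] norm_ge_zero[of x] by linarith
  have N_scale: "N (sX a x) = norm a * N x" for a x
    by (rule homogeneous_if_le[where V = UNIV, OF X.vector_space_axioms]) (auto simp: N_ge0 N_scale_le)
  have N_up: "N x \<le> (1 + M 0) * norm x" for x
  proof (rule N_leI)
    have "1 * norm x \<le> (1 + M 0) * norm x" using M(1)[of 0] by (intro mult_right_mono) auto
    then show "norm x \<le> 2 * ((1 + M 0) * norm x)" using norm_ge_zero[of x] by linarith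
  qed (rule q_le)
  have eqv: "equivalent_norm sX N"
    unfolding equivalent_norm_def norm_over_def
  proof (intro conjI allI impI)
    show "N (x + y) \<le> N x + N y" for x y
    proof (rule N_leI)
      show "norm (x + y) \<le> 2 * (N x + N y)"
        using order_trans[OF norm_triangle_ineq add_mono[OF norm_N norm_N], of x y] by simp
      show "q k (x + y) \<le> N x + N y" for k
        using q_add[of k x y] q_N[of k x] q_N[of k y] by linarith
    qed
    show "N x = 0 \<Longrightarrow> x = 0" for x using norm_N[of x] by simp
    show "\<exists>c>0. \<exists>C>0. \<forall>x. c * norm x \<le> N x \<and> N x \<le> C * norm x"
    proof (intro exI conjI allI)
      show "(1/2) * norm x \<le> N x" for x using norm_N[of x] by simp
      show "N x \<le> (1 + M 0) * norm x" for x by (rule N_up)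
    qed (use M1 in auto)
  qed (simp_all add: N_ge0 N_scale)
  have "face_norm sX N e r (1 + M 0)"
  proof unfold_locales
    show "equivalent_norm sX N" by (rule eqv)
    show "r k \<in> dual_space UNIV sX N" for k
    proof -
      have "norm (r k x) \<le> (M k * 2) * N x" for x
        using order_trans[OF M(2) mult_left_mono[OF norm_N M(1)]] by (simp add: mult.assoc)
      then show ?thesis using rD by (auto simp: dual_space_def intro!: exI[of _ "M k * 2"])
    qed
    show "r k (e j) = (if j = k then 1 else 0)" for k j by (rule bi)
    show "N (e k) \<le> (1 + M 0) * (1/2) ^ k" for k
      using order_trans[OF N_up mult_left_mono[OF e]] M1[of 0] by simp
    \<comment> \<open>For \<open>k = 0\<close> the weight cancels, so \<open>r 0\<close> itself is
      among the seminorms and has norm at most 1 for \<open>N\<close>.\<close>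
    have q0: "q 0 x = norm (r 0 x)" for x
      using M1[of 0] by (simp add: q_def field_simps)
    show r0: "norm (r 0 x) \<le> N x" for x
      using q_N[of 0 x] q0 by simp
    show "norm (r k x) \<le> 1" if "N x \<le> 1" "norm (r 0 x) = 1" for k x
    proof -
      have "(norm (r k x) + M k) / (1 + M k) \<le> 1" using q_N[of k x] that by (simp add: q_def)
      then show ?thesis using M1[of k] by simp
    qed
    fix \<sigma> :: "nat \<Rightarrow> real" and n assume \<sigma>: "\<And>k. \<bar>\<sigma> k\<bar> = 1"
    let ?x = "e 0 + (\<Sum>k=1..<n. \<sigma> k *\<^sub>R e k)"
    have rx: "r j ?x = (if j = 0 then 1 else if j < n then of_real (\<sigma> j) else 0)" for j
    proof -
      have "r j ?x = r j (e 0) + (\<Sum>k=1..<n. of_real (\<sigma> k) * r j (e k))"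
        by (simp add: rD X.Z.dual_space_sum[OF r] flip: X.scale_of_real)
      also have "(\<Sum>k=1..<n. of_real (\<sigma> k) * r j (e k)) = (\<Sum>k=1..<n. if k = j then of_real (\<sigma> j) else 0)"
        by (intro sum.cong) (auto simp: bi)
      finally show ?thesis by (auto simp: bi)
    qed
    show "N ?x \<le> 1"
    proof (rule N_leI)
      have "norm ?x \<le> norm (e 0) + (\<Sum>k=1..<n. norm (e k))"
        using \<sigma> by (intro order_trans[OF norm_triangle_ineq] add_left_mono sum_norm_le) auto
      also have "\<dots> \<le> 1 + (\<Sum>k=1..<n. (1/2) ^ k)"
        using e[of 0] e by (intro add_mono sum_mono) auto
      also have "\<dots> \<le> 2"
      proof -
        have "(\<Sum>k=1..<n. (1/2::real) ^ k) \<le> 1 - (1/2) ^ (n - 1)"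
          by (induction n) (auto simp: sum.atLeastLessThan_Suc not_less_eq_eq power_eq_if split: if_splits)
        then show ?thesis by (smt (verit) zero_le_power zero_le_divide_1_iff)
      qed
      finally show "norm ?x \<le> 2 * 1" by simp
      show "q k ?x \<le> 1" for k
      proof -
        have "norm (r k ?x) \<le> 1" "norm (r 0 ?x) = 1" unfolding rx using \<sigma> by auto
        then show ?thesis using M1[of k] by (simp add: q_def)
      qed
    qed
  qed
  then show ?thesis by (rule that)
qed

section \<open>The diagonal tensor and its norm\<close>

context face_norm
begin

text \<open>The series of the \<open>e k \<otimes> e k\<close>, given by its action on functionals
  so that it is directly a candidate for the bidual, with value 0 outside
  \<open>dualT\<close>.\<close>

definition diagonal :: "(((('a \<Rightarrow> 'a \<Rightarrow> 'k) \<Rightarrow> 'k) \<Rightarrow> 'k) \<Rightarrow> 'k)" where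
  "diagonal \<Phi> = (if \<Phi> \<in> dualT then \<Sum>k. \<Phi> (tens (e k) (e k)) else 0)"

lemma diagonal_terms:
  assumes \<Phi>: "\<Phi> \<in> dualT"
  shows "norm (\<Phi> (tens (e k) (e k))) \<le> dual_norm T \<pi> \<Phi> * C\<^sup>2 * (1/4) ^ k"
proof -
  have C: "C \<ge> 0" using e_small[of 0] N_nonneg[of "e 0"] by simp
  have "norm (\<Phi> (tens (e k) (e k))) \<le> dual_norm T \<pi> \<Phi> * (N (e k) * N (e k))"
    using dualT_form(2)[OF \<Phi>] by (simp add: mult.assoc)
  also have "\<dots> \<le> dual_norm T \<pi> \<Phi> * ((C * (1/2) ^ k) * (C * (1/2) ^ k))"
    using C N_nonneg P.dual_norm_nonneg[OF \<Phi>] by (intro mult_left_mono mult_mono e_small) auto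
  also have "(C * (1/2) ^ k) * (C * (1/2) ^ k) = C\<^sup>2 * ((1/2) * (1/2)) ^ k"
    by (simp only: power_mult_distrib power2_eq_square mult_ac)
  finally show ?thesis by (simp add: mult.assoc)
qed

lemma summable_diagonal: "\<Phi> \<in> dualT \<Longrightarrow> summable (\<lambda>k. \<Phi> (tens (e k) (e k)))"
  by (rule summable_comparison_test'[where g = "\<lambda>k. dual_norm T \<pi> \<Phi> * C\<^sup>2 * (1/4) ^ k"])
    (auto intro!: summable_mult summable_geometric diagonal_terms)

text \<open>The tail is geometric with ratio 1/4, whence the 4/3. The estimate is uniform over the
  dual ball, the form that \<open>P.completionI\<close> needs.\<close>

lemma diagonal_partial_sums:
  assumes \<Phi>: "\<Phi> \<in> dualT"
  shows "norm (diagonal \<Phi> - \<Phi> (\<Sum>k<n. tens (e k) (e k))) \<le> (C\<^sup>2 * (4/3) * (1/4) ^ n) * dual_norm T \<pi> \<Phi>"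
proof -
  have eq: "diagonal \<Phi> - \<Phi> (\<Sum>k<n. tens (e k) (e k)) = (\<Sum>k. \<Phi> (tens (e (k + n)) (e (k + n))))"
    using \<Phi> by (simp add: diagonal_def P.dual_space_sum[OF \<Phi>] tensor_in
        suminf_minus_initial_segment[OF summable_diagonal[OF \<Phi>]])
  have "norm (\<Sum>k. \<Phi> (tens (e (k + n)) (e (k + n)))) \<le> (\<Sum>k. (dual_norm T \<pi> \<Phi> * C\<^sup>2 * (1/4) ^ n) * (1/4) ^ k)"
  proof (rule norm_suminf_le)
    show "norm (\<Phi> (tens (e (k + n)) (e (k + n)))) \<le> (dual_norm T \<pi> \<Phi> * C\<^sup>2 * (1/4) ^ n) * (1/4) ^ k" for k
      using diagonal_terms[OF \<Phi>, of "k + n"] by (simp add: power_add mult_ac)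
  qed (auto intro!: summable_mult summable_geometric)
  also have "\<dots> = (dual_norm T \<pi> \<Phi> * C\<^sup>2 * (1/4) ^ n) * (4/3)"
    by (subst suminf_mult) (auto simp: suminf_geometric intro!: summable_geometric)
  finally show ?thesis unfolding eq by (simp add: mult_ac)
qed

lemma diagonal_in_completion: "diagonal \<in> completion T fscale \<pi>"
proof (rule P.completionI(1)[where w = "\<lambda>n. \<Sum>k<n. tens (e k) (e k)"])
  show "\<And>\<Phi>. \<Phi> \<notin> dualT \<Longrightarrow> diagonal \<Phi> = 0" by (simp add: diagonal_def)
  show "(\<lambda>n. C\<^sup>2 * (4/3) * (1/4) ^ n) \<longlonglongrightarrow> 0"
    by (intro tendsto_mult_right_zero LIMSEQ_power_zero) simp
qed (intro P.carrier_sum tensor_in diagonal_partial_sums; assumption)+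

text \<open>The parallelogram identity \<open>2 (v \<otimes> v + e \<otimes> e) = (v + e) \<otimes> (v + e) + (v - e) \<otimes> (v - e)\<close>
  writes the partial sums of the diagonal tensor as averages of \<open>x \<otimes> x\<close> over sign choices.\<close>

lemma proj_norm_sign_average:
  assumes "\<And>\<sigma>. (\<And>k. \<bar>\<sigma> k\<bar> = 1) \<Longrightarrow> N (v + (\<Sum>k=1..<n. \<sigma> k *\<^sub>R e k)) \<le> 1"
  shows "\<pi> (tens v v + (\<Sum>k=1..<n. tens (e k) (e k))) \<le> 1"
  using assms
\<comment> \<open>\<open>v\<close> absorbs \<open>e n\<close> with either sign when the last summand
  is removed, so it must stay general.\<close>
proof (induction n arbitrary: v)
  case 0
  have "N v \<le> 1" using "0.prems"[of "\<lambda>_. 1"] by simp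
  then have "N v * N v \<le> 1" using N_nonneg by (simp add: mult_le_one)
  then show ?case using proj_norm_tensor_le[of v v] by simp
next
  case (Suc n)
  show ?case
  proof (cases "n \<ge> 1")
    case False
    then have "n = 0" by simp
    have "N v \<le> 1" using Suc.prems[of "\<lambda>_. 1"] \<open>n = 0\<close> by simp
    then have "N v * N v \<le> 1" using N_nonneg by (simp add: mult_le_one)
    then show ?thesis using proj_norm_tensor_le[of v v] \<open>n = 0\<close> by simp
  next
    case True
    let ?S = "\<Sum>k=1..<n. tens (e k) (e k)"
    have IH: "\<pi> (tens (v + s *\<^sub>R e n) (v + s *\<^sub>R e n) + ?S) \<le> 1" if s: "\<bar>s\<bar> = 1" for s
    proof (rule Suc.IH)
      fix \<sigma> :: "nat \<Rightarrow> real" assume \<sigma>: "\<And>k. \<bar>\<sigma> k\<bar> = 1"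
      have "N (v + (\<Sum>k=1..<Suc n. (\<sigma>(n := s)) k *\<^sub>R e k)) \<le> 1"
        using \<sigma> s by (intro Suc.prems) auto
      then show "N ((v + s *\<^sub>R e n) + (\<Sum>k=1..<n. \<sigma> k *\<^sub>R e k)) \<le> 1"
        using True by (simp add: algebra_simps)
    qed
    let ?p = "tens (v + e n) (v + e n) + ?S" and ?m = "tens (v - e n) (v - e n) + ?S"
    have p: "\<pi> ?p \<le> 1" and m: "\<pi> ?m \<le> 1" using IH[of 1] IH[of "- 1"] by auto
    have inT: "?p \<in> T" "?m \<in> T" by (intro P.carrier_add P.carrier_sum tensor_in)+
    have minus: "tens (a - b) c = tens a c - tens b c" "tens c (a - b) = tens c a - tens c b" for a b c
      using tensor_add_left[of "a - b" b c] tensor_add_right[of c "a - b" b] by auto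
    have eq: "tens v v + (\<Sum>k=1..<Suc n. tens (e k) (e k)) = fscale (of_real (1/2)) (?p + ?m)"
      using True
      by (auto simp: fun_eq_iff fscale_def tensor_add_left tensor_add_right minus field_simps)
    have "\<pi> (tens v v + (\<Sum>k=1..<Suc n. tens (e k) (e k))) = 1/2 * \<pi> (?p + ?m)"
      unfolding eq by (subst proj_norm_scale[OF P.carrier_add[OF inT]]) (simp add: norm_divide)
    also have "\<dots> \<le> 1/2 * (\<pi> ?p + \<pi> ?m)"
      by (intro mult_left_mono proj_norm_triangle inT) simp
    also have "\<dots> \<le> 1/2 * (1 + 1)" by (intro mult_left_mono add_mono p m) simp
    also have "\<dots> = 1" by simp
    finally show ?thesis .
  qed
qed

text \<open>Biorthogonality leaves finitely many terms of the series: on combinations of the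
  \<open>r k\<close> the diagonal is the bilinear dot product of the coefficients. This supplies the
  orthogonality relations for the Bessel estimate.\<close>

lemma diagonal_rank_one:
  "diagonal (rank_one (\<Sum>k<n. fscale (a k) (r k)) (\<Sum>k<n. fscale (b k) (r k))) = (\<Sum>k<n. a k * b k)"
proof -
  have f: "(\<Sum>k<n. fscale (a k) (r k)) \<in> dualZ" for a
    by (intro fscale.subspace_sum[OF Z.dual_space_subspace] fscale.subspace_scale[OF Z.dual_space_subspace] r_dual)
  have fe: "(\<Sum>k<n. fscale (a k) (r k)) (e j) = (if j < n then a j else 0)" for a j
  proof -
    have "(\<Sum>k<n. fscale (a k) (r k)) (e j) = (\<Sum>k<n. if k = j then a j else 0)"
      unfolding sum_fun_apply fscale_def biorthogonal by (intro sum.cong) auto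
    then show ?thesis by simp
  qed
  have "diagonal (rank_one (\<Sum>k<n. fscale (a k) (r k)) (\<Sum>k<n. fscale (b k) (r k)))
      = (\<Sum>j. (if j < n then a j * b j else 0))"
    using rank_one(1)[OF f f] rank_one(2)[OF f f] fe by (auto simp: diagonal_def intro!: suminf_cong)
  also have "\<dots> = (\<Sum>j<n. if j < n then a j * b j else 0)"
    by (rule suminf_finite) auto
  finally show ?thesis by simp
qed

lemma diagonal_rank_one_same: "diagonal (rank_one (r k) (r k)) = 1"
proof -
  have "(\<Sum>j<Suc k. fscale (if j = k then 1 else 0) (r j)) = r k"
    by (simp add: fun_eq_iff sum_fun_apply fscale_def)
  then show ?thesis
    using diagonal_rank_one[where n = "Suc k" and a = "\<lambda>j. if j = k then 1 else 0"
        and b = "\<lambda>j. if j = k then 1 else 0"] by simp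
qed

text \<open>From above, the partial sums are averages of tensors of cost at most 1. From below, the
  form \<open>rank_one (r 0) (r 0)\<close> has norm at most 1 and takes the value 1.\<close>

lemma norm_diagonal: "bidual_norm T fscale \<pi> diagonal = 1"
proof (rule antisym)
  show "bidual_norm T fscale \<pi> diagonal \<le> 1"
  proof (rule P.bidual_norm_le)
    fix \<Phi> assume \<Phi>: "\<Phi> \<in> dualT"
    let ?w = "\<lambda>n. \<Sum>k<n. tens (e k) (e k)"
    have "(\<lambda>n. \<Phi> (?w n)) \<longlonglongrightarrow> diagonal \<Phi>"
      using summable_LIMSEQ[OF summable_diagonal[OF \<Phi>]] \<Phi>
      by (simp add: diagonal_def P.dual_space_sum[OF \<Phi>] tensor_in)
    then have "(\<lambda>n. norm (\<Phi> (?w n))) \<longlonglongrightarrow> norm (diagonal \<Phi>)" by (rule tendsto_norm)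
    moreover have "norm (\<Phi> (?w n)) \<le> 1 * dual_norm T \<pi> \<Phi>" if "n \<ge> 1" for n
    proof -
      have "?w n = tens (e 0) (e 0) + (\<Sum>k=1..<n. tens (e k) (e k))"
        using that by (simp add: lessThan_atLeast0 sum.atLeast_Suc_lessThan)
      then have "\<pi> (?w n) \<le> 1" using proj_norm_sign_average[OF signs] by simp
      then have "dual_norm T \<pi> \<Phi> * \<pi> (?w n) \<le> dual_norm T \<pi> \<Phi> * 1"
        by (intro mult_left_mono P.dual_norm_nonneg \<Phi>)
      moreover have "norm (\<Phi> (?w n)) \<le> dual_norm T \<pi> \<Phi> * \<pi> (?w n)"
        by (intro P.dual_norm_bound \<Phi> P.carrier_sum tensor_in)
      ultimately show ?thesis by simp
    qed
    ultimately show "norm (diagonal \<Phi>) \<le> 1 * dual_norm T \<pi> \<Phi>"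
      by (intro LIMSEQ_le_const2) auto
  qed simp
  have d: "diagonal \<in> bidual T fscale \<pi>"
    using diagonal_in_completion P.completion_subset_bidual by blast
  interpret bi: seminormed_space fscale "bidual T fscale \<pi>" "bidual_norm T fscale \<pi>"
    by (rule P.seminormed_space_bidual)
  have r0: "dual_norm UNIV N (r 0) \<le> 1" by (rule Z.dual_norm_le) (auto simp: r0_le)
  have "1 = norm (diagonal (rank_one (r 0) (r 0)))" by (simp add: diagonal_rank_one_same)
  also have "\<dots> \<le> bidual_norm T fscale \<pi> diagonal * dual_norm T \<pi> (rank_one (r 0) (r 0))"
    by (rule P.bidual_norm_bound[OF d rank_one(1)[OF r_dual r_dual]])
  also have "\<dots> \<le> bidual_norm T fscale \<pi> diagonal * 1"
  proof (rule mult_left_mono)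
    show "dual_norm T \<pi> (rank_one (r 0) (r 0)) \<le> 1"
      using rank_one(3)[OF r_dual r_dual, of 0 0] mult_le_one[OF r0 Z.dual_norm_nonneg[OF r_dual] r0] by simp
    show "0 \<le> bidual_norm T fscale \<pi> diagonal" by (rule bi.seminorm_nonneg[OF d])
  qed
  finally show "1 \<le> bidual_norm T fscale \<pi> diagonal" by simp
qed

theorem diagonal_not_norm_attaining: "diagonal \<notin> NA_pi sX N sX N"
proof
  assume "diagonal \<in> NA_pi sX N sX N"
  then obtain l x y where l: "\<And>n. 0 \<le> l n" and x: "\<And>n. N (x n) \<le> 1" and y: "\<And>n. N (y n) \<le> 1"
    and lim: "(\<lambda>m. bidual_norm T fscale \<pi> (diagonal -
       (\<Sum>n<m. fscale (of_real (l n)) (canonical T fscale \<pi> (tens (x n) (y n)))))) \<longlonglongrightarrow> 0"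
    and l1: "l sums 1"
    unfolding NA_pi_def ptensor_norm_def ptensor_def unit_ball_def
    by (auto simp: norm_diagonal)
  interpret bi: seminormed_space fscale "bidual T fscale \<pi>" "bidual_norm T fscale \<pi>"
    by (rule P.seminormed_space_bidual)
  have d: "diagonal \<in> bidual T fscale \<pi>"
    using diagonal_in_completion P.completion_subset_bidual by blast
  have sums: "(\<lambda>n. of_real (l n) * \<Phi> (tens (x n) (y n))) sums diagonal \<Phi>" if \<Phi>: "\<Phi> \<in> dualT" for \<Phi>
  proof -
    let ?S = "\<lambda>m. \<Sum>n<m. fscale (of_real (l n)) (canonical T fscale \<pi> (tens (x n) (y n)))"
    have S: "?S m \<in> bidual T fscale \<pi>" for m
      by (intro bi.carrier_sum bi.carrier_scale P.canonical_in_bidual tensor_in)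
    have "(\<lambda>m. (diagonal - ?S m) \<Phi>) \<longlonglongrightarrow> 0"
    proof (rule Lim_null_comparison)
      show "(\<lambda>m. bidual_norm T fscale \<pi> (diagonal - ?S m) * dual_norm T \<pi> \<Phi>) \<longlonglongrightarrow> 0"
        by (rule tendsto_mult_left_zero[OF lim])
      show "\<forall>\<^sub>F m in sequentially. norm ((diagonal - ?S m) \<Phi>)
          \<le> bidual_norm T fscale \<pi> (diagonal - ?S m) * dual_norm T \<pi> \<Phi>"
        by (intro always_eventually allI P.bidual_norm_bound bi.carrier_diff d S \<Phi>)
    qed
    from tendsto_diff[OF tendsto_const[of "diagonal \<Phi>"] this] show ?thesis
      using \<Phi> by (simp add: sums_def sum_fun_apply fscale_def P.canonical_apply)
  qed
  have r0: "norm (r 0 v) \<le> 1" if "N v \<le> 1" for v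
    using r0_le[of v] that by linarith
  \<comment> \<open>The value 1 of the diagonal at this form is a convex combination of points of
    the unit disc.\<close>
  have r0_prod: "r 0 (x n) * r 0 (y n) = 1" if "l n > 0" for n
  proof (rule convex_sum_eq_1[OF l l1 _ _ that])
    show "norm (r 0 (x n) * r 0 (y n)) \<le> 1" for n
      using r0[OF x[of n]] r0[OF y[of n]] by (simp add: norm_mult mult_le_one)
    show "(\<lambda>n. of_real (l n) * (r 0 (x n) * r 0 (y n))) sums 1"
      using sums[OF rank_one(1)[OF r_dual r_dual], of 0 0]
      by (simp add: rank_one(2)[OF r_dual r_dual] diagonal_rank_one_same)
  qed
  \<comment> \<open>Two factors of modulus at most 1 with product 1 both have modulus 1, so both
    legs of an atom lie on the face.\<close>
  have rk: "norm (r k (x n)) \<le> 1 \<and> norm (r k (y n)) \<le> 1" if "l n > 0" for k n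
  proof -
    have p: "norm (r 0 (x n)) * norm (r 0 (y n)) = 1" using r0_prod[OF that] by (metis norm_mult norm_one)
    have "norm (r 0 (x n)) * norm (r 0 (y n)) \<le> norm (r 0 (x n)) * 1"
      "norm (r 0 (x n)) * norm (r 0 (y n)) \<le> 1 * norm (r 0 (y n))"
      by (intro mult_left_mono mult_right_mono r0 x y; simp)+
    then have "norm (r 0 (x n)) = 1" "norm (r 0 (y n)) = 1"
      using p r0[OF x[of n]] r0[OF y[of n]] by auto
    then show ?thesis using face x y by blast
  qed
  \<comment> \<open>The bound just obtained from the face allows the extreme point argument for
    every \<open>k\<close>, not only for \<open>k = 0\<close>.\<close>
  have rk_prod: "r k (x n) * r k (y n) = 1" if "l n > 0" for k n
  proof (rule convex_sum_eq_1[OF l l1 _ _ that])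
    show "norm (r k (x n) * r k (y n)) \<le> 1" if "l n > 0" for n
      using rk[OF that, of k] by (simp add: norm_mult mult_le_one)
    show "(\<lambda>n. of_real (l n) * (r k (x n) * r k (y n))) sums 1"
      using sums[OF rank_one(1)[OF r_dual r_dual], of k k]
      by (simp add: rank_one(2)[OF r_dual r_dual] diagonal_rank_one_same)
  qed
  obtain n0 where n0: "l n0 > 0"
  proof -
    have "\<exists>n. l n \<noteq> 0"
    proof (rule ccontr)
      assume "\<not> (\<exists>n. l n \<noteq> 0)"
      then have "l = (\<lambda>_. 0)" by auto
      then have "l sums 0" by simp
      then show False using l1 sums_unique2 by force
    qed
    then show thesis using that l by (metis less_eq_real_def)
  qed
  have bound: "l n0 * real K \<le> 1" if K: "K > 0" for K
  proof -
    \<comment> \<open>\<open>r k (y n0)\<close> is the conjugate of \<open>r k (x n0)\<close>, so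
      \<open>f\<close> is the Bessel test combination peaking at the atom \<open>n0\<close>: there
      it equals \<open>K\<close>, while its weighted square sum over all atoms is only
      \<open>K\<close>.\<close>
    define f g where "f = (\<Sum>k<K. fscale (r k (y n0)) (r k))" and "g = (\<Sum>k<K. fscale (r k (x n0)) (r k))"
    have f: "f \<in> dualZ" and g: "g \<in> dualZ" unfolding f_def g_def
      by (intro fscale.subspace_sum[OF Z.dual_space_subspace] fscale.subspace_scale[OF Z.dual_space_subspace] r_dual)+
    have fg: "f (x n) * g (y n) = of_real ((norm (f (x n)))\<^sup>2)" if n: "l n > 0" for n
    proof -
      have "(\<Sum>k<K. r k (y n0) * r k (x n)) * (\<Sum>k<K. r k (x n0) * r k (y n))
          = of_real ((norm (\<Sum>k<K. r k (y n0) * r k (x n)))\<^sup>2)"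
      proof (rule sum_times_sum_of_inverses)
        show "norm (r k (y n0) * r k (x n)) \<le> 1" "norm (r k (x n0) * r k (y n)) \<le> 1" for k
          using rk[OF n0, of k] rk[OF n, of k] by (simp_all add: norm_mult mult_le_one)
        have "r k (y n0) * r k (x n) * (r k (x n0) * r k (y n))
            = (r k (x n0) * r k (y n0)) * (r k (x n) * r k (y n))" for k by (simp add: mult_ac)
        then show "r k (y n0) * r k (x n) * (r k (x n0) * r k (y n)) = 1" for k
          by (simp add: rk_prod[OF n0] rk_prod[OF n])
      qed
      then show ?thesis by (simp add: f_def g_def sum_fun_apply fscale_def)
    qed
    have K1: "(\<Sum>k<K. r k (y n0) * r k (x n0)) = of_nat K"
      by (subst mult.commute) (simp add: rk_prod[OF n0])
    have "(\<lambda>n. of_real (l n) * (f (x n) * g (y n))) sums of_nat K"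
      using sums[OF rank_one(1)[OF f g]] diagonal_rank_one[where n = K and a = "\<lambda>k. r k (y n0)" and b = "\<lambda>k. r k (x n0)"] K1
      by (simp add: rank_one(2)[OF f g] f_def[symmetric] g_def[symmetric])
    moreover have "of_real (l n) * (f (x n) * g (y n)) = of_real (l n * (norm (f (x n)))\<^sup>2)" for n
    proof (cases "l n > 0")
      case True then show ?thesis by (simp add: fg)
    next
      case False then show ?thesis using l[of n] by simp
    qed
    ultimately have "(\<lambda>n. of_real (l n * (norm (f (x n)))\<^sup>2) :: 'k) sums of_real (real K)" by simp
    then have s: "(\<lambda>n. l n * (norm (f (x n)))\<^sup>2) sums real K"
      by (simp only: sums_of_real_iff)
    have "f (x n0) = of_nat K" using K1 by (simp add: f_def sum_fun_apply fscale_def)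
    then have "l n0 * (real K)\<^sup>2 = (\<Sum>n\<in>{n0}. l n * (norm (f (x n)))\<^sup>2)" by simp
    also have "\<dots> \<le> real K"
      unfolding sums_unique[OF s] using l by (intro sum_le_suminf sums_summable[OF s]) auto
    finally have "(l n0 * real K) * real K \<le> 1 * real K" by (simp add: power2_eq_square mult.assoc)
    then show ?thesis using K by simp
  qed
  obtain K :: nat where "1 / l n0 < real K" using reals_Archimedean2 by blast
  moreover have "1 / l n0 > 0" using n0 by simp
  ultimately have "K > 0" "1 < l n0 * real K" using n0 by (auto simp: field_simps intro: gr0I)
  then show False using bound[of K] by simp
qed

end

subsection \<open>A coupling of discrete distributions\<close>

text \<open>The first nonzero digit contributes \<open>(1/3) ^ k\<close>, all later ones together at
  most half of that. In base 2 the tail could cancel the leading digit.\<close>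

lemma ternary_separation:
  fixes d :: "nat \<Rightarrow> real"
  assumes d: "\<And>i. \<bar>d i\<bar> \<le> 1" and z: "\<And>i. i < k \<Longrightarrow> d i = 0" and k: "\<bar>d k\<bar> = 1"
  shows "(1/3) ^ k / 2 \<le> \<bar>\<Sum>i. d i * (1/3) ^ i\<bar>"
proof -
  have s: "summable (\<lambda>i. d i * (1/3) ^ i)"
    by (rule summable_comparison_test'[where g = "\<lambda>i. (1/3) ^ i"])
      (use d in \<open>auto simp: abs_mult intro!: summable_geometric mult_left_le_one_le\<close>)
  let ?t = "\<Sum>i. d (i + Suc k) * (1/3) ^ (i + Suc k)"
  have "(\<Sum>i<Suc k. d i * (1/3) ^ i) = d k * (1/3) ^ k" using z by simp
  then have eq: "(\<Sum>i. d i * (1/3) ^ i) = ?t + d k * (1/3) ^ k"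
    using suminf_split_initial_segment[OF s, of "Suc k"] by simp
  have "norm ?t \<le> (\<Sum>i. (1/3) ^ Suc k * (1/3) ^ i)"
  proof (rule norm_suminf_le)
    show "norm (d (i + Suc k) * (1/3) ^ (i + Suc k)) \<le> (1/3) ^ Suc k * (1/3) ^ i" for i
      using mult_right_mono[OF d[of "i + Suc k"], of "(1/3) ^ (i + Suc k)"]
      by (simp add: abs_mult power_add mult_ac)
  qed (intro summable_mult summable_geometric, simp)
  also have "\<dots> = (1/3) ^ Suc k * (3/2)"
    by (subst suminf_mult) (auto simp: suminf_geometric intro!: summable_geometric)
  finally have "\<bar>?t\<bar> \<le> (1/3) ^ k / 2" by simp
  moreover have "\<bar>d k * (1/3) ^ k\<bar> = (1/3) ^ k" using k by (simp add: abs_mult)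
  ultimately show ?thesis unfolding eq by linarith
qed

text \<open>A Cantor set coding of the outcomes of all tests. Using only the digits 0 and 1 in base
  3 leaves gaps, so every digit is locally constant as a function of the code.\<close>

definition ternary_code :: "(nat \<Rightarrow> 'z \<Rightarrow> bool) \<Rightarrow> 'z \<Rightarrow> real" where
  "ternary_code t z = (\<Sum>k. of_bool (t k z) * (1/3) ^ k)"

lemma summable_ternary_code: "summable (\<lambda>k. of_bool (t k z) * (1/3::real) ^ k)"
  by (rule summable_comparison_test'[where g = "\<lambda>i. (1/3) ^ i"])
    (auto intro!: summable_geometric)

lemma ternary_code_bounds: "0 \<le> ternary_code t z" "ternary_code t z \<le> 2"
proof -
  show "0 \<le> ternary_code t z"
    unfolding ternary_code_def by (intro suminf_nonneg summable_ternary_code) auto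
  have "ternary_code t z \<le> (\<Sum>k. (1/3) ^ k)"
    unfolding ternary_code_def by (intro suminf_le summable_ternary_code summable_geometric) auto
  then show "ternary_code t z \<le> 2" by (simp add: suminf_geometric)
qed

text \<open>If digit \<open>k\<close> differs, the first differing digit is at
  \<open>m \<le> k\<close>, and a difference there separates the codes at least as much as one at
  \<open>k\<close>.\<close>

lemma ternary_code_close:
  assumes "\<bar>ternary_code t z - ternary_code t z'\<bar> < (1/3) ^ k / 2"
  shows "t k z = t k z'"
proof (rule ccontr)
  assume ne: "t k z \<noteq> t k z'"
  define m where "m = (LEAST m. t m z \<noteq> t m z')"
  have m: "t m z \<noteq> t m z'" using ne unfolding m_def by (rule LeastI)
  have less: "t i z = t i z'" if "i < m" for i using that not_less_Least unfolding m_def by blast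
  have mk: "m \<le> k" unfolding m_def using ne by (rule Least_le)
  define d where "d i = of_bool (t i z) - (of_bool (t i z') :: real)" for i
  have "ternary_code t z - ternary_code t z' = (\<Sum>i. d i * (1/3) ^ i)"
    unfolding ternary_code_def d_def
    by (simp add: suminf_diff[OF summable_ternary_code summable_ternary_code] left_diff_distrib)
  moreover have "(1/3) ^ m / 2 \<le> \<bar>\<Sum>i. d i * (1/3) ^ i\<bar>"
    by (rule ternary_separation) (use m less in \<open>auto simp: d_def\<close>)
  moreover have "(1/3::real) ^ k \<le> (1/3) ^ m" using mk by (intro power_decreasing) auto
  ultimately show False using assms by linarith
qed

text \<open>Encoding the tests in one real number whose convergence forces every test to stabilise
  reduces the statement to Helly's and Skorohod's theorems on the line.\<close>

lemma coupling:
  fixes P :: "nat \<Rightarrow> 'z pmf" and t :: "nat \<Rightarrow> 'z \<Rightarrow> bool"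
  assumes fin: "\<And>n. finite (set_pmf (P n))" and D: "\<And>n. set_pmf (P n) \<subseteq> D"
    and sep: "\<And>z z'. z \<in> D \<Longrightarrow> z' \<in> D \<Longrightarrow> (\<And>k. t k z = t k z') \<Longrightarrow> z = z'"
  obtains \<Omega> :: "real measure" and s Z where "prob_space \<Omega>" "strict_mono (s :: nat \<Rightarrow> nat)"
    "\<And>n. Z n \<in> \<Omega> \<rightarrow>\<^sub>M count_space UNIV" "\<And>n \<omega>. \<omega> \<in> space \<Omega> \<Longrightarrow> Z n \<omega> \<in> D"
    "\<And>\<omega> k. \<omega> \<in> space \<Omega> \<Longrightarrow> \<exists>b. \<forall>\<^sub>F n in sequentially. t k (Z n \<omega>) = b"
    "\<And>n. distr \<Omega> (count_space UNIV) (Z n) = measure_pmf (P (s n))"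
proof -
  let ?\<theta> = "ternary_code t"
  define \<mu> where "\<mu> n = distr (measure_pmf (P n)) borel ?\<theta>" for n
  have \<mu>: "real_distribution (\<mu> n)" for n
    unfolding \<mu>_def by (intro prob_space.real_distribution_distr measure_pmf.prob_space_axioms) simp
  have "tight \<mu>"
    unfolding tight_def
  proof (intro conjI allI impI \<mu>)
    fix \<epsilon> :: real assume \<epsilon>: "\<epsilon> > 0"
    \<comment> \<open>Codes lie between 0 and 2; the left end is excluded from the interval and so
      must be negative.\<close>
    have "measure (\<mu> n) {-1<..2} = 1" for n
    proof -
      have eq: "measure (\<mu> n) {-1<..2} = measure (measure_pmf (P n)) (?\<theta> -` {-1<..2} \<inter> space (measure_pmf (P n)))"
        unfolding \<mu>_def by (rule measure_distr) auto
      have "-1 < ?\<theta> z" for z using ternary_code_bounds(1)[of t z] by linarith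
      then have "?\<theta> -` {-1<..2} \<inter> space (measure_pmf (P n)) = space (measure_pmf (P n))"
        using ternary_code_bounds(2)[of t] by auto
      with eq show ?thesis by (simp add: measure_pmf.prob_space)
    qed
    then show "\<exists>a b. a < b \<and> (\<forall>n. 1 - \<epsilon> < measure (\<mu> n) {a<..b})"
      using \<epsilon> by (intro exI[of _ "-1"] exI[of _ 2]) auto
  qed
  then obtain s M where s: "strict_mono (s :: nat \<Rightarrow> nat)" and M: "real_distribution M"
    and conv: "weak_conv_m (\<mu> \<circ> s) M"
    using tight_imp_convergent_subsubsequence[of \<mu> id] by (auto simp: strict_mono_id)
  have "\<And>n. real_distribution ((\<mu> \<circ> s) n)" using \<mu> by simp
  from Skorohod[OF this M conv]
  obtain \<Omega> :: "real measure" and Y :: "nat \<Rightarrow> real \<Rightarrow> real" and Y' :: "real \<Rightarrow> real" where \<Omega>: "prob_space \<Omega>"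
    and Y': "\<forall>n. Y n \<in> borel_measurable \<Omega>" "\<forall>n. distr \<Omega> borel (Y n) = (\<mu> \<circ> s) n"
    and lim': "\<forall>\<omega>\<in>space \<Omega>. (\<lambda>n. Y n \<omega>) \<longlonglongrightarrow> Y' \<omega>"
    by blast
  have Y: "Y n \<in> borel_measurable \<Omega>" "distr \<Omega> borel (Y n) = \<mu> (s n)" for n using Y' by auto
  have lim: "(\<lambda>n. Y n \<omega>) \<longlonglongrightarrow> Y' \<omega>" if "\<omega> \<in> space \<Omega>" for \<omega> using lim' that by blast
  define F where "F n = set_pmf (P (s n))" for n
  have F: "finite (F n)" "F n \<subseteq> D" "F n \<noteq> {}" for n
    using fin D by (auto simp: F_def set_pmf_not_empty)
  obtain z0 where z0: "z0 \<in> D" using F[of 0] by blast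
  define dec where "dec n y = (if y \<in> ?\<theta> ` F n then inv_into (F n) ?\<theta> y else z0)" for n y
  \<comment> \<open>The variables \<open>Y n\<close> have the law of the codes, hence are codes only
    almost surely. Off the common good set \<open>G\<close> every \<open>Z n\<close> is the constant
    \<open>z0\<close>, so the tests stabilise at each point and not merely almost
    everywhere.\<close>
  define G where "G = {\<omega> \<in> space \<Omega>. \<forall>n. Y n \<omega> \<in> ?\<theta> ` F n}"
  define Z where "Z n \<omega> = (if \<omega> \<in> G then dec n (Y n \<omega>) else z0)" for n \<omega>
  have inj: "inj_on ?\<theta> D"
  proof (rule inj_onI)
    fix z z' assume "z \<in> D" "z' \<in> D" "?\<theta> z = ?\<theta> z'"
    then show "z = z'" by (intro sep ternary_code_close) auto
  qed
  have dec_\<theta>: "dec n (?\<theta> z) = z" if "z \<in> F n" for n z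
    using that inj_on_subset[OF inj F(2)[of n]] by (auto simp: dec_def)
  have dec_D: "dec n y \<in> D" for n y
    using z0 F(2)[of n] inv_into_into[of y ?\<theta> "F n"] by (auto simp: dec_def)
  have dec_meas: "dec n \<in> borel \<rightarrow>\<^sub>M count_space UNIV" for n
  proof (rule measurableI)
    fix A :: "'z set"
    have eq: "dec n -` A \<inter> space borel = (?\<theta> ` F n \<inter> dec n -` A) \<union> (if z0 \<in> A then - (?\<theta> ` F n) else {})"
      by (auto simp: dec_def split: if_splits)
    have "?\<theta> ` F n \<inter> dec n -` A \<in> sets borel"
      using F(1)[of n] by (intro borel_closed finite_imp_closed) auto
    moreover have "(if z0 \<in> A then - (?\<theta> ` F n) else {}) \<in> sets borel"
      using borel_comp[OF borel_closed[OF finite_imp_closed[OF finite_imageI[OF F(1)[of n], of ?\<theta>]]]] by simp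
    ultimately show "dec n -` A \<inter> space borel \<in> sets borel"
      unfolding eq by (rule sets.Un)
  qed simp
  have Fb: "?\<theta> ` F n \<in> sets borel" for n
    using F(1)[of n] by (intro borel_closed finite_imp_closed) auto
  have ae: "AE \<omega> in \<Omega>. Y n \<omega> \<in> ?\<theta> ` F n" for n
  proof -
    have "AE z in measure_pmf (P (s n)). ?\<theta> z \<in> ?\<theta> ` F n"
      by (auto simp: AE_measure_pmf_iff F_def)
    then have "AE y in \<mu> (s n). y \<in> ?\<theta> ` F n"
      unfolding \<mu>_def using Fb[of n] by (subst AE_distr_iff) auto
    then have "AE y in distr \<Omega> borel (Y n). y \<in> ?\<theta> ` F n" by (simp only: Y(2))
    then show ?thesis using Fb[of n] Y(1) by (subst (asm) AE_distr_iff) auto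
  qed
  have G: "G \<in> sets \<Omega>" unfolding G_def using Y(1) Fb by measurable
  have aeG: "AE \<omega> in \<Omega>. \<omega> \<in> G"
    using ae unfolding G_def by (auto simp: AE_all_countable)
  have Zm: "Z n \<in> \<Omega> \<rightarrow>\<^sub>M count_space UNIV" for n
    unfolding Z_def
  proof (rule measurable_If_set)
    show "(\<lambda>\<omega>. dec n (Y n \<omega>)) \<in> \<Omega> \<rightarrow>\<^sub>M count_space UNIV"
      using measurable_compose[OF Y(1) dec_meas] by simp
    show "G \<inter> space \<Omega> \<in> sets \<Omega>" using G by auto
  qed simp
  show ?thesis
  proof (rule that[OF \<Omega> s Zm])
    show "Z n \<omega> \<in> D" for n \<omega> using dec_D z0 by (simp add: Z_def)
  next
    fix \<omega> k assume \<omega>: "\<omega> \<in> space \<Omega>"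
    show "\<exists>b. \<forall>\<^sub>F n in sequentially. t k (Z n \<omega>) = b"
    proof (cases "\<omega> \<in> G")
      case False
      then show ?thesis by (simp add: Z_def)
    next
      case True
      have \<theta>Z: "?\<theta> (Z n \<omega>) = Y n \<omega>" for n
      proof -
        have "Y n \<omega> \<in> ?\<theta> ` F n" using True by (simp add: G_def)
        then obtain z where "z \<in> F n" "Y n \<omega> = ?\<theta> z" by blast
        then show ?thesis using True by (simp add: Z_def dec_\<theta>)
      qed
      have "Cauchy (\<lambda>n. Y n \<omega>)" using lim[OF \<omega>] by (rule LIMSEQ_imp_Cauchy)
      then obtain n0 where n0: "\<And>m n. m \<ge> n0 \<Longrightarrow> n \<ge> n0 \<Longrightarrow> dist (Y m \<omega>) (Y n \<omega>) < (1/3) ^ k / 2"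
        unfolding Cauchy_def by (metis half_gt_zero zero_less_divide_1_iff zero_less_numeral zero_less_power)
      have "t k (Z n \<omega>) = t k (Z n0 \<omega>)" if "n \<ge> n0" for n
        by (rule ternary_code_close) (use n0[OF that order_refl] in \<open>simp add: \<theta>Z dist_real_def\<close>)
      then show ?thesis unfolding eventually_sequentially by blast
    qed
  next
    fix n
    have "distr \<Omega> (count_space UNIV) (Z n) = distr \<Omega> (count_space UNIV) (\<lambda>\<omega>. dec n (Y n \<omega>))"
      using measurable_compose[OF Y(1) dec_meas] Zm aeG
      by (intro distr_cong_AE) (auto simp: Z_def)
    also have "\<dots> = distr (distr \<Omega> borel (Y n)) (count_space UNIV) (dec n)"
      using Y(1) dec_meas by (subst distr_distr) (auto simp: comp_def)
    also have "\<dots> = distr (measure_pmf (P (s n))) (count_space UNIV) (\<lambda>z. dec n (?\<theta> z))"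
      unfolding Y(2) \<mu>_def using dec_meas by (simp add: distr_distr comp_def)
    also have "\<dots> = distr (measure_pmf (P (s n))) (count_space UNIV) (\<lambda>z. z)"
      by (intro distr_cong_AE) (auto simp: AE_measure_pmf_iff dec_\<theta> F_def)
    also have "\<dots> = measure_pmf (P (s n))"
      by (rule distr_id2) simp
    finally show "distr \<Omega> (count_space UNIV) (Z n) = measure_pmf (P (s n))" .
  qed
qed

subsection \<open>Weak convergence in reflexive spaces\<close>

context renormed_space
begin

text \<open>Equivalent norms have the same bounded functionals, and hence the same dual, bidual and
  canonical map as sets and functions; only the norms on them change.\<close>

lemma reflexive_space_renorm:
  assumes "reflexive_space sX norm"
  shows "reflexive_space sX N"
proof -
  interpret X: renormed_space sX norm by (rule renormed_space_norm)
  obtain c C where cC: "c > 0" "C > 0" "\<And>x. c * norm x \<le> N x" "\<And>x. N x \<le> C * norm x"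
    using norm_equiv by blast
  have XN: "norm x \<le> (1 / c) * N x" for x using cC(1) cC(3)[of x] by (simp add: field_simps)
  note to_N = dual_space_mono[OF X.Z.seminormed_space_axioms Z.seminormed_space_axioms _ XN]
  note to_X = dual_space_mono[OF Z.seminormed_space_axioms X.Z.seminormed_space_axioms _ cC(4)]
  have D: "X.dualZ = dualZ" using to_N(1) to_X(1) cC by auto
  interpret d: seminormed_space fscale dualZ "dual_norm UNIV N" by (rule Z.seminormed_space_dual)
  interpret dX: seminormed_space fscale dualZ "dual_norm UNIV norm"
    using X.Z.seminormed_space_dual by (simp add: D)
  have "bidual UNIV sX norm = bidual UNIV sX N"
    unfolding bidual_def D
  proof (intro equalityI subsetI)
    show "u \<in> dual_space dualZ fscale (dual_norm UNIV N)"
      if "u \<in> dual_space dualZ fscale (dual_norm UNIV norm)" for u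
      by (rule dual_space_mono(1)[OF dX.seminormed_space_axioms d.seminormed_space_axioms _ _ that, of C])
        (use cC to_X(2) in auto)
    show "u \<in> dual_space dualZ fscale (dual_norm UNIV norm)"
      if "u \<in> dual_space dualZ fscale (dual_norm UNIV N)" for u
      by (rule dual_space_mono(1)[OF d.seminormed_space_axioms dX.seminormed_space_axioms _ _ that, of "1 / c"])
        (use cC to_N(2) D in auto)
  qed
  moreover have "canonical UNIV sX norm = canonical UNIV sX N"
    unfolding canonical_def D ..
  ultimately show ?thesis using assms by (simp add: reflexive_space_def)
qed

text \<open>A countable family with \<open>N x\<close> the supremum of the
  \<open>norm (h j x)\<close>. Countability lets it replace the whole dual both in the coupling and
  in measurability proofs.\<close>

definition norming :: "(nat \<Rightarrow> 'a \<Rightarrow> 'k) \<Rightarrow> bool" where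
  "norming h \<longleftrightarrow> (\<forall>j. h j \<in> dualZ \<and> (\<forall>x. norm (h j x) \<le> N x)) \<and>
     (\<forall>x r. (\<forall>j. norm (h j x) \<le> r) \<longrightarrow> N x \<le> r)"

lemma ex_dense_sequence:
  assumes "separable_space (euclidean :: 'a topology)"
  obtains d :: "nat \<Rightarrow> 'a" where "\<And>x e. e > 0 \<Longrightarrow> \<exists>j. N (x - d j) < e"
proof -
  obtain S :: "'a set" where S: "countable S" "closure S = UNIV"
    using assms by (auto simp: separable_space_def)
  obtain c C where cC: "c > 0" "C > 0" "\<And>x. c * norm x \<le> N x" "\<And>x. N x \<le> C * norm x"
    using norm_equiv by blast
  have "S \<noteq> {}" using S by auto
  then have range: "range (from_nat_into S) = S" using S(1) by (rule range_from_nat_into)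
  show ?thesis
  proof (rule that)
    fix x and e :: real assume e: "e > 0"
    have "x \<in> closure S" using S by simp
    moreover have "e / C > 0" using e cC(2) by simp
    ultimately obtain y where y: "y \<in> S" "dist y x < e / C" unfolding closure_approachable by blast
    then obtain j where j: "y = from_nat_into S j" using range by blast
    have "N (x - y) \<le> C * norm (x - y)" by (rule cC(4))
    also have "\<dots> < e" using y(2) cC(2) by (simp add: dist_norm norm_minus_commute pos_less_divide_eq mult.commute)
    finally show "\<exists>j. N (x - from_nat_into S j) < e" using j by blast
  qed
qed

text \<open>Norming functionals at a dense sequence suffice, since each of them has Lipschitz
  constant 1 for \<open>N\<close>.\<close>

lemma ex_norming:
  assumes "separable_space (euclidean :: 'a topology)"
  obtains h where "norming h"
proof -
  obtain d :: "nat \<Rightarrow> 'a" where d: "\<And>x e. e > 0 \<Longrightarrow> \<exists>j. N (x - d j) < e"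
    using ex_dense_sequence[OF assms] by blast
  have "\<forall>j. \<exists>f. f \<in> dualZ \<and> f (d j) = of_real (N (d j)) \<and> (\<forall>x. norm (f x) \<le> N x)"
    using Z.hahn_banach by (metis UNIV_I)
  then obtain h where h: "\<And>j. h j \<in> dualZ" "\<And>j. h j (d j) = of_real (N (d j))" "\<And>j x. norm (h j x) \<le> N x"
    by metis
  have "N x \<le> r" if r: "\<And>j. norm (h j x) \<le> r" for x r
  proof (rule field_le_epsilon)
    fix e :: real assume e: "e > 0"
    obtain j where j: "N (x - d j) < e / 2" using d[of "e/2"] e by auto
    have "N x \<le> N (x - d j) + N (d j)" using N_triangle[of "x - d j" "d j"] by simp
    also have "N (d j) = norm (h j x - h j (x - d j))"
      using h(2)[of j] N_nonneg by (simp add: Z.dual_space_diff[OF h(1)])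
    also have "\<dots> \<le> norm (h j x) + norm (h j (x - d j))" by (rule norm_triangle_ineq4)
    also have "\<dots> \<le> r + N (x - d j)" by (intro add_mono r h)
    finally show "N x \<le> r + e" using j by simp
  qed
  then show ?thesis using that[of h] h by (auto simp: norming_def)
qed

lemma norming_separates: "norming h \<Longrightarrow> (\<And>j. h j x = h j y) \<Longrightarrow> x = y"
proof -
  assume h: "norming h" and eq: "\<And>j. h j x = h j y"
  have "h j (x - y) = 0" for j
    using h eq Z.dual_space_diff[of "h j" x y] by (simp add: norming_def)
  then have "N (x - y) \<le> 0" using h by (simp add: norming_def)
  then have "N (x - y) = 0" using N_nonneg by (simp add: antisym)
  then show ?thesis using N_eq_0D by fastforce
qed

text \<open>The oscillation of \<open>f (x n)\<close> at infinity is a seminorm in \<open>f\<close>; a functional on the dual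
  dominated by it is evaluation at a vector annihilated by every \<open>h j\<close>.\<close>

lemma weakly_convergent_if_norming:
  assumes refl: "reflexive_space sX N" and h: "norming h"
    and x: "\<And>n. N (x n) \<le> 1" and conv: "\<And>j. convergent (\<lambda>n. h j (x n))"
  obtains y where "N y \<le> 1" "\<And>f. f \<in> dualZ \<Longrightarrow> (\<lambda>n. f (x n)) \<longlonglongrightarrow> f y"
proof -
  interpret dual: seminormed_space fscale dualZ "dual_norm UNIV N"
    by (rule Z.seminormed_space_dual)
  have hd: "h j \<in> dualZ" for j using h by (simp add: norming_def)
  have fx: "norm (f (x n)) \<le> dual_norm UNIV N f" if "f \<in> dualZ" for f n
    using Z.dual_norm_bound[OF that, of "x n"] mult_left_mono[OF x[of n] Z.dual_norm_nonneg[OF that]] by simp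
  \<comment> \<open>\<open>S f\<close> collects the bounds for the oscillation of
    \<open>f (x n)\<close> on some tail; infimum 0 means that \<open>f (x n)\<close> is
    Cauchy.\<close>
  define S where "S f = {c. c \<ge> 0 \<and> (\<forall>\<^sub>F n in sequentially. \<forall>m\<ge>n. norm (f (x m) - f (x n)) \<le> c)}" for f :: "'a \<Rightarrow> 'k"
  define osc where "osc f = Inf (S f)" for f
  have S2: "2 * dual_norm UNIV N f \<in> S f" if f: "f \<in> dualZ" for f
  proof -
    have "norm (f (x m) - f (x n)) \<le> 2 * dual_norm UNIV N f" for m n
      using norm_triangle_ineq4[of "f (x m)" "f (x n)"] fx[OF f, of m] fx[OF f, of n] by linarith
    then show ?thesis using Z.dual_norm_nonneg[OF f] by (simp add: S_def)
  qed
  have bdd: "bdd_below (S f)" for f by (rule bdd_belowI[of _ 0]) (simp add: S_def)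
  have osc_le: "osc f \<le> c" if "c \<in> S f" for f c
    unfolding osc_def using that bdd by (rule cInf_lower)
  have S_ne: "S f \<noteq> {}" if "f \<in> dualZ" for f
    using S2[OF that] by blast
  have osc_nonneg: "osc f \<ge> 0" if "f \<in> dualZ" for f
    unfolding osc_def by (rule cInf_greatest[OF S_ne[OF that]]) (simp add: S_def)
  have osc_approx: "\<exists>c\<in>S f. c < osc f + e" if "f \<in> dualZ" "e > 0" for f e
    using cInf_lessD[OF S_ne[OF that(1)], of "osc f + e"] that(2) unfolding osc_def by auto
  have osc_add: "osc (f + g) \<le> osc f + osc g" if f: "f \<in> dualZ" and g: "g \<in> dualZ" for f g
  proof (rule field_le_epsilon)
    fix e :: real assume e: "e > 0"
    obtain c d where c: "c \<in> S f" "c < osc f + e/2" and d: "d \<in> S g" "d < osc g + e/2"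
      using osc_approx[OF f, of "e/2"] osc_approx[OF g, of "e/2"] e by auto
    have "\<forall>\<^sub>F n in sequentially. \<forall>m\<ge>n. norm ((f + g) (x m) - (f + g) (x n)) \<le> c + d"
    proof -
      have "\<forall>\<^sub>F n in sequentially. \<forall>m\<ge>n. norm (f (x m) - f (x n)) \<le> c"
        "\<forall>\<^sub>F n in sequentially. \<forall>m\<ge>n. norm (g (x m) - g (x n)) \<le> d"
        using c(1) d(1) by (auto simp: S_def)
      then show ?thesis
      proof eventually_elim
        case (elim n)
        show ?case
        proof (intro allI impI)
          fix m assume "m \<ge> n"
          have eq: "(f + g) (x m) - (f + g) (x n) = (f (x m) - f (x n)) + (g (x m) - g (x n))" by simp
          show "norm ((f + g) (x m) - (f + g) (x n)) \<le> c + d"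
            unfolding eq
            by (rule order_trans[OF norm_triangle_ineq add_mono]) (use elim \<open>m \<ge> n\<close> in auto)
        qed
      qed
    qed
    then have "c + d \<in> S (f + g)" using c d by (auto simp: S_def)
    then show "osc (f + g) \<le> osc f + osc g + e" using osc_le[of "c + d" "f + g"] c d by linarith
  qed
  have osc_scale_le: "osc (fscale a f) \<le> norm a * osc f" if f: "f \<in> dualZ" for a f
  proof (rule field_le_epsilon)
    fix e :: real assume e: "e > 0"
    define d where "d = e / (norm a + 1)"
    have na: "norm a + 1 > 0" by (simp add: add_nonneg_pos)
    have d: "d > 0" using e na by (simp add: d_def)
    have "norm a * d \<le> (norm a + 1) * d" using d by (intro mult_right_mono) auto
    then have d2: "norm a * d \<le> e" using na by (simp add: d_def)
    obtain c where c: "c \<in> S f" "c < osc f + d" using osc_approx[OF f d] by blast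
    have "norm a * c \<in> S (fscale a f)"
      using c(1) by (auto simp: S_def fscale_def norm_mult mult_left_mono
          simp flip: right_diff_distrib elim!: eventually_mono)
    then have "osc (fscale a f) \<le> norm a * c" by (rule osc_le)
    also have "\<dots> \<le> norm a * (osc f + d)" using c(2) by (intro mult_left_mono) auto
    finally show "osc (fscale a f) \<le> norm a * osc f + e" using d2 by (simp add: distrib_left)
  qed
  have osc_scale: "osc (fscale a f) = norm a * osc f" if f: "f \<in> dualZ" for a f
    by (rule homogeneous_if_le[where V = dualZ and p = osc,
        OF vector_space_fscale dual.carrier_scale osc_nonneg osc_scale_le f])
  interpret osc: seminormed_space fscale dualZ osc
    by unfold_locales (auto simp: Z.dual_space_subspace osc_nonneg osc_scale osc_add)
  have osc_h: "osc (h j) = 0" for j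
  proof -
    have "osc (h j) \<le> 0 + e" if e: "e > 0" for e
    proof -
      have "Cauchy (\<lambda>n. h j (x n))" using conv by (rule convergent_Cauchy)
      then obtain n0 where "\<And>m n. m \<ge> n0 \<Longrightarrow> n \<ge> n0 \<Longrightarrow> dist (h j (x m)) (h j (x n)) < e"
        using e unfolding Cauchy_def by blast
      then have "e \<in> S (h j)"
        using e by (auto simp: S_def eventually_sequentially dist_norm intro!: exI[of _ n0] less_imp_le)
      then show ?thesis using osc_le by simp
    qed
    then show ?thesis using osc_nonneg[OF hd[of j]] field_le_epsilon by (metis antisym)
  qed
  have bidual_eq: "bidual UNIV sX N = range (canonical UNIV sX N)"
    using refl by (simp add: reflexive_space_def)
  have osc_0: "osc f = 0" if f: "f \<in> dualZ" for f
  proof -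
    obtain \<Phi> where \<Phi>: "\<Phi> \<in> dual_space dualZ fscale osc" "\<Phi> f = of_real (osc f)"
      "\<And>g. g \<in> dualZ \<Longrightarrow> norm (\<Phi> g) \<le> osc g"
      using osc.hahn_banach[OF f] by blast
    \<comment> \<open>Domination by the oscillation implies boundedness in the dual norm, which puts
      \<open>\<Phi>\<close> in the bidual, where reflexivity applies.\<close>
    have "norm (\<Phi> g) \<le> 2 * dual_norm UNIV N g" if "g \<in> dualZ" for g
      using \<Phi>(3)[OF that] osc_le[OF S2[OF that]] by linarith
    then have "\<Phi> \<in> bidual UNIV sX N"
      using \<Phi>(1) unfolding bidual_def dual_space_def[of dualZ] by blast
    then obtain z where z: "\<Phi> = canonical UNIV sX N z" using bidual_eq by blast
    have "h j z = h j 0" for j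
      using \<Phi>(3)[OF hd[of j]] osc_h[of j] hd[of j]
      by (simp add: z Z.canonical_apply Z.dual_space_zero)
    then have "z = 0" by (rule norming_separates[OF h])
    then have "\<Phi> f = 0" using f by (simp add: z Z.canonical_apply Z.dual_space_zero)
    then show ?thesis using \<Phi>(2) by simp
  qed
  have conv_f: "convergent (\<lambda>n. f (x n))" if f: "f \<in> dualZ" for f
  proof -
    have "Cauchy (\<lambda>n. f (x n))"
      unfolding Cauchy_altdef2
    proof (intro allI impI)
      fix e :: real assume "e > 0"
      then obtain c where c: "c \<in> S f" "c < e" using osc_approx[OF f, of e] osc_0[OF f] by auto
      then show "\<exists>n0. \<forall>n\<ge>n0. dist (f (x n)) (f (x n0)) < e"
        by (force simp: S_def eventually_sequentially dist_norm)
    qed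
    then show ?thesis by (rule Cauchy_convergent)
  qed
  \<comment> \<open>Second use of reflexivity: the pointwise limit is a bounded functional on the
    dual, hence evaluation at the weak limit \<open>y\<close>.\<close>
  define \<Phi> where "\<Phi> f = (if f \<in> dualZ then lim (\<lambda>n. f (x n)) else 0)" for f
  have \<Phi>_lim: "(\<lambda>n. f (x n)) \<longlonglongrightarrow> \<Phi> f" if "f \<in> dualZ" for f
    using conv_f[OF that] that by (simp add: \<Phi>_def convergent_LIMSEQ_iff)
  have \<Phi>_le: "norm (\<Phi> f) \<le> 1 * dual_norm UNIV N f" if "f \<in> dualZ" for f
    using fx[OF that] by (intro LIMSEQ_le_const2[OF tendsto_norm[OF \<Phi>_lim[OF that]]]) auto
  have "\<Phi> \<in> bidual UNIV sX N"
    unfolding bidual_def dual_space_def[of dualZ]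
  proof (intro CollectI conjI ballI allI impI)
    fix f g assume f: "f \<in> dualZ" and g: "g \<in> dualZ"
    have "(\<lambda>n. (f + g) (x n)) \<longlonglongrightarrow> \<Phi> f + \<Phi> g"
      using tendsto_add[OF \<Phi>_lim[OF f] \<Phi>_lim[OF g]] by simp
    then show "\<Phi> (f + g) = \<Phi> f + \<Phi> g"
      using \<Phi>_lim[OF dual.carrier_add[OF f g]] LIMSEQ_unique by blast
  next
    fix a f assume f: "f \<in> dualZ"
    have "(\<lambda>n. (fscale a f) (x n)) \<longlonglongrightarrow> a * \<Phi> f"
      using tendsto_mult_left[OF \<Phi>_lim[OF f]] by (simp add: fscale_def)
    then show "\<Phi> (fscale a f) = a * \<Phi> f"
      using \<Phi>_lim[OF dual.carrier_scale[OF f]] LIMSEQ_unique by blast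
  next
    show "\<exists>C. \<forall>f\<in>dualZ. norm (\<Phi> f) \<le> C * dual_norm UNIV N f" using \<Phi>_le by blast
  qed (simp add: \<Phi>_def)
  then obtain y where y: "\<Phi> = canonical UNIV sX N y" using bidual_eq by blast
  then have \<Phi>y: "\<Phi> f = f y" if "f \<in> dualZ" for f using that by (simp add: Z.canonical_apply)
  show ?thesis
  proof (rule that)
    show "N y \<le> 1" using \<Phi>_le \<Phi>y by (intro Z.seminorm_le_dual) auto
    show "(\<lambda>n. f (x n)) \<longlonglongrightarrow> f y" if "f \<in> dualZ" for f
      using \<Phi>_lim[OF that] \<Phi>y[OF that] by simp
  qed
qed

end

subsection \<open>Representation by a Bochner integral\<close>

text \<open>Boundedness gives a cluster point. A basic neighbourhood of it is visited infinitely
  often, so its test can only stabilise at true.\<close>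

lemma convergent_if_basis_tests_stabilise:
  fixes a :: "nat \<Rightarrow> 'k::{heine_borel, second_countable_topology}" and U :: "nat \<Rightarrow> 'k set"
  assumes "topological_basis (range U)" and "bounded (range a)"
    and stab: "\<And>i. \<exists>b. \<forall>\<^sub>F n in sequentially. (a n \<in> U i) = b"
  shows "convergent a"
proof -
  obtain l r where r: "strict_mono (r :: nat \<Rightarrow> nat)" "(a \<circ> r) \<longlonglongrightarrow> l"
    using bounded_imp_convergent_subsequence[OF assms(2)] by blast
  have "a \<longlonglongrightarrow> l"
  proof (rule topological_tendstoI)
    fix V assume V: "open V" "l \<in> V"
    then obtain i where i: "l \<in> U i" "U i \<subseteq> V"
      using topological_basisE[OF assms(1) V] by blast
    have oU: "open (U i)" using topological_basis_open[OF assms(1)] by blast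
    obtain b where b: "\<forall>\<^sub>F n in sequentially. (a n \<in> U i) = b" using stab by blast
    have "\<forall>\<^sub>F n in sequentially. a (r n) \<in> U i"
      using topological_tendstoD[OF r(2) oU i(1)] by simp
    moreover have "\<forall>\<^sub>F n in sequentially. (a (r n) \<in> U i) = b"
      using eventually_subseq[OF r(1) b] .
    ultimately have "\<forall>\<^sub>F n in sequentially. b" by eventually_elim auto
    then have b by simp
    then show "\<forall>\<^sub>F n in sequentially. a n \<in> V" using b i by (auto elim!: eventually_mono)
  qed
  then show ?thesis by (rule convergentI)
qed

context renormed_space
begin

text \<open>The normalised pairs get the weights \<open>N (x i) * N (y i) / c\<close>. The missing
  mass goes to \<open>(0, 0)\<close>, whose tensor is zero, so the measure is a probability and the
  cost is carried by \<open>c\<close> alone.\<close>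

lemma proj_norm_pmf_representation:
  assumes v: "v \<in> T" and c: "\<pi> v < c"
  shows "\<exists>p. finite (set_pmf p) \<and> set_pmf p \<subseteq> unit_ball N \<times> unit_ball N \<and>
    (\<forall>\<Phi>\<in>dualT. \<Phi> v = of_real c * (\<integral>z. \<Phi> (tens (fst z) (snd z)) \<partial>measure_pmf p))"
proof -
  obtain n :: nat and x y where v_eq: "v = (\<Sum>i<n. tens (x i) (y i))"
    and sum: "(\<Sum>i<n. N (x i) * N (y i)) < c"
    by (rule proj_norm_approx[OF v c])
  have c0: "c > 0" using proj_norm_nonneg[OF v] c by linarith
  \<comment> \<open>Index \<open>n\<close>, one past the representation, holds the slack.\<close>
  define q where "q i = (if i < n then N (x i) * N (y i) / c
      else if i = n then 1 - (\<Sum>i<n. N (x i) * N (y i)) / c else 0)" for i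
  have q0: "q i \<ge> 0" for i
    using sum c0 N_nonneg by (auto simp: q_def)
  have "(\<Sum>i\<le>n. q i) = (\<Sum>i<n. q i) + q n" by (simp add: lessThan_Suc_atMost[symmetric])
  also have "(\<Sum>i<n. q i) = (\<Sum>i<n. N (x i) * N (y i)) / c"
    by (simp add: q_def sum_divide_distrib)
  finally have q1: "(\<Sum>i\<le>n. q i) = 1" by (simp add: q_def)
  have "(\<integral>\<^sup>+i. ennreal (q i) \<partial>count_space UNIV) = (\<Sum>i\<le>n. ennreal (q i))"
    by (rule nn_integral_count_space') (auto simp: q_def)
  also have "\<dots> = ennreal (\<Sum>i\<le>n. q i)" using q0 by (intro sum_ennreal) auto
  finally have "(\<integral>\<^sup>+i. ennreal (q i) \<partial>count_space UNIV) = 1" by (simp add: q1)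
  then have pq: "pmf (embed_pmf q) i = q i" for i using q0 by (intro pmf_embed_pmf)
  define a where "a w = sX (of_real (1 / N w)) w" for w
  have Na: "N (a w) \<le> 1" for w using N_nonneg[of w] by (simp add: a_def N_scale norm_divide)
  have scale_a: "sX (of_real (N w)) (a w) = w" for w
  proof (cases "N w = 0")
    case True then show ?thesis using N_eq_0D by (simp add: a_def)
  next
    case False
    then have "of_real (N w) * of_real (1 / N w) = (1::'k)" by (simp flip: of_real_mult)
    then show ?thesis by (simp add: a_def del: of_real_divide)
  qed
  define G where "G i = (if i < n then (a (x i), a (y i)) else (0, 0))" for i
  define p where "p = map_pmf G (embed_pmf q)"
  have sub: "set_pmf (embed_pmf q) \<subseteq> {..n}"
    by (auto simp: set_pmf_iff pq q_def split: if_splits)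
  have "finite (set_pmf p)"
    using finite_subset[OF sub] by (simp add: p_def)
  moreover have "set_pmf p \<subseteq> unit_ball N \<times> unit_ball N"
    by (auto simp: p_def G_def unit_ball_def Na)
  moreover have "\<Phi> v = of_real c * (\<integral>z. \<Phi> (tens (fst z) (snd z)) \<partial>measure_pmf p)" if \<Phi>: "\<Phi> \<in> dualT" for \<Phi>
  proof -
    have G_term: "of_real c * (q i *\<^sub>R \<Phi> (tens (fst (G i)) (snd (G i)))) = \<Phi> (tens (x i) (y i))" if "i < n" for i
    proof -
      have "tens (x i) (y i) = tens (sX (of_real (N (x i))) (a (x i))) (sX (of_real (N (y i))) (a (y i)))"
        by (simp add: scale_a)
      also have "\<dots> = fscale (of_real (N (x i)) * of_real (N (y i))) (tens (a (x i)) (a (y i)))"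
        by (simp add: tensor_scale_left tensor_scale_right)
      finally have "\<Phi> (tens (x i) (y i)) = of_real (N (x i)) * of_real (N (y i)) * \<Phi> (tens (a (x i)) (a (y i)))"
        by (simp add: P.dual_spaceD(2)[OF \<Phi> tensor_in])
      then show ?thesis
        using that c0 by (simp add: G_def q_def scaleR_conv_of_real)
    qed
    have "(\<integral>z. \<Phi> (tens (fst z) (snd z)) \<partial>measure_pmf p)
        = (\<Sum>i\<le>n. pmf (embed_pmf q) i *\<^sub>R \<Phi> (tens (fst (G i)) (snd (G i))))"
      unfolding p_def integral_map_pmf by (rule integral_measure_pmf) (use sub in auto)
    also have "\<dots> = (\<Sum>i<n. q i *\<^sub>R \<Phi> (tens (fst (G i)) (snd (G i))))"
      by (simp add: pq lessThan_Suc_atMost[symmetric] G_def P.dual_space_zero[OF \<Phi>])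
    finally have "of_real c * (\<integral>z. \<Phi> (tens (fst z) (snd z)) \<partial>measure_pmf p)
        = (\<Sum>i<n. of_real c * (q i *\<^sub>R \<Phi> (tens (fst (G i)) (snd (G i)))))"
      by (simp only: sum_distrib_left)
    also have "\<dots> = (\<Sum>i<n. \<Phi> (tens (x i) (y i)))"
      by (intro sum.cong refl G_term) simp
    finally have "of_real c * (\<integral>z. \<Phi> (tens (fst z) (snd z)) \<partial>measure_pmf p) = (\<Sum>i<n. \<Phi> (tens (x i) (y i)))" .
    then show ?thesis by (simp add: v_eq P.dual_space_sum[OF \<Phi>] tensor_in)
  qed
  ultimately show ?thesis by blast
qed

text \<open>\<open>u\<close> is a weak limit of finite convex combinations of elementary tensors; coupling these
  makes the random vectors converge weakly at every point of the probability space.\<close>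

theorem ex_random_representation:
  assumes sep: "separable_space (euclidean :: 'a topology)" and refl: "reflexive_space sX N"
    and u: "u \<in> completion T fscale \<pi>"
  obtains \<Omega> :: "real measure" and x y where "prob_space \<Omega>"
    "\<And>\<omega>. \<omega> \<in> space \<Omega> \<Longrightarrow> N (x \<omega>) \<le> 1" "\<And>\<omega>. \<omega> \<in> space \<Omega> \<Longrightarrow> N (y \<omega>) \<le> 1"
    "\<And>f. f \<in> dualZ \<Longrightarrow> (\<lambda>\<omega>. f (x \<omega>)) \<in> borel_measurable \<Omega>"
    "\<And>f. f \<in> dualZ \<Longrightarrow> (\<lambda>\<omega>. f (y \<omega>)) \<in> borel_measurable \<Omega>"
    "\<And>f g. f \<in> dualZ \<Longrightarrow> g \<in> dualZ \<Longrightarrow>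
       u (rank_one f g) = of_real (bidual_norm T fscale \<pi> u) * (\<integral>\<omega>. f (x \<omega>) * g (y \<omega>) \<partial>\<Omega>)"
proof -
  define B where "B = unit_ball N"
  obtain h where h: "norming h" using ex_norming[OF sep] by blast
  have hd: "h j \<in> dualZ" and h_le: "norm (h j x) \<le> N x" for j x using h by (auto simp: norming_def)
  obtain \<U> :: "'k set set" where \<U>: "countable \<U>" "topological_basis \<U>"
    using ex_countable_basis by blast
  have "\<U> \<noteq> {}" using topological_basisE[OF \<U>(2), of UNIV 0] by auto
  then have U: "topological_basis (range (from_nat_into \<U>))"
    using \<U> range_from_nat_into by metis
  \<comment> \<open>A test is coded by a functional \<open>h j\<close>, a basic open set of scalars
    and a flag choosing the leg; together the tests detect convergence of every \<open>h j\<close>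
    on both legs.\<close>
  define t where "t k z = (case from_nat k of (j :: nat, i :: nat, b :: bool) \<Rightarrow>
      h j (if b then fst z else snd z) \<in> from_nat_into \<U> i)" for k and z :: "'a \<times> 'a"
  have t_test: "t (to_nat (j, i, b)) z \<longleftrightarrow> h j (if b then fst z else snd z) \<in> from_nat_into \<U> i" for j i b z
    by (simp add: t_def)
  let ?c = "bidual_norm T fscale \<pi> u"
  obtain w where w: "\<And>k. w k \<in> T"
    and wb: "\<And>k \<Phi>. \<Phi> \<in> dualT \<Longrightarrow> norm (u \<Phi> - \<Phi> (w k)) \<le> 1 / Suc k * dual_norm T \<pi> \<Phi>"
    and wn: "\<And>k. \<pi> (w k) < ?c + 1 / Suc k"
    using P.completionE[OF u] by metis
  define c where "c k = ?c + 1 / Suc k" for k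
  have "\<forall>k. \<exists>p. finite (set_pmf p) \<and> set_pmf p \<subseteq> B \<times> B \<and>
    (\<forall>\<Phi>\<in>dualT. \<Phi> (w k) = of_real (c k) * (\<integral>z. \<Phi> (tens (fst z) (snd z)) \<partial>measure_pmf p))"
    using proj_norm_pmf_representation[OF w wn] unfolding B_def c_def by blast
  from choice[OF this] obtain p where p: "\<And>k. finite (set_pmf (p k))" "\<And>k. set_pmf (p k) \<subseteq> B \<times> B"
    and pw: "\<And>k \<Phi>. \<Phi> \<in> dualT \<Longrightarrow>
      \<Phi> (w k) = of_real (c k) * (\<integral>z. \<Phi> (tens (fst z) (snd z)) \<partial>measure_pmf (p k))"
    by blast
  \<comment> \<open>Basic open sets separate scalars and the \<open>h j\<close> separate
    vectors.\<close>
  have sep_t: "z = z'" if eq: "\<And>k. t k z = t k z'" for z z'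
  proof -
    have side: "(if b then fst z else snd z) = (if b then fst z' else snd z')" for b
    proof (rule norming_separates[OF h])
      fix j
      show "h j (if b then fst z else snd z) = h j (if b then fst z' else snd z')" (is "?l = ?r")
      proof (rule ccontr)
        assume "?l \<noteq> ?r"
        then obtain V where V: "open V" "?l \<in> V" "?r \<notin> V" using t1_space by metis
        obtain i where "?l \<in> from_nat_into \<U> i" "from_nat_into \<U> i \<subseteq> V"
          using topological_basisE[OF U V(1,2)] by blast
        then show False using V eq[of "to_nat (j, i, b)"] unfolding t_test by blast
      qed
    qed
    show ?thesis using side[of True] side[of False] by (simp add: prod_eq_iff)
  qed
  obtain \<Omega> :: "real measure" and s Z where \<Omega>: "prob_space \<Omega>" and s: "strict_mono (s :: nat \<Rightarrow> nat)"
    and Zm: "\<And>n. Z n \<in> \<Omega> \<rightarrow>\<^sub>M count_space UNIV" and ZB: "\<And>n \<omega>. \<omega> \<in> space \<Omega> \<Longrightarrow> Z n \<omega> \<in> B \<times> B"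
    and stab: "\<And>\<omega> k. \<omega> \<in> space \<Omega> \<Longrightarrow> \<exists>b. \<forall>\<^sub>F n in sequentially. t k (Z n \<omega>) = b"
    and law: "\<And>n. distr \<Omega> (count_space UNIV) (Z n) = measure_pmf (p (s n))"
    using coupling[of p "B \<times> B" t] p sep_t by metis
  interpret \<Omega>: prob_space \<Omega> by (rule \<Omega>)
  have conv: "\<exists>a. N a \<le> 1 \<and> (\<forall>f\<in>dualZ. (\<lambda>n. f (if b then fst (Z n \<omega>) else snd (Z n \<omega>))) \<longlonglongrightarrow> f a)"
    if \<omega>: "\<omega> \<in> space \<Omega>" for \<omega> b
  proof -
    let ?z = "\<lambda>n. if b then fst (Z n \<omega>) else snd (Z n \<omega>)"
    have Nz: "N (?z n) \<le> 1" for n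
      using ZB[OF \<omega>, of n] by (auto simp: B_def unit_ball_def mem_Times_iff)
    have conv_h: "convergent (\<lambda>n. h j (?z n))" for j
    proof (rule convergent_if_basis_tests_stabilise[OF U])
      show "bounded (range (\<lambda>n. h j (?z n)))"
        using order_trans[OF h_le Nz] by (auto intro!: boundedI[of _ 1])
      show "\<exists>ba. \<forall>\<^sub>F n in sequentially. (h j (?z n) \<in> from_nat_into \<U> i) = ba" for i
        using stab[OF \<omega>, of "to_nat (j, i, b)"] unfolding t_test .
    qed
    show ?thesis
    proof (rule weakly_convergent_if_norming[OF refl h Nz conv_h])
      fix a assume "N a \<le> 1" "\<And>f. f \<in> dualZ \<Longrightarrow> (\<lambda>n. f (?z n)) \<longlonglongrightarrow> f a"
      then show ?thesis by blast
    qed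
  qed
  have "\<forall>\<omega>. \<exists>a. \<omega> \<in> space \<Omega> \<longrightarrow> N a \<le> 1 \<and> (\<forall>f\<in>dualZ. (\<lambda>n. f (fst (Z n \<omega>))) \<longlonglongrightarrow> f a)"
    using conv[of _ True] by auto
  then obtain x where x: "\<And>\<omega>. \<omega> \<in> space \<Omega> \<Longrightarrow> N (x \<omega>) \<le> 1"
    and xl: "\<And>\<omega> f. \<omega> \<in> space \<Omega> \<Longrightarrow> f \<in> dualZ \<Longrightarrow> (\<lambda>n. f (fst (Z n \<omega>))) \<longlonglongrightarrow> f (x \<omega>)"
    by metis
  have "\<forall>\<omega>. \<exists>a. \<omega> \<in> space \<Omega> \<longrightarrow> N a \<le> 1 \<and> (\<forall>f\<in>dualZ. (\<lambda>n. f (snd (Z n \<omega>))) \<longlonglongrightarrow> f a)"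
    using conv[of _ False] by auto
  then obtain y where y: "\<And>\<omega>. \<omega> \<in> space \<Omega> \<Longrightarrow> N (y \<omega>) \<le> 1"
    and yl: "\<And>\<omega> f. \<omega> \<in> space \<Omega> \<Longrightarrow> f \<in> dualZ \<Longrightarrow> (\<lambda>n. f (snd (Z n \<omega>))) \<longlonglongrightarrow> f (y \<omega>)"
    by metis
  have Z_meas: "(\<lambda>\<omega>. F (Z n \<omega>)) \<in> borel_measurable \<Omega>" for F :: "'a \<times> 'a \<Rightarrow> 'k" and n
    by (rule measurable_compose[OF Zm]) simp
  show ?thesis
  proof (rule that[OF \<Omega> x y])
    fix f assume f: "f \<in> dualZ"
    show "(\<lambda>\<omega>. f (x \<omega>)) \<in> borel_measurable \<Omega>"
      by (rule borel_measurable_LIMSEQ_metric[where f = "\<lambda>n \<omega>. f (fst (Z n \<omega>))"])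
        (auto intro: xl f Z_meas[of "\<lambda>z. f (fst z)"])
    show "(\<lambda>\<omega>. f (y \<omega>)) \<in> borel_measurable \<Omega>"
      by (rule borel_measurable_LIMSEQ_metric[where f = "\<lambda>n \<omega>. f (snd (Z n \<omega>))"])
        (auto intro: yl f Z_meas[of "\<lambda>z. f (snd z)"])
  next
    fix f g assume f: "f \<in> dualZ" and g: "g \<in> dualZ"
    note R = rank_one(1)[OF f g]
    let ?F = "\<lambda>z. f (fst z) * g (snd z)"
    have meas: "(\<lambda>\<omega>. ?F (Z n \<omega>)) \<in> borel_measurable \<Omega>" for n by (rule Z_meas)
    \<comment> \<open>The only place where the product structure of the form is used: both factors
      converge as scalars.\<close>
    have lim: "(\<lambda>n. ?F (Z n \<omega>)) \<longlonglongrightarrow> f (x \<omega>) * g (y \<omega>)" if "\<omega> \<in> space \<Omega>" for \<omega>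
      using that f g by (intro tendsto_mult xl yl)
    have "(\<lambda>n. \<integral>\<omega>. ?F (Z n \<omega>) \<partial>\<Omega>) \<longlonglongrightarrow> (\<integral>\<omega>. f (x \<omega>) * g (y \<omega>) \<partial>\<Omega>)"
    proof (rule integral_dominated_convergence[where w = "\<lambda>_. dual_norm UNIV N f * dual_norm UNIV N g"])
      show "(\<lambda>\<omega>. f (x \<omega>) * g (y \<omega>)) \<in> borel_measurable \<Omega>"
        by (rule borel_measurable_LIMSEQ_metric[where f = "\<lambda>n \<omega>. ?F (Z n \<omega>)", OF meas lim])
      show "AE \<omega> in \<Omega>. (\<lambda>n. ?F (Z n \<omega>)) \<longlonglongrightarrow> f (x \<omega>) * g (y \<omega>)" using lim by auto
      show "AE \<omega> in \<Omega>. norm (?F (Z n \<omega>)) \<le> dual_norm UNIV N f * dual_norm UNIV N g" for n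
      proof (rule AE_I2)
        fix \<omega> assume "\<omega> \<in> space \<Omega>"
        then have "N (fst (Z n \<omega>)) \<le> 1" "N (snd (Z n \<omega>)) \<le> 1"
          using ZB[of \<omega> n] by (auto simp: B_def unit_ball_def mem_Times_iff)
        then have "norm (f (fst (Z n \<omega>))) \<le> dual_norm UNIV N f * 1" "norm (g (snd (Z n \<omega>))) \<le> dual_norm UNIV N g * 1"
          using Z.dual_norm_nonneg[OF f] Z.dual_norm_nonneg[OF g]
          by (auto intro!: order_trans[OF Z.dual_norm_bound] mult_left_mono f g simp del: mult_1_right)
        then show "norm (?F (Z n \<omega>)) \<le> dual_norm UNIV N f * dual_norm UNIV N g"
          using Z.dual_norm_nonneg[OF f] by (auto simp: norm_mult intro!: mult_mono)
      qed
    qed (use meas in auto)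
    moreover have "(\<integral>\<omega>. ?F (Z n \<omega>) \<partial>\<Omega>) = (\<integral>z. ?F z \<partial>measure_pmf (p (s n)))" for n
      unfolding law[symmetric] by (rule integral_distr[OF Zm, symmetric]) simp
    moreover have cl: "(\<lambda>n. c (s n)) \<longlonglongrightarrow> ?c"
    proof -
      have "c \<longlonglongrightarrow> ?c + 0" unfolding c_def by (intro tendsto_intros LIMSEQ_Suc[OF lim_1_over_n])
      then show ?thesis using LIMSEQ_subseq_LIMSEQ[OF _ s] by (fastforce simp: o_def)
    qed
    ultimately have l1: "(\<lambda>n. of_real (c (s n)) * (\<integral>z. ?F z \<partial>measure_pmf (p (s n))))
        \<longlonglongrightarrow> of_real ?c * (\<integral>\<omega>. f (x \<omega>) * g (y \<omega>) \<partial>\<Omega>)"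
      by (intro tendsto_mult tendsto_of_real) auto
    have eq: "of_real (c (s n)) * (\<integral>z. ?F z \<partial>measure_pmf (p (s n))) = rank_one f g (w (s n))" for n
      using pw[OF R, of "s n"] by (simp add: rank_one(2)[OF f g])
    have l2: "(\<lambda>n. rank_one f g (w (s n))) \<longlonglongrightarrow> u (rank_one f g)"
    proof -
      have "(\<lambda>k. u (rank_one f g) - rank_one f g (w k)) \<longlonglongrightarrow> 0"
      proof (rule Lim_null_comparison)
        show "(\<lambda>k. 1 / Suc k * dual_norm T \<pi> (rank_one f g)) \<longlonglongrightarrow> 0"
          by (intro tendsto_mult_left_zero LIMSEQ_Suc[OF lim_1_over_n])
      qed (use wb[OF R] in auto)
      from tendsto_diff[OF tendsto_const[of "u (rank_one f g)"] this]
      have "(\<lambda>k. rank_one f g (w k)) \<longlonglongrightarrow> u (rank_one f g)" by simp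
      then show ?thesis using LIMSEQ_subseq_LIMSEQ[OF _ s] by (fastforce simp: o_def)
    qed
    show "u (rank_one f g) = of_real ?c * (\<integral>\<omega>. f (x \<omega>) * g (y \<omega>) \<partial>\<Omega>)"
      by (rule LIMSEQ_unique[OF l2 l1[unfolded eq]])
  qed
qed


section \<open>The Borel sets of the product of the balls\<close>

lemma norm_topology_eq: "norm_topology N = euclidean"
proof -
  interpret M: Metric_space UNIV "\<lambda>x y. N (x - y)"
  proof
    show "N (x - y) = N (y - x)" for x y using N_minus[of "x - y"] by simp
    show "(N (x - y) = 0) = (x = y)" for x y using N_eq_0D[of "x - y"] by auto
    show "N (x - z) \<le> N (x - y) + N (y - z)" for x y z using N_triangle[of "x - y" "y - z"] by simp
  qed (rule N_nonneg)
  obtain c C where cC: "c > 0" "C > 0" "\<And>x. c * norm x \<le> N x" "\<And>x. N x \<le> C * norm x"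
    using norm_equiv by blast
  have "openin M.mtopology U \<longleftrightarrow> open U" for U
  proof
    assume U: "openin M.mtopology U"
    show "open U"
      unfolding open_contains_ball
    proof
      fix x assume "x \<in> U"
      then obtain r where r: "r > 0" "M.mball x r \<subseteq> U" using U by (auto simp: M.openin_mtopology)
      have "ball x (r / C) \<subseteq> M.mball x r"
      proof
        fix y assume "y \<in> ball x (r / C)"
        then have "C * norm (x - y) < r" using cC(2) by (simp add: dist_norm pos_less_divide_eq mult.commute)
        then show "y \<in> M.mball x r" using cC(4)[of "x - y"] by (simp add: M.in_mball)
      qed
      then show "\<exists>e>0. ball x e \<subseteq> U" using r cC(2) by (intro exI[of _ "r / C"]) auto
    qed
  next
    assume U: "open U"
    show "openin M.mtopology U"
      unfolding M.openin_mtopology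
    proof (intro conjI allI impI)
      fix x assume "x \<in> U"
      then obtain r where r: "r > 0" "ball x r \<subseteq> U" using U open_contains_ball by blast
      have "M.mball x (c * r) \<subseteq> ball x r"
      proof
        fix y assume "y \<in> M.mball x (c * r)"
        then have "N (x - y) < c * r" by (simp add: M.in_mball)
        then have "c * norm (x - y) < c * r" using cC(3)[of "x - y"] by linarith
        then show "y \<in> ball x r" using cC(1) by (simp add: dist_norm)
      qed
      then show "\<exists>r>0. M.mball x r \<subseteq> U" using r cC(1) by (intro exI[of _ "c * r"]) auto
    qed simp
  qed
  then show ?thesis unfolding norm_topology_def by (simp add: topology_eq)
qed

abbreviation S :: "('a \<times> 'a) set" where
  "S \<equiv> unit_ball N \<times> unit_ball N"

abbreviation BB :: "('a \<times> 'a) measure" where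
  "BB \<equiv> balls_borel N N"

lemma balls_borel_eq: "BB = sigma S {V \<inter> S |V. open V}"
proof -
  have "{U. openin (top_of_set S) U} = {V \<inter> S |V. open V}" by (auto simp: openin_subtopology)
  then show ?thesis by (simp only: balls_borel_def norm_topology_eq prod_topology_euclidean)
qed

lemma space_balls_borel: "space BB = S"
  by (simp add: balls_borel_def space_measure_of_conv)

lemma open_in_balls_borel: "open V \<Longrightarrow> V \<inter> S \<in> sets BB"
  unfolding balls_borel_eq by (subst sets_measure_of) (auto intro: sigma_sets.Basic)

lemma continuous_measurable_balls_borel:
  fixes F :: "'a \<times> 'a \<Rightarrow> 'c::topological_space"
  assumes "continuous_on UNIV F"
  shows "F \<in> borel_measurable BB"
proof (rule borel_measurableI)
  fix V :: "'c set" assume "open V"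
  then have "open (F -` V)" using assms by (rule open_vimage)
  then show "F -` V \<inter> space BB \<in> sets BB"
    unfolding space_balls_borel by (rule open_in_balls_borel)
qed

lemma continuous_on_N: "continuous_on A N"
proof -
  obtain c C where cC: "c > 0" "C > 0" "\<And>x. c * norm x \<le> N x" "\<And>x. N x \<le> C * norm x"
    using norm_equiv by blast
  have "C-lipschitz_on A N"
  proof (rule lipschitz_onI)
    fix x y
    have "N x \<le> N (x - y) + N y" "N y \<le> N (x - y) + N x"
      using N_triangle[of "x - y" y] N_triangle[of "y - x" x] N_minus[of "x - y"] by auto
    then show "dist (N x) (N y) \<le> C * dist x y"
      using cC(4)[of "x - y"] by (simp add: dist_real_def dist_norm)
  qed (use cC in auto)
  then show ?thesis by (rule lipschitz_on_continuous_on)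
qed

section \<open>Discretisation by nearest points, and norm measurability from weak
  measurability\<close>

definition pdist :: "'a \<times> 'a \<Rightarrow> 'a \<times> 'a \<Rightarrow> real" where
  "pdist z z' = N (fst z - fst z') + N (snd z - snd z')"

lemma pdist_nonneg: "pdist z z' \<ge> 0"
  by (simp add: pdist_def N_nonneg)

lemma continuous_on_pdist: "continuous_on A (\<lambda>z. pdist z a)"
  unfolding pdist_def
  by (intro continuous_intros continuous_on_compose2[OF continuous_on_N[of UNIV]]) auto

text \<open>With the origin as point 0, the distance of a point of the balls to its nearest point is
  at most 2 at every stage, which gives a dominating constant.\<close>

lemma ex_dense_pairs:
  assumes "separable_space (euclidean :: 'a topology)"
  obtains d :: "nat \<Rightarrow> 'a \<times> 'a" where "d 0 = (0, 0)" "\<And>z e. e > 0 \<Longrightarrow> \<exists>j. pdist z (d j) < e"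
proof -
  obtain d :: "nat \<Rightarrow> 'a" where d: "\<And>x e. e > 0 \<Longrightarrow> \<exists>j. N (x - d j) < e"
    using ex_dense_sequence[OF assms] by blast
  define d' where "d' j = (case j of 0 \<Rightarrow> (0, 0) | Suc i \<Rightarrow> (d (fst (prod_decode i)), d (snd (prod_decode i))))" for j
  have "\<exists>j. pdist z (d' j) < e" if e: "e > 0" for z e
  proof -
    obtain i j where "N (fst z - d i) < e/2" "N (snd z - d j) < e/2"
      using d[of "e/2" "fst z"] d[of "e/2" "snd z"] e by auto
    then have "pdist z (d' (Suc (prod_encode (i, j)))) < e"
      by (simp add: pdist_def d'_def)
    then show ?thesis ..
  qed
  then show ?thesis using that[of d'] by (simp add: d'_def)
qed

text \<open>Index of a closest point among \<open>d 0\<close>, ..., \<open>d k\<close>, the earliest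
  one in case of ties. The recursion compares with one new point at a time, which makes
  measurability an induction.\<close>

primrec nearest :: "(nat \<Rightarrow> 'a \<times> 'a) \<Rightarrow> nat \<Rightarrow> 'a \<times> 'a \<Rightarrow> nat" where
  "nearest d 0 z = 0"
| "nearest d (Suc k) z = (if pdist z (d (Suc k)) < pdist z (d (nearest d k z)) then Suc k else nearest d k z)"

lemma nearest_le: "nearest d k z \<le> k"
  by (induction k) auto

lemma nearest_min: "j \<le> k \<Longrightarrow> pdist z (d (nearest d k z)) \<le> pdist z (d j)"
  by (induction k) (auto simp: le_Suc_eq)

text \<open>Both claims go through the induction together: the index changes on a set described by
  the minimal distance of the previous stage.\<close>

lemma nearest_measurable:
  "nearest d k \<in> BB \<rightarrow>\<^sub>M count_space UNIV" "(\<lambda>z. pdist z (d (nearest d k z))) \<in> borel_measurable BB"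
proof (induction k)
  case 0
  show "nearest d 0 \<in> BB \<rightarrow>\<^sub>M count_space UNIV"
    by (rule measurable_cong[THEN iffD2, of _ _ "\<lambda>_. 0"]) auto
  show "(\<lambda>z. pdist z (d (nearest d 0 z))) \<in> borel_measurable BB"
    by (simp add: continuous_measurable_balls_borel continuous_on_pdist)
next
  case (Suc k)
  have [measurable]: "(\<lambda>z. pdist z (d j)) \<in> borel_measurable BB" for j
    by (intro continuous_measurable_balls_borel continuous_on_pdist)
  note [measurable] = Suc
  have "(\<lambda>z. if pdist z (d (Suc k)) < pdist z (d (nearest d k z)) then Suc k else nearest d k z)
      \<in> BB \<rightarrow>\<^sub>M count_space UNIV" by measurable
  then show "nearest d (Suc k) \<in> BB \<rightarrow>\<^sub>M count_space UNIV"
    by (simp add: measurable_cong[of BB "nearest d (Suc k)"])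
  have "(\<lambda>z. min (pdist z (d (Suc k))) (pdist z (d (nearest d k z)))) \<in> borel_measurable BB" by measurable
  moreover have "pdist z (d (nearest d (Suc k) z)) = min (pdist z (d (Suc k))) (pdist z (d (nearest d k z)))" for z
    by simp
  ultimately show "(\<lambda>z. pdist z (d (nearest d (Suc k) z))) \<in> borel_measurable BB"
    by (simp only:)
qed

text \<open>Change one leg at a time. The approximating point need not lie in the balls; at distance
  at most 2 its first leg has norm at most 1 + 2, whence the constant 3.\<close>

lemma form_lipschitz:
  assumes \<Phi>: "\<Phi> \<in> dualT" and z: "N (fst z) \<le> 1" "N (snd z) \<le> 1" and z': "pdist z z' \<le> 2"
  shows "norm (\<Phi> (tens (fst z) (snd z)) - \<Phi> (tens (fst z') (snd z'))) \<le> (3 * pdist z z') * dual_norm T \<pi> \<Phi>"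
proof -
  let ?M = "dual_norm T \<pi> \<Phi>"
  have M: "?M \<ge> 0" by (rule P.dual_norm_nonneg[OF \<Phi>])
  have N1: "N (fst z') \<le> 3"
    using N_diff[of "fst z" "fst z - fst z'"] z z' N_nonneg[of "snd z - snd z'"] by (simp add: pdist_def)
  have "tens (fst z) (snd z) = tens (fst z - fst z') (snd z) + tens (fst z') (snd z - snd z') + tens (fst z') (snd z')"
    using tensor_add_left[of "fst z - fst z'" "fst z'" "snd z"] tensor_add_right[of "fst z'" "snd z - snd z'" "snd z'"]
    by (simp add: add.assoc)
  then have eq: "\<Phi> (tens (fst z) (snd z)) - \<Phi> (tens (fst z') (snd z'))
      = \<Phi> (tens (fst z - fst z') (snd z)) + \<Phi> (tens (fst z') (snd z - snd z'))"
    by (simp add: P.dual_spaceD(1)[OF \<Phi>] tensor_in P.carrier_add)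
  have 1: "norm (\<Phi> (tens (fst z - fst z') (snd z))) \<le> ?M * N (fst z - fst z') * 3"
    using z M N_nonneg by (intro order_trans[OF dualT_form(2)[OF \<Phi>]] mult_left_mono) auto
  have "norm (\<Phi> (tens (fst z') (snd z - snd z'))) \<le> ?M * N (fst z') * N (snd z - snd z')"
    by (rule dualT_form(2)[OF \<Phi>])
  also have "\<dots> \<le> ?M * 3 * N (snd z - snd z')"
    using N1 M N_nonneg by (intro mult_right_mono mult_left_mono) auto
  finally have "norm (\<Phi> (tens (fst z - fst z') (snd z)) + \<Phi> (tens (fst z') (snd z - snd z')))
      \<le> ?M * N (fst z - fst z') * 3 + ?M * 3 * N (snd z - snd z')"
    using 1 by (intro order_trans[OF norm_triangle_ineq] add_mono)
  then show ?thesis unfolding eq by (simp add: pdist_def algebra_simps)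
qed

text \<open>A Pettis argument. The norm distance to a fixed vector is a countable supremum of scalar
  functions, hence measurable, and by separability an open set is a countable union of balls for
  \<open>pdist\<close>.\<close>

lemma measurable_into_balls_borel:
  assumes sep: "separable_space (euclidean :: 'a topology)"
    and B: "\<And>\<omega>. \<omega> \<in> space \<Omega> \<Longrightarrow> N (x \<omega>) \<le> 1" "\<And>\<omega>. \<omega> \<in> space \<Omega> \<Longrightarrow> N (y \<omega>) \<le> 1"
    and x: "\<And>f. f \<in> dualZ \<Longrightarrow> (\<lambda>\<omega>. f (x \<omega>)) \<in> borel_measurable \<Omega>"
    and y: "\<And>f. f \<in> dualZ \<Longrightarrow> (\<lambda>\<omega>. f (y \<omega>)) \<in> borel_measurable \<Omega>"
  shows "(\<lambda>\<omega>. (x \<omega>, y \<omega>)) \<in> \<Omega> \<rightarrow>\<^sub>M BB"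
proof -
  obtain h where h: "norming h" using ex_norming[OF sep] by blast
  have hd: "h j \<in> dualZ" and h_le: "norm (h j v) \<le> N v" for j v using h by (auto simp: norming_def)
  have N_meas: "(\<lambda>\<omega>. N (v \<omega> - a)) \<in> borel_measurable \<Omega>"
    if v: "\<And>f. f \<in> dualZ \<Longrightarrow> (\<lambda>\<omega>. f (v \<omega>)) \<in> borel_measurable \<Omega>" for v and a :: 'a
  proof (rule borel_measurable_iff_le[THEN iffD2], rule allI)
    fix r
    have [measurable]: "(\<lambda>\<omega>. h j (v \<omega>)) \<in> borel_measurable \<Omega>" for j by (rule v[OF hd])
    have "{\<omega> \<in> space \<Omega>. N (v \<omega> - a) \<le> r} = {\<omega> \<in> space \<Omega>. \<forall>j. norm (h j (v \<omega>) - h j a) \<le> r}"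
    proof (intro set_eqI iffI; clarsimp)
      fix \<omega> j assume "N (v \<omega> - a) \<le> r"
      then show "norm (h j (v \<omega>) - h j a) \<le> r"
        using h_le[of j "v \<omega> - a"] by (simp add: Z.dual_space_diff[OF hd])
    next
      fix \<omega> assume "\<forall>j. norm (h j (v \<omega>) - h j a) \<le> r"
      then have "\<forall>j. norm (h j (v \<omega> - a)) \<le> r" by (simp add: Z.dual_space_diff[OF hd])
      then show "N (v \<omega> - a) \<le> r" using h by (auto simp: norming_def)
    qed
    also have "\<dots> \<in> sets \<Omega>" by measurable
    finally show "{\<omega> \<in> space \<Omega>. N (v \<omega> - a) \<le> r} \<in> sets \<Omega>" .
  qed
  obtain d :: "nat \<Rightarrow> 'a \<times> 'a" where d: "\<And>z e. e > 0 \<Longrightarrow> \<exists>j. pdist z (d j) < e"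
    using ex_dense_pairs[OF sep] by blast
  have [measurable]: "(\<lambda>\<omega>. pdist (x \<omega>, y \<omega>) (d j)) \<in> borel_measurable \<Omega>" for j
    unfolding pdist_def by (auto intro!: borel_measurable_add N_meas x y)
  obtain c C where cC: "c > 0" "C > 0" "\<And>x. c * norm x \<le> N x" "\<And>x. N x \<le> C * norm x"
    using norm_equiv by blast
  show ?thesis
    unfolding balls_borel_eq
  proof (rule measurable_measure_of)
    show "(\<lambda>\<omega>. (x \<omega>, y \<omega>)) \<in> space \<Omega> \<rightarrow> S" using B by (auto simp: unit_ball_def)
    fix U assume "U \<in> {V \<inter> S |V. open V}"
    then obtain V where V: "open V" "U = V \<inter> S" by blast
    define I where "I = {(j, n). \<forall>z. pdist z (d j) < 1 / Suc n \<longrightarrow> z \<in> V}"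
    have cover: "\<exists>(j, n)\<in>I. pdist z (d j) < 1 / Suc n" if zV: "z \<in> V" for z
    proof -
      obtain e where e: "e > 0" "ball z e \<subseteq> V" by (rule openE[OF V(1) zV])
      \<comment> \<open>Two points of one small ball are at \<open>pdist\<close> less than twice its
        radius; \<open>c\<close> converts \<open>N\<close> into the norm of the type.\<close>
      obtain n where n: "1 / Suc n < c * e / 2"
        using reals_Archimedean[of "c * e / 2"] cC(1) e(1) by (auto simp: inverse_eq_divide)
      obtain j where j: "pdist z (d j) < 1 / Suc n" using d[of "1 / Suc n" z] by auto
      have "z' \<in> V" if z': "pdist z' (d j) < 1 / Suc n" for z'
      proof -
        have "N (fst z - fst z') \<le> N (fst z - fst (d j)) + N (fst z' - fst (d j))"
          "N (snd z - snd z') \<le> N (snd z - snd (d j)) + N (snd z' - snd (d j))"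
          using N_diff[of "fst z - fst (d j)" "fst z' - fst (d j)"] N_diff[of "snd z - snd (d j)" "snd z' - snd (d j)"]
          by simp_all
        then have "N (fst z - fst z') + N (snd z - snd z') \<le> pdist z (d j) + pdist z' (d j)"
          by (simp add: pdist_def)
        also have "\<dots> < c * e" using j z' n by linarith
        finally have "c * (norm (fst z - fst z') + norm (snd z - snd z')) < c * e"
          using cC(3)[of "fst z - fst z'"] cC(3)[of "snd z - snd z'"] by (simp add: distrib_left)
        then have "norm (fst z - fst z') + norm (snd z - snd z') < e" using cC(1) by simp
        then have "dist z z' < e"
          using norm_Pair_le[of "fst z - fst z'" "snd z - snd z'"]
          by (simp add: dist_norm minus_prod_def)
        then show ?thesis using e(2) by auto
      qed
      then show ?thesis using j by (auto simp: I_def)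
    qed
    have "(\<lambda>\<omega>. (x \<omega>, y \<omega>)) -` U \<inter> space \<Omega> = {\<omega> \<in> space \<Omega>. (x \<omega>, y \<omega>) \<in> V}"
      using B unfolding V(2) by (auto simp: unit_ball_def)
    also have "\<dots> = (\<Union>q\<in>I. {\<omega> \<in> space \<Omega>. pdist (x \<omega>, y \<omega>) (d (fst q)) < 1 / Suc (snd q)})"
    proof (intro set_eqI iffI)
      fix \<omega> assume \<omega>: "\<omega> \<in> {\<omega> \<in> space \<Omega>. (x \<omega>, y \<omega>) \<in> V}"
      then show "\<omega> \<in> (\<Union>q\<in>I. {\<omega> \<in> space \<Omega>. pdist (x \<omega>, y \<omega>) (d (fst q)) < 1 / Suc (snd q)})"
        using cover[of "(x \<omega>, y \<omega>)"] by (auto simp: case_prod_beta)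
    next
      fix \<omega> assume "\<omega> \<in> (\<Union>q\<in>I. {\<omega> \<in> space \<Omega>. pdist (x \<omega>, y \<omega>) (d (fst q)) < 1 / Suc (snd q)})"
      then show "\<omega> \<in> {\<omega> \<in> space \<Omega>. (x \<omega>, y \<omega>) \<in> V}" by (auto simp: I_def)
    qed
    also have "\<dots> \<in> sets \<Omega>"
    proof (rule sets.countable_UN'')
      show "{\<omega> \<in> space \<Omega>. pdist (x \<omega>, y \<omega>) (d (fst q)) < 1 / Suc (snd q)} \<in> sets \<Omega>" if "q \<in> I" for q
        by measurable
    qed (rule countableI_type)
    finally show "(\<lambda>\<omega>. (x \<omega>, y \<omega>)) -` U \<inter> space \<Omega> \<in> sets \<Omega>" .
  qed auto
qed

text \<open>The measure is \<open>c\<close> times the law of the random pair. Its barycentre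
  \<open>E\<close> agrees with \<open>u\<close> on rank one forms, but the approximation property
  yields equality only for elements of the completion. Hence nearest-point simple integrals are
  built first: they place \<open>u - E\<close> in the completion, and afterwards they are the simple
  functions required by Bochner integrability.\<close>

theorem INA_pi_eq:
  assumes sep: "separable_space (euclidean :: 'a topology)" and reflexive: "reflexive_space sX N"
    and AP: "approximation_property sX"
  shows "INA_pi sX N sX N = ptensor_space sX N sX N"
proof
  show "INA_pi sX N sX N \<subseteq> ptensor_space sX N sX N" by (auto simp: INA_pi_def)
  show "ptensor_space sX N sX N \<subseteq> INA_pi sX N sX N"
  proof
    fix u assume "u \<in> ptensor_space sX N sX N"
    then have u: "u \<in> completion T fscale \<pi>" by (simp add: ptensor_space_def)
    let ?p = "bidual_norm T fscale \<pi>" and ?can = "canonical T fscale \<pi>"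
    define c where "c = ?p u"
    interpret bi: seminormed_space fscale "bidual T fscale \<pi>" ?p
      by (rule P.seminormed_space_bidual)
    have ub: "u \<in> bidual T fscale \<pi>" using u P.completion_subset_bidual by blast
    have c0: "c \<ge> 0" unfolding c_def by (rule bi.seminorm_nonneg[OF ub])
    obtain \<Omega> :: "real measure" and x y where \<Omega>: "prob_space \<Omega>"
      and B: "\<And>\<omega>. \<omega> \<in> space \<Omega> \<Longrightarrow> N (x \<omega>) \<le> 1" "\<And>\<omega>. \<omega> \<in> space \<Omega> \<Longrightarrow> N (y \<omega>) \<le> 1"
      and xm: "\<And>f. f \<in> dualZ \<Longrightarrow> (\<lambda>\<omega>. f (x \<omega>)) \<in> borel_measurable \<Omega>"
      and ym: "\<And>f. f \<in> dualZ \<Longrightarrow> (\<lambda>\<omega>. f (y \<omega>)) \<in> borel_measurable \<Omega>"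
      and rank1: "\<And>f g. f \<in> dualZ \<Longrightarrow> g \<in> dualZ \<Longrightarrow>
        u (rank_one f g) = of_real c * (\<integral>\<omega>. f (x \<omega>) * g (y \<omega>) \<partial>\<Omega>)"
      using ex_random_representation[OF sep reflexive u] unfolding c_def by blast
    interpret \<Omega>: prob_space \<Omega> by (rule \<Omega>)
    define W where "W \<omega> = (x \<omega>, y \<omega>)" for \<omega>
    have W[measurable]: "W \<in> \<Omega> \<rightarrow>\<^sub>M BB"
      unfolding W_def by (rule measurable_into_balls_borel[where x = x and y = y, OF sep B xm ym])
    have WS: "W \<omega> \<in> S" if "\<omega> \<in> space \<Omega>" for \<omega>
      using B that by (simp add: W_def unit_ball_def)
    obtain d :: "nat \<Rightarrow> 'a \<times> 'a" where d0: "d 0 = (0, 0)" and d: "\<And>z e. e > 0 \<Longrightarrow> \<exists>j. pdist z (d j) < e"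
      using ex_dense_pairs[OF sep] by blast
    define \<kappa> where "\<kappa> = nearest d"
    define m where "m k z = pdist z (d (\<kappa> k z))" for k z
    have \<kappa>_meas[measurable]: "\<kappa> k \<in> BB \<rightarrow>\<^sub>M count_space UNIV" for k
      unfolding \<kappa>_def by (rule nearest_measurable)
    have m_meas[measurable]: "m k \<in> borel_measurable BB" for k
      unfolding m_def[abs_def] \<kappa>_def by (rule nearest_measurable)
    have m0: "m k z \<ge> 0" for k z unfolding m_def by (rule pdist_nonneg)
    have m2: "m k z \<le> 2" if "z \<in> S" for k z
    proof -
      have "m k z \<le> pdist z (d 0)" unfolding m_def \<kappa>_def by (rule nearest_min) simp
      also have "\<dots> \<le> 2" using that by (auto simp: d0 pdist_def unit_ball_def)
      finally show ?thesis .
    qed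
    have m_lim: "(\<lambda>k. m k z) \<longlonglongrightarrow> 0" for z
    proof (rule LIMSEQ_I)
      fix e :: real assume "e > 0"
      then obtain j where "pdist z (d j) < e" using d by blast
      then have "m k z < e" if "k \<ge> j" for k
        using nearest_min[OF that, of z d] by (simp add: m_def \<kappa>_def)
      then show "\<exists>no. \<forall>k\<ge>no. norm (m k z - 0) < e" using m0 by auto
    qed
    \<comment> \<open>A single rate for three purposes: convergence of simple integrals to the
      barycentre, membership of \<open>Q\<close> in the completion, and the \<open>L1\<close>
      distance of the simple functions. The dominating constant is 3 times 2.\<close>
    define \<delta> where "\<delta> k = c * (\<integral>\<omega>. 3 * m k (W \<omega>) \<partial>\<Omega>)" for k
    have mW_int: "integrable \<Omega> (\<lambda>\<omega>. 3 * m k (W \<omega>))" for k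
      using m0 m2[OF WS] by (intro \<Omega>.integrable_const_bound[where B = 6]) auto
    have \<delta>_lim: "\<delta> \<longlonglongrightarrow> 0"
    proof -
      have "(\<lambda>k. \<integral>\<omega>. 3 * m k (W \<omega>) \<partial>\<Omega>) \<longlonglongrightarrow> (\<integral>\<omega>. 0 \<partial>\<Omega>)"
      proof (rule integral_dominated_convergence[where w = "\<lambda>_. 6"])
        show "AE \<omega> in \<Omega>. (\<lambda>k. 3 * m k (W \<omega>)) \<longlonglongrightarrow> 0"
          by (intro AE_I2 tendsto_mult_right_zero m_lim)
        show "AE \<omega> in \<Omega>. norm (3 * m k (W \<omega>)) \<le> 6" for k
          using m0 m2[OF WS] by (intro AE_I2) auto
      qed auto
      then show ?thesis unfolding \<delta>_def by (auto intro: tendsto_mult_right_zero)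
    qed
    let ?tz = "\<lambda>z. tens (fst z) (snd z)"
    have close: "norm (\<Phi> (?tz z) - \<Phi> (?tz (d (\<kappa> k z)))) \<le> (3 * m k z) * dual_norm T \<pi> \<Phi>"
      if "\<Phi> \<in> dualT" "z \<in> S" for \<Phi> z k
      using form_lipschitz[OF that(1), of z "d (\<kappa> k z)"] m2[OF that(2), of k] that(2)
      by (auto simp: m_def unit_ball_def)
    have k_meas: "(\<lambda>\<omega>. \<Phi> (?tz (d (\<kappa> k (W \<omega>))))) \<in> borel_measurable \<Omega>" for k and \<Phi> :: "_ \<Rightarrow> 'k"
      by (rule measurable_compose[OF measurable_compose[OF W \<kappa>_meas[of k]], where g = "\<lambda>j. \<Phi> (?tz (d j))"]) simp
    have \<Phi>W_meas: "(\<lambda>\<omega>. \<Phi> (?tz (W \<omega>))) \<in> borel_measurable \<Omega>" if \<Phi>: "\<Phi> \<in> dualT" for \<Phi>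
    proof (rule borel_measurable_LIMSEQ_metric[where f = "\<lambda>k \<omega>. \<Phi> (?tz (d (\<kappa> k (W \<omega>))))"])
      show "(\<lambda>\<omega>. \<Phi> (?tz (d (\<kappa> k (W \<omega>))))) \<in> borel_measurable \<Omega>" for k by (rule k_meas)
      fix \<omega> assume \<omega>: "\<omega> \<in> space \<Omega>"
      have "(\<lambda>k. \<Phi> (?tz (W \<omega>)) - \<Phi> (?tz (d (\<kappa> k (W \<omega>))))) \<longlonglongrightarrow> 0"
      proof (rule Lim_null_comparison)
        show "(\<lambda>k. (3 * m k (W \<omega>)) * dual_norm T \<pi> \<Phi>) \<longlonglongrightarrow> 0"
          by (intro tendsto_mult_left_zero tendsto_mult_right_zero m_lim)
        show "\<forall>\<^sub>F k in sequentially. norm (\<Phi> (?tz (W \<omega>)) - \<Phi> (?tz (d (\<kappa> k (W \<omega>)))))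
            \<le> (3 * m k (W \<omega>)) * dual_norm T \<pi> \<Phi>"
          by (intro always_eventually allI close \<Phi> WS \<omega>)
      qed
      from tendsto_diff[OF tendsto_const[of "\<Phi> (?tz (W \<omega>))"] this]
      show "(\<lambda>k. \<Phi> (?tz (d (\<kappa> k (W \<omega>))))) \<longlonglongrightarrow> \<Phi> (?tz (W \<omega>))" by simp
    qed
    have \<Phi>W_int: "integrable \<Omega> (\<lambda>\<omega>. \<Phi> (?tz (W \<omega>)))" if \<Phi>: "\<Phi> \<in> dualT" for \<Phi>
    proof (rule \<Omega>.integrable_const_bound[where B = "dual_norm T \<pi> \<Phi>"])
      show "AE \<omega> in \<Omega>. norm (\<Phi> (?tz (W \<omega>))) \<le> dual_norm T \<pi> \<Phi>"
      proof (rule AE_I2)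
        fix \<omega> assume "\<omega> \<in> space \<Omega>"
        then have "N (fst (W \<omega>)) * N (snd (W \<omega>)) \<le> 1"
          using WS[of \<omega>] N_nonneg by (auto simp: unit_ball_def mem_Times_iff intro!: mult_le_one)
        then have "dual_norm T \<pi> \<Phi> * (N (fst (W \<omega>)) * N (snd (W \<omega>))) \<le> dual_norm T \<pi> \<Phi> * 1"
          by (intro mult_left_mono P.dual_norm_nonneg[OF \<Phi>])
        then show "norm (\<Phi> (?tz (W \<omega>))) \<le> dual_norm T \<pi> \<Phi>"
          using dualT_form(2)[OF \<Phi>, of "fst (W \<omega>)" "snd (W \<omega>)"] by (simp add: mult.assoc)
      qed
    qed (rule \<Phi>W_meas[OF \<Phi>])
    have k_int: "integrable \<Omega> (\<lambda>\<omega>. \<Phi> (?tz (d (\<kappa> k (W \<omega>)))))" for k and \<Phi> :: "_ \<Rightarrow> 'k"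
    proof (rule \<Omega>.integrable_const_bound[where B = "\<Sum>j\<le>k. norm (\<Phi> (?tz (d j)))"])
      show "AE \<omega> in \<Omega>. norm (\<Phi> (?tz (d (\<kappa> k (W \<omega>))))) \<le> (\<Sum>j\<le>k. norm (\<Phi> (?tz (d j))))"
        using nearest_le[of d k]
        by (intro AE_I2 member_le_sum[where f = "\<lambda>j. norm (\<Phi> (?tz (d j)))"]) (auto simp: \<kappa>_def)
    qed (rule k_meas)
    define E where "E \<Phi> = of_real c * (\<integral>\<omega>. \<Phi> (?tz (W \<omega>)) \<partial>\<Omega>)" for \<Phi> :: "_ \<Rightarrow> 'k"
    define Ik where "Ik k \<Phi> = of_real c * (\<integral>\<omega>. \<Phi> (?tz (d (\<kappa> k (W \<omega>)))) \<partial>\<Omega>)" for k and \<Phi> :: "_ \<Rightarrow> 'k"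
    have E_Ik: "norm (E \<Phi> - Ik k \<Phi>) \<le> \<delta> k * dual_norm T \<pi> \<Phi>" if \<Phi>: "\<Phi> \<in> dualT" for \<Phi> k
    proof -
      have "E \<Phi> - Ik k \<Phi> = of_real c * (\<integral>\<omega>. \<Phi> (?tz (W \<omega>)) - \<Phi> (?tz (d (\<kappa> k (W \<omega>)))) \<partial>\<Omega>)"
        unfolding E_def Ik_def by (simp add: \<Phi>W_int[OF \<Phi>] k_int right_diff_distrib)
      then have "norm (E \<Phi> - Ik k \<Phi>)
          = c * norm (\<integral>\<omega>. \<Phi> (?tz (W \<omega>)) - \<Phi> (?tz (d (\<kappa> k (W \<omega>)))) \<partial>\<Omega>)"
        using c0 by (simp add: norm_mult)
      also have "\<dots> \<le> c * (\<integral>\<omega>. (3 * m k (W \<omega>)) * dual_norm T \<pi> \<Phi> \<partial>\<Omega>)"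
      proof (rule mult_left_mono[OF _ c0])
        show "norm (\<integral>\<omega>. \<Phi> (?tz (W \<omega>)) - \<Phi> (?tz (d (\<kappa> k (W \<omega>)))) \<partial>\<Omega>)
            \<le> (\<integral>\<omega>. (3 * m k (W \<omega>)) * dual_norm T \<pi> \<Phi> \<partial>\<Omega>)"
          by (rule order_trans[OF integral_norm_bound integral_mono])
            (use \<Phi>W_int[OF \<Phi>] k_int mW_int close[OF \<Phi> WS] in auto)
      qed
      also have "(\<integral>\<omega>. (3 * m k (W \<omega>)) * dual_norm T \<pi> \<Phi> \<partial>\<Omega>) = (\<integral>\<omega>. 3 * m k (W \<omega>) \<partial>\<Omega>) * dual_norm T \<pi> \<Phi>"
        by (rule integral_mult_left_zero)
      finally show ?thesis by (simp add: \<delta>_def mult.assoc)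
    qed
    define M where "M = scale_measure (ennreal c) (distr \<Omega> BB W)"
    have sp: "space M = S" by (simp add: M_def space_scale_measure space_balls_borel)
    have se: "sets M = sets BB" by (simp add: M_def)
    have meas_M: "measure M A = c * measure \<Omega> (W -` A \<inter> space \<Omega>)" if "A \<in> sets BB" for A
      using that c0 by (simp add: M_def measure_distr[OF W])
    \<comment> \<open>Transfers integrals of simple functions under \<open>M\<close> to the
      probability space, one scalar observable \<open>G\<close> at a time. It is used for the index
      map \<open>\<kappa> k\<close> and for the vector valued \<open>g k\<close>.\<close>
    have simple_sum: "(\<Sum>v\<in>g ` S. of_real (measure M (g -` {v} \<inter> S)) * G v)
        = of_real c * (\<integral>\<omega>. G (g (W \<omega>)) \<partial>\<Omega>)"
      if g: "simple_function M g" for g :: "'a \<times> 'a \<Rightarrow> 'v" and G :: "'v \<Rightarrow> 'k"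
    proof -
      have fin: "finite (g ` S)" using g by (simp add: simple_function_def sp)
      have gset: "g -` {v} \<inter> S \<in> sets BB" for v
      proof (cases "v \<in> g ` S")
        case True then show ?thesis using g by (auto simp: simple_function_def sp se)
      next
        case False
        then have "g -` {v} \<inter> S = {}" by auto
        then show ?thesis by simp
      qed
      define A where "A v = W -` (g -` {v} \<inter> S) \<inter> space \<Omega>" for v
      have A[measurable]: "A v \<in> sets \<Omega>" for v
        unfolding A_def by (rule measurable_sets[OF W gset])
      have A_int: "integrable \<Omega> (indicat_real (A v))" for v
        by (rule integrable_real_indicator[OF A]) (simp add: \<Omega>.emeasure_eq_measure)
      have "(\<integral>\<omega>. G (g (W \<omega>)) \<partial>\<Omega>) = (\<integral>\<omega>. (\<Sum>v\<in>g ` S. indicat_real (A v) \<omega> *\<^sub>R G v) \<partial>\<Omega>)"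
      proof (rule Bochner_Integration.integral_cong[OF refl])
        fix \<omega> assume \<omega>: "\<omega> \<in> space \<Omega>"
        have "(\<Sum>v\<in>g ` S. indicat_real (A v) \<omega> *\<^sub>R G v) = (\<Sum>v\<in>g ` S. if v = g (W \<omega>) then G v else 0)"
          using \<omega> WS[OF \<omega>] by (intro sum.cong) (auto simp: A_def indicator_def)
        then show "G (g (W \<omega>)) = (\<Sum>v\<in>g ` S. indicat_real (A v) \<omega> *\<^sub>R G v)"
          using fin WS[OF \<omega>] by simp
      qed
      also have "\<dots> = (\<Sum>v\<in>g ` S. (\<integral>\<omega>. indicat_real (A v) \<omega> *\<^sub>R G v \<partial>\<Omega>))"
        by (rule Bochner_Integration.integral_sum)
          (auto intro!: integrable_scaleR_left A_int)
      also have "\<dots> = (\<Sum>v\<in>g ` S. measure \<Omega> (A v) *\<^sub>R G v)"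
        by (intro sum.cong refl) (simp add: integral_scaleR_left[OF A_int])
      finally show ?thesis
        by (simp add: meas_M[OF gset] A_def sum_distrib_left scaleR_conv_of_real mult.assoc)
    qed
    have \<kappa>_simple: "simple_function M (\<kappa> k)" for k
    proof -
      have "finite (\<kappa> k ` space M)"
        by (rule finite_subset[of _ "{..k}"]) (auto simp: \<kappa>_def nearest_le)
      moreover have "\<kappa> k -` {v} \<inter> space M \<in> sets M" for v
        using measurable_sets[OF \<kappa>_meas, of "{v}" k] by (simp add: se sp space_balls_borel)
      ultimately show ?thesis by (simp add: simple_function_def)
    qed
    \<comment> \<open>The simple integral of stage \<open>k\<close> inside the algebraic tensor
      product, as \<open>P.completionI\<close> asks for approximants from \<open>T\<close>.\<close>
    define i where "i k = (\<Sum>j\<in>\<kappa> k ` S. fscale (of_real (measure M (\<kappa> k -` {j} \<inter> S))) (?tz (d j)))" for k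
    have iT: "i k \<in> T" for k
      unfolding i_def by (intro P.carrier_sum P.carrier_scale tensor_in)
    have \<Phi>i: "\<Phi> (i k) = Ik k \<Phi>" if \<Phi>: "\<Phi> \<in> dualT" for \<Phi> k
      unfolding i_def Ik_def using simple_sum[OF \<kappa>_simple[of k], of "\<lambda>j. \<Phi> (?tz (d j))"]
      by (simp add: P.dual_space_sum[OF \<Phi>] P.carrier_scale tensor_in P.dual_spaceD(2)[OF \<Phi>])
    obtain w where w: "\<And>k. w k \<in> T"
      and wb: "\<And>k \<Phi>. \<Phi> \<in> dualT \<Longrightarrow> norm (u \<Phi> - \<Phi> (w k)) \<le> 1 / Suc k * dual_norm T \<pi> \<Phi>"
      using P.completionE[OF u] by metis
    \<comment> \<open>The difference of \<open>u\<close> and the barycentre: it vanishes on rank one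
      forms by the choice of the random pair.\<close>
    define Q where "Q \<Phi> = (if \<Phi> \<in> dualT then u \<Phi> - E \<Phi> else 0)" for \<Phi>
    have Q: "Q \<in> completion T fscale \<pi>"
    proof (rule P.completionI(1)[where w = "\<lambda>k. w k - i k" and e = "\<lambda>k. 1 / Suc k + \<delta> k"])
      show "w k - i k \<in> T" for k by (rule P.carrier_diff[OF w iT])
      show "Q \<Phi> = 0" if "\<Phi> \<notin> dualT" for \<Phi> using that by (simp add: Q_def)
      show "(\<lambda>k. 1 / Suc k + \<delta> k) \<longlonglongrightarrow> 0"
        using tendsto_add[OF LIMSEQ_Suc[OF lim_1_over_n] \<delta>_lim] by simp
      fix k \<Phi> assume \<Phi>: "\<Phi> \<in> dualT"
      have eq: "Q \<Phi> - \<Phi> (w k - i k) = (u \<Phi> - \<Phi> (w k)) - (E \<Phi> - Ik k \<Phi>)"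
        using \<Phi> by (simp add: Q_def P.dual_space_diff[OF \<Phi> w iT] \<Phi>i)
      have "norm (Q \<Phi> - \<Phi> (w k - i k)) \<le> 1 / Suc k * dual_norm T \<pi> \<Phi> + \<delta> k * dual_norm T \<pi> \<Phi>"
        unfolding eq by (rule order_trans[OF norm_triangle_ineq4 add_mono[OF wb[OF \<Phi>] E_Ik[OF \<Phi>]]])
      then show "norm (Q \<Phi> - \<Phi> (w k - i k)) \<le> (1 / Suc k + \<delta> k) * dual_norm T \<pi> \<Phi>"
        by (simp add: distrib_right)
    qed
    have "Q (rank_one f g) = 0" if f: "f \<in> dualZ" and g: "g \<in> dualZ" for f g
      using rank1[OF f g] by (simp add: Q_def E_def rank_one(1)[OF f g] rank_one(2)[OF f g] W_def)
    then have Q0: "Q \<Phi> = 0" if "\<Phi> \<in> dualT" for \<Phi>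
      using approximation_property_imp_determined[OF AP Q _ that] by blast
    have uE: "u \<Phi> = E \<Phi>" if "\<Phi> \<in> dualT" for \<Phi>
      using Q0[OF that] that by (simp add: Q_def)
    define g where "g k z = ?can (?tz (d (\<kappa> k z)))" for k z
    have g_simple: "simple_function M (g k)" for k
      unfolding g_def[abs_def] by (rule simple_function_compose1[OF \<kappa>_simple])
    have g_in: "g k z \<in> completion T fscale \<pi>" for k z
      unfolding g_def by (rule P.canonical_in_completion[OF tensor_in])
    \<comment> \<open>The norm of the completion is a supremum over functionals, so the scalar
      estimate \<open>close\<close> is already the norm estimate.\<close>
    have near: "?p (?can (?tz z) - g k z) \<le> 3 * m k z" if "z \<in> S" for z k
      using m0[of k z] close[OF _ that] by (intro P.bidual_norm_le) (auto simp: g_def P.canonical_apply)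
    have near0: "0 \<le> ?p (?can (?tz z) - g k z)" for z k
      unfolding g_def by (intro bi.seminorm_nonneg bi.carrier_diff P.canonical_in_bidual tensor_in)
    have fin: "finite_measure M"
    proof
      show "emeasure M (space M) \<noteq> \<infinity>"
        using c0 by (simp add: M_def space_scale_measure emeasure_distr \<Omega>.emeasure_eq_measure ennreal_mult_eq_top_iff)
    qed
    have "has_bochner_integral_in (completion T fscale \<pi>) fscale ?p M (\<lambda>(x, y). ?can (tens x y)) u"
      unfolding has_bochner_integral_in_def
    proof (intro conjI exI allI)
      show "u \<in> completion T fscale \<pi>" by (rule u)
      show "(\<lambda>(x, y). ?can (tens x y)) ` space M \<subseteq> completion T fscale \<pi>"
        by (auto intro: P.canonical_in_completion tensor_in)
      show "simple_function M (g k)" "g k ` space M \<subseteq> completion T fscale \<pi>" for k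
        using g_simple g_in by auto
      then show "simple_function M (g k)" "g k ` space M \<subseteq> completion T fscale \<pi>" for k by auto
      show "AE z in M. (\<lambda>k. ?p ((case z of (x, y) \<Rightarrow> ?can (tens x y)) - g k z)) \<longlonglongrightarrow> 0"
      proof (rule AE_I2)
        fix z assume "z \<in> space M"
        then have z: "z \<in> S" by (simp add: sp)
        have "(\<lambda>k. ?p (?can (?tz z) - g k z)) \<longlonglongrightarrow> 0"
          by (rule tendsto_sandwich[where f = "\<lambda>_. 0" and h = "\<lambda>k. 3 * m k z"])
            (auto intro!: always_eventually near0 near[OF z] tendsto_mult_right_zero m_lim)
        then show "(\<lambda>k. ?p ((case z of (x, y) \<Rightarrow> ?can (tens x y)) - g k z)) \<longlonglongrightarrow> 0"
          by (simp add: case_prod_beta)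
      qed
      show "(\<lambda>k. \<integral>\<^sup>+ z. ennreal (?p ((case z of (x, y) \<Rightarrow> ?can (tens x y)) - g k z)) \<partial>M) \<longlonglongrightarrow> 0"
      proof (rule tendsto_sandwich[where f = "\<lambda>_. 0" and h = "\<lambda>k. ennreal (\<delta> k)"])
        show "(\<lambda>k. ennreal (\<delta> k)) \<longlonglongrightarrow> 0"
          using tendsto_ennrealI[OF \<delta>_lim] by simp
        have "(\<integral>\<^sup>+ z. ennreal (?p ((case z of (x, y) \<Rightarrow> ?can (tens x y)) - g k z)) \<partial>M) \<le> ennreal (\<delta> k)" for k
        proof -
          have "(\<integral>\<^sup>+ z. ennreal (?p ((case z of (x, y) \<Rightarrow> ?can (tens x y)) - g k z)) \<partial>M)
              \<le> (\<integral>\<^sup>+ z. ennreal (3 * m k z) \<partial>M)"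
            using near by (intro nn_integral_mono ennreal_leI) (simp add: sp case_prod_beta)
          also have "\<dots> = ennreal c * (\<integral>\<^sup>+ z. ennreal (3 * m k z) \<partial>distr \<Omega> BB W)"
            unfolding M_def by (rule nn_integral_scale_measure) measurable
          also have "(\<integral>\<^sup>+ z. ennreal (3 * m k z) \<partial>distr \<Omega> BB W) = (\<integral>\<^sup>+ \<omega>. ennreal (3 * m k (W \<omega>)) \<partial>\<Omega>)"
            by (rule nn_integral_distr) measurable
          also have "\<dots> = ennreal (\<integral>\<omega>. 3 * m k (W \<omega>) \<partial>\<Omega>)"
            using m0 by (intro nn_integral_eq_integral mW_int) auto
          also have "ennreal c * \<dots> = ennreal (\<delta> k)"
            unfolding \<delta>_def using c0 by (simp add: ennreal_mult')
          finally show ?thesis .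
        qed
        then show "\<forall>\<^sub>F k in sequentially. (\<integral>\<^sup>+ z. ennreal (?p ((case z of (x, y) \<Rightarrow> ?can (tens x y)) - g k z)) \<partial>M)
            \<le> ennreal (\<delta> k)" by simp
      qed auto
      show "(\<lambda>k. ?p (u - simple_integral_in fscale M (g k))) \<longlonglongrightarrow> 0"
      proof (rule tendsto_sandwich[where f = "\<lambda>_. 0" and h = \<delta>])
        show "\<forall>\<^sub>F k in sequentially. 0 \<le> ?p (u - simple_integral_in fscale M (g k))"
          unfolding simple_integral_in_def using g_in P.completion_subset_bidual
          by (intro always_eventually allI bi.seminorm_nonneg bi.carrier_diff ub bi.carrier_sum bi.carrier_scale) auto
        have "?p (u - simple_integral_in fscale M (g k)) \<le> \<delta> k" for k
        proof (rule P.bidual_norm_le)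
          show "\<delta> k \<ge> 0" unfolding \<delta>_def using c0 m0 by (intro mult_nonneg_nonneg integral_nonneg) auto
          fix \<Phi> assume \<Phi>: "\<Phi> \<in> dualT"
          have "simple_integral_in fscale M (g k) \<Phi> = of_real c * (\<integral>\<omega>. (g k (W \<omega>)) \<Phi> \<partial>\<Omega>)"
            using simple_sum[OF g_simple[of k], of "\<lambda>v. v \<Phi>"]
            by (simp add: simple_integral_in_def sum_fun_apply fscale_def sp)
          also have "\<dots> = Ik k \<Phi>" using \<Phi> by (simp add: Ik_def g_def P.canonical_apply)
          finally show "norm ((u - simple_integral_in fscale M (g k)) \<Phi>) \<le> \<delta> k * dual_norm T \<pi> \<Phi>"
            using E_Ik[OF \<Phi>, of k] by (simp add: uE[OF \<Phi>])
        qed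
        then show "\<forall>\<^sub>F k in sequentially. ?p (u - simple_integral_in fscale M (g k)) \<le> \<delta> k" by simp
      qed (use \<delta>_lim in auto)
    qed
    moreover have "?p u = measure M (space M)"
    proof -
      have "W -` S \<inter> space \<Omega> = space \<Omega>" using WS by auto
      then show ?thesis
        using meas_M[of S] sets.top[of BB] by (simp add: sp space_balls_borel \<Omega>.prob_space c_def)
    qed
    ultimately show "u \<in> INA_pi sX N sX N"
      using u sp se fin
      unfolding INA_pi_def ptensor_space_def ptensor_norm_def ptensor_def by blast
  qed
qed

end

theorem corollary4:
  fixes sX :: "'k::real_or_complex \<Rightarrow> 'a::banach \<Rightarrow> 'a"
  assumes "banach_space_over sX"
    and "infinite_dimensional sX"
    and "separable_space (euclidean :: 'a topology)"
    and "reflexive_space sX norm"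
    and "approximation_property sX"
  shows "\<exists>N. equivalent_norm sX N \<and>
           NA_pi sX N sX N \<subset> INA_pi sX N sX N \<and>
           INA_pi sX N sX N = ptensor_space sX N sX N"
proof -
  obtain N e r C where "face_norm sX N e r C"
    using ex_face_norm[OF assms(1,2)] by blast
  then interpret face_norm sX N e r C .
  have INA: "INA_pi sX N sX N = ptensor_space sX N sX N"
    using assms(3) reflexive_space_renorm[OF assms(4)] assms(5) by (rule INA_pi_eq)
  have "NA_pi sX N sX N \<subseteq> ptensor_space sX N sX N" by (auto simp: NA_pi_def)
  moreover have "diagonal \<in> ptensor_space sX N sX N"
    unfolding ptensor_space_def by (rule diagonal_in_completion)
  ultimately have "NA_pi sX N sX N \<subset> INA_pi sX N sX N"
    unfolding INA using diagonal_not_norm_attaining by blast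
  then show ?thesis using equivalent_norm INA by blast
qed

end
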